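(* Let $\mathfrak{g}$ be a complex simple Lie algebra with Cartan subalgebra $\mathfrak{h}$, root system $R$, positive roots $R^+$, co-weight lattice $P^\vee\subset\mathfrak{h}$, a Chevalley involution $\sigma$ relative to $\mathfrak{h}$, and root vectors $e_\alpha\in\mathfrak{g}_\alpha$ with $[e_\alpha,e_{-\alpha}]=t_\alpha$ and $\sigma(e_\alpha)=-e_{-\alpha}$ for all $\alpha\in R$. Fix $\overline y=y+2\pi iP^\vee\in\mathfrak{h}/2\pi iP^\vee$, let $\sigma_{\overline y}:=\sigma\circ\mathrm{Ad}_y$, and let $\mathfrak{g}^+_{\sigma_{\overline y}}$ be the fixed point Lie subalgebra of $\sigma_{\overline y}$. Put $$r_{\mathrm{Ga}}:=\tfrac12\varpi_{\mathfrak h}+\sum_{\alpha\in R^+}e_\alpha\otimes e_{-\alpha},\qquad \widetilde r_{\mathrm{Ga}}(\overline y):=(\sigma_{\overline y}\otimes\mathrm{id})(r_{\mathrm{Ga}})=-\tfrac12\varpi_{\mathfrak h}-\sum_{\alpha\in R^+}e^{\alpha(y)}e_{-\alpha}\otimes e_{-\alpha},$$ $$r^+_{\mathrm{Ga}}(\overline y):=\tfrac12\bigl(\widetilde r_{\mathrm{Ga}}(\overline y)+r_{\mathrm{Ga}}\bigr)=\tfrac12\sum_{\alpha\in R^+}(e_\alpha-e^{\alpha(y)}e_{-\alpha})\otimes e_{-\alpha}\in\mathfrak{g}^+_{\sigma_{\overline y}}\otimes\mathfrak{g},$$ $$\kappa^{\mathrm{core}}_{\mathrm{Ga}}(\overline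 y):=\tfrac12 m(\widetilde r_{\mathrm{Ga}}(\overline y))=-\tfrac14 m(\varpi_{\mathfrak h})-\tfrac12\sum_{\alpha\in R^+}e^{\alpha(y)}e_{-\alpha}^2\in U(\mathfrak{g}).$$ Let $N\ge1$, label the tensor components of $U(\mathfrak{g}^+_{\sigma_{\overline y}})\otimes U(\mathfrak{g})^{\otimes N}\otimes U(\mathfrak{g}^+_{\sigma_{\overline y}})$ by $0,1,\dots,N,0'$, and let $\kappa_{\mathrm{Ga};i}(\overline y)$ be given, for all $1\le i\le N$ simultaneously, by one of the three choices $$\kappa^{\mathrm{core}}_{\mathrm{Ga}}(\overline y)_i+r^+_{\mathrm{Ga}}(\overline y)_{0i},\qquad \kappa^{\mathrm{core}}_{\mathrm{Ga}}(\overline y)_i+r^+_{\mathrm{Ga}}(\overline y)_{0'i},\qquad \kappa^{\mathrm{core}}_{\mathrm{Ga}}(\overline y)_i+r^+_{\mathrm{Ga}}(\overline y)_{0i}+r^+_{\mathrm{Ga}}(\overline y)_{0'i}.$$ Then the elements $$A^{(N)}_{\mathrm{Ga};i}(\overline y):=-\frac12\sum_{s=i+1}^N\varpi_{is}+\Bigl(\kappa_{\mathrm{Ga};i}(\overline y)+\frac12\sum_{s\ne i}r_{\mathrm{Ga};si}+\frac12\sum_{s\ne i}\widetilde r_{\mathrm{Ga};si}(\overline y)\Bigr),\qquad i=1,\dots,N,$$ (sums over $s\in\{1,\dots,N\}$) of $U(\mathfrak{g}^+_{\sigma_{\overline y}})\otimes U(\mathfrak{g})^{\otimes N}\otimes U(\mathfrak{g}^+_{\sigma_{\overline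 y}})$ pairwise commute.
   Context: $(\cdot,\cdot)$ is the restriction of the Killing form $K$ of $\mathfrak{g}$ to $\mathfrak{h}$; for $\nu\in\mathfrak{h}^*$, $t_\nu\in\mathfrak{h}$ is defined by $\nu(\cdot)=(t_\nu,\cdot)$. A Chevalley involution relative to $\mathfrak{h}$ is an involutive automorphism $\sigma$ of $\mathfrak{g}$ with $\sigma|_{\mathfrak{h}}=-\mathrm{id}_{\mathfrak{h}}$. For $y\in\mathfrak{h}$, $\mathrm{Ad}_y\in\mathrm{Aut}(\mathfrak{g})$ acts as the identity on $\mathfrak{h}$ and as $e^{\alpha(y)}$ on $\mathfrak{g}_\alpha$ ($\alpha\in R$); it depends only on $y$ modulo $2\pi iP^\vee$, where $P^\vee=\{h\in\mathfrak{h}:\alpha(h)\in\mathbb{Z}\ \forall\alpha\in R\}$. $\varpi_{\mathfrak h}=\sum_j x_j\otimes x_j$ for a basis $\{x_j\}$ of $\mathfrak{h}$ with $(x_i,x_j)=\delta_{ij}$, and $\varpi=\varpi_{\mathfrak h}+\sum_{\alpha\in R}e_{-\alpha}\otimes e_\alpha$ is the mixed Casimir element. $m$ is the multiplication map of $U(\mathfrak{g})$. Subscripts indicate placement: $z_{ij}$ has the first tensor component of $z$ in position $i$, the second in position $j$, and $1$ elsewhere ($r_{\mathrm{Ga};si}=(r_{\mathrm{Ga}})_{si}$, etc.). *)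

theory Defs
  imports Complex_Main "HOL-Library.Poly_Mapping" "HOL-Library.FuncSet"
    "HOL-Algebra.QuotRing" "HOL-Algebra.Module"
begin

section \<open>Complex vector spaces\<close>

class complex_vec = ab_group_add +
  fixes cscale :: "complex \<Rightarrow> 'a \<Rightarrow> 'a" (infixr \<open>*\<^sub>C\<close> 75)
  assumes cscale_add_right: "a *\<^sub>C (x + y) = a *\<^sub>C x + a *\<^sub>C y"
    and cscale_add_left: "(a + b) *\<^sub>C x = a *\<^sub>C x + b *\<^sub>C x"
    and cscale_assoc: "a *\<^sub>C b *\<^sub>C x = (a * b) *\<^sub>C x"
    and cscale_one: "1 *\<^sub>C x = x"

global_interpretation cvec: vector_space "cscale :: complex \<Rightarrow> 'a \<Rightarrow> 'a::complex_vec"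
  by unfold_locales (fact cscale_add_right cscale_add_left cscale_assoc cscale_one)+

instantiation complex :: complex_vec
begin
definition cscale_complex :: "complex \<Rightarrow> complex \<Rightarrow> complex" where
  "cscale_complex c z = c * z"
instance by standard (simp_all add: cscale_complex_def algebra_simps)
end

instantiation poly_mapping :: (type, complex_vec) complex_vec
begin
definition cscale_poly_mapping :: "complex \<Rightarrow> ('a \<Rightarrow>\<^sub>0 'b) \<Rightarrow> ('a \<Rightarrow>\<^sub>0 'b)" where
  "cscale_poly_mapping c p = Poly_Mapping.map (cscale c) p"
lemma lookup_cscale:
  "Poly_Mapping.lookup (c *\<^sub>C p) k = c *\<^sub>C Poly_Mapping.lookup (p :: 'a \<Rightarrow>\<^sub>0 'b) k"
  by (simp add: cscale_poly_mapping_def Poly_Mapping.map.rep_eq when_def)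

instance
  by standard (simp_all add: poly_mapping_eqI lookup_cscale lookup_add cscale_add_right
      cscale_add_left)
end

definition lin_map :: "('a::complex_vec \<Rightarrow> 'b::complex_vec) \<Rightarrow> bool" where
  "lin_map f \<longleftrightarrow> Vector_Spaces.linear cscale cscale f"

(* The trace of an endomorphism of a finite-dimensional space; it does not depend on the basis,
   and cvec.extend_basis {} is just some basis of the whole space. *)
definition lin_trace :: "('a::complex_vec \<Rightarrow> 'a) \<Rightarrow> complex" where
  "lin_trace f = (\<Sum>b\<in>cvec.extend_basis {}. cvec.representation (cvec.extend_basis {}) (f b) b)"


section \<open>Tensor product of two vector spaces\<close>

definition bilinear_relations :: "('a::complex_vec \<times> 'b::complex_vec \<Rightarrow>\<^sub>0 complex) set" where
  "bilinear_relations =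
     {Poly_Mapping.single (x + x', y) 1 - Poly_Mapping.single (x, y) 1 - Poly_Mapping.single (x', y) 1
        | x x' y. True} \<union>
     {Poly_Mapping.single (x, y + y') 1 - Poly_Mapping.single (x, y) 1 - Poly_Mapping.single (x, y') 1
        | x y y'. True} \<union>
     {Poly_Mapping.single (c *\<^sub>C x, y) 1 - Poly_Mapping.single (x, y) c | c x y. True} \<union>
     {Poly_Mapping.single (x, c *\<^sub>C y) 1 - Poly_Mapping.single (x, y) c | c x y. True}"

definition tensor_eq ::
  "('a::complex_vec \<times> 'b::complex_vec \<Rightarrow>\<^sub>0 complex) \<Rightarrow> ('a \<times> 'b \<Rightarrow>\<^sub>0 complex) \<Rightarrow> bool" where
  "tensor_eq p q \<longleftrightarrow> p - q \<in> cvec.span bilinear_relations"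

lemma tensor_eq_refl: "tensor_eq p p"
  by (simp add: tensor_eq_def cvec.span_zero)

lemma tensor_eq_sym: "tensor_eq p q \<Longrightarrow> tensor_eq q p"
  unfolding tensor_eq_def using cvec.span_neg[of "p - q"] by simp

lemma tensor_eq_trans: "tensor_eq p q \<Longrightarrow> tensor_eq q r \<Longrightarrow> tensor_eq p r"
  unfolding tensor_eq_def using cvec.span_add[of "p - q" _ "q - r"] by simp

quotient_type (overloaded) ('a, 'b) tensor =
  "'a::complex_vec \<times> 'b::complex_vec \<Rightarrow>\<^sub>0 complex" / tensor_eq
  by (intro equivpI reflpI sympI transpI) (blast intro: tensor_eq_refl tensor_eq_sym tensor_eq_trans)+

lemma tensor_eq_add: "tensor_eq p q \<Longrightarrow> tensor_eq p' q' \<Longrightarrow> tensor_eq (p + p') (q + q')"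
  unfolding tensor_eq_def using cvec.span_add[of "p - q" _ "p' - q'"] by (simp add: add_diff_add)

lemma tensor_eq_scale: "tensor_eq p q \<Longrightarrow> tensor_eq (c *\<^sub>C p) (c *\<^sub>C q)"
  unfolding tensor_eq_def using cvec.span_scale[of "p - q" _ c]
  by (simp add: cvec.scale_right_diff_distrib)

lemma tensor_eq_neg: "tensor_eq p q \<Longrightarrow> tensor_eq (- p) (- q)"
  using tensor_eq_scale[of p q "-1"] by simp

instantiation tensor :: (complex_vec, complex_vec) complex_vec
begin

lift_definition zero_tensor :: "('a, 'b) tensor" is 0 .

lift_definition plus_tensor :: "('a, 'b) tensor \<Rightarrow> ('a, 'b) tensor \<Rightarrow> ('a, 'b) tensor" is "(+)"
  by (rule tensor_eq_add)

lift_definition uminus_tensor :: "('a, 'b) tensor \<Rightarrow> ('a, 'b) tensor" is uminus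
  by (rule tensor_eq_neg)

definition minus_tensor :: "('a, 'b) tensor \<Rightarrow> ('a, 'b) tensor \<Rightarrow> ('a, 'b) tensor" where
  "minus_tensor u v = u + - v"

lift_definition cscale_tensor :: "complex \<Rightarrow> ('a, 'b) tensor \<Rightarrow> ('a, 'b) tensor" is cscale
  by (rule tensor_eq_scale)

instance
proof
  fix u v w :: "('a, 'b) tensor" and a b :: complex
  show "u + v + w = u + (v + w)" by transfer (simp add: add.assoc tensor_eq_refl)
  show "u + v = v + u" by transfer (simp add: add.commute tensor_eq_refl)
  show "0 + u = u" by transfer (simp add: tensor_eq_refl)
  show "- u + u = 0" by transfer (simp add: tensor_eq_refl)
  show "u - v = u + - v" by (simp add: minus_tensor_def)
  show "a *\<^sub>C (u + v) = a *\<^sub>C u + a *\<^sub>C v"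
    by transfer (simp add: cscale_add_right tensor_eq_refl)
  show "(a + b) *\<^sub>C u = a *\<^sub>C u + b *\<^sub>C u"
    by transfer (simp add: cscale_add_left tensor_eq_refl)
  show "a *\<^sub>C b *\<^sub>C u = (a * b) *\<^sub>C u" by transfer (simp add: tensor_eq_refl)
  show "1 *\<^sub>C u = u" by transfer (simp add: tensor_eq_refl)
qed

end

lift_definition tensor :: "'a::complex_vec \<Rightarrow> 'b::complex_vec \<Rightarrow> ('a, 'b) tensor" is
  "\<lambda>x y. Poly_Mapping.single (x, y) 1" .

definition subtensor ::
  "'a::complex_vec set \<Rightarrow> 'b::complex_vec set \<Rightarrow> ('a, 'b) tensor set" where
  "subtensor V W = cvec.span {tensor x y | x y. x \<in> V \<and> y \<in> W}"

(* f \<otimes> g for linear maps f, g. *)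
definition tensor_map ::
  "('a::complex_vec \<Rightarrow> 'c::complex_vec) \<Rightarrow> ('b::complex_vec \<Rightarrow> 'd::complex_vec) \<Rightarrow>
   ('a, 'b) tensor \<Rightarrow> ('c, 'd) tensor" where
  "tensor_map f g z =
     (let p = (SOME p. abs_tensor p = z)
      in \<Sum>xy\<in>Poly_Mapping.keys p.
           Poly_Mapping.lookup p xy *\<^sub>C tensor (f (fst xy)) (g (snd xy)))"

(* The linear map from V \<otimes> W (viewed inside the full tensor product) to M that is induced by a
   map phi which is bilinear on V x W; outside of V \<otimes> W the value is irrelevant. *)
definition tensor_lift ::
  "(complex, 'm) module \<Rightarrow> 'a::complex_vec set \<Rightarrow> 'b::complex_vec set \<Rightarrow>
   ('a \<Rightarrow> 'b \<Rightarrow> 'm) \<Rightarrow> ('a, 'b) tensor \<Rightarrow> 'm" where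
  "tensor_lift M V W \<phi> z =
     (let p = (SOME p. abs_tensor p = z \<and> Poly_Mapping.keys p \<subseteq> V \<times> W)
      in \<Oplus>\<^bsub>M\<^esub>xy\<in>Poly_Mapping.keys p.
           Poly_Mapping.lookup p xy \<odot>\<^bsub>M\<^esub> \<phi> (fst xy) (snd xy))"


section \<open>Lie algebras\<close>

class complex_lie_algebra = complex_vec +
  fixes bracket :: "'a \<Rightarrow> 'a \<Rightarrow> 'a"
  assumes bracket_add_left: "bracket (x + y) z = bracket x z + bracket y z"
    and bracket_scale_left: "bracket (c *\<^sub>C x) z = c *\<^sub>C bracket x z"
    and bracket_self: "bracket x x = 0"
    and jacobi: "bracket x (bracket y z) + bracket y (bracket z x) + bracket z (bracket x y) = 0"

definition lie_subalgebra :: "'g::complex_lie_algebra set \<Rightarrow> bool" where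
  "lie_subalgebra k \<longleftrightarrow> cvec.subspace k \<and> (\<forall>x\<in>k. \<forall>y\<in>k. bracket x y \<in> k)"

definition lie_ideal :: "'g::complex_lie_algebra set \<Rightarrow> bool" where
  "lie_ideal I \<longleftrightarrow> cvec.subspace I \<and> (\<forall>x. \<forall>y\<in>I. bracket x y \<in> I)"

definition simple_lie_algebra :: "'g::complex_lie_algebra itself \<Rightarrow> bool" where
  "simple_lie_algebra _ \<longleftrightarrow>
     (\<exists>B::'g set. finite B \<and> cvec.span B = UNIV) \<and>
     (\<exists>x y::'g. bracket x y \<noteq> 0) \<and>
     (\<forall>I::'g set. lie_ideal I \<longrightarrow> I = {0} \<or> I = UNIV)"

definition killing :: "'g::complex_lie_algebra \<Rightarrow> 'g \<Rightarrow> complex" where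
  "killing x y = lin_trace (\<lambda>z. bracket x (bracket y z))"

primrec lower_central :: "'g::complex_lie_algebra set \<Rightarrow> nat \<Rightarrow> 'g set" where
  "lower_central k 0 = k"
| "lower_central k (Suc n) = cvec.span {bracket x y | x y. x \<in> k \<and> y \<in> lower_central k n}"

definition cartan_subalgebra :: "'g::complex_lie_algebra set \<Rightarrow> bool" where
  "cartan_subalgebra h \<longleftrightarrow>
     lie_subalgebra h \<and>
     (\<exists>n. lower_central h n = {0}) \<and>
     {x. \<forall>t\<in>h. bracket x t \<in> h} = h"

(* A linear functional on h is extended by 0 to the whole type, so that it is determined by its
   values on h and so that negation of functionals is pointwise negation. *)
definition dual_space :: "'g::complex_vec set \<Rightarrow> ('g \<Rightarrow> complex) set" where
  "dual_space h = {\<nu>. (\<forall>s\<in>h. \<forall>t\<in>h. \<nu> (s + t) = \<nu> s + \<nu> t) \<and>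
                      (\<forall>c. \<forall>t\<in>h. \<nu> (c *\<^sub>C t) = c * \<nu> t) \<and>
                      (\<forall>t. t \<notin> h \<longrightarrow> \<nu> t = 0)}"

definition root_space :: "'g::complex_lie_algebra set \<Rightarrow> ('g \<Rightarrow> complex) \<Rightarrow> 'g set" where
  "root_space h \<alpha> = {x. \<forall>t\<in>h. bracket t x = \<alpha> t *\<^sub>C x}"

definition roots :: "'g::complex_lie_algebra set \<Rightarrow> ('g \<Rightarrow> complex) set" where
  "roots h = {\<alpha>\<in>dual_space h. \<alpha> \<noteq> (\<lambda>_. 0) \<and> root_space h \<alpha> \<noteq> {0}}"

definition positive_system :: "('g \<Rightarrow> complex) set \<Rightarrow> ('g \<Rightarrow> complex) set \<Rightarrow> bool" where
  "positive_system R Rp \<longleftrightarrow>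
     Rp \<subseteq> R \<and>
     (\<forall>\<alpha>\<in>R. (\<alpha> \<in> Rp) \<noteq> (- \<alpha> \<in> Rp)) \<and>
     (\<forall>\<alpha>\<in>Rp. \<forall>\<beta>\<in>Rp. (\<lambda>t. \<alpha> t + \<beta> t) \<in> R \<longrightarrow> (\<lambda>t. \<alpha> t + \<beta> t) \<in> Rp)"

definition t_dual :: "'g::complex_lie_algebra set \<Rightarrow> ('g \<Rightarrow> complex) \<Rightarrow> 'g" where
  "t_dual h \<nu> = (THE t. t \<in> h \<and> (\<forall>s\<in>h. \<nu> s = killing t s))"

definition orthonormal_basis :: "'g::complex_lie_algebra set \<Rightarrow> 'g set \<Rightarrow> bool" where
  "orthonormal_basis h X \<longleftrightarrow>
     cvec.independent X \<and> cvec.span X = h \<and>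
     (\<forall>x\<in>X. \<forall>x'\<in>X. killing x x' = (if x = x' then 1 else 0))"

definition lie_automorphism :: "('g::complex_lie_algebra \<Rightarrow> 'g) \<Rightarrow> bool" where
  "lie_automorphism f \<longleftrightarrow> lin_map f \<and> bij f \<and> (\<forall>x y. f (bracket x y) = bracket (f x) (f y))"

definition chevalley_involution ::
  "'g::complex_lie_algebra set \<Rightarrow> ('g \<Rightarrow> 'g) \<Rightarrow> bool" where
  "chevalley_involution h \<sigma> \<longleftrightarrow>
     lie_automorphism \<sigma> \<and> \<sigma> \<circ> \<sigma> = id \<and> (\<forall>t\<in>h. \<sigma> t = - t)"

definition Ad_torus :: "'g::complex_lie_algebra set \<Rightarrow> 'g \<Rightarrow> 'g \<Rightarrow> 'g" where
  "Ad_torus h y = (THE f. lie_automorphism f \<and> (\<forall>t\<in>h. f t = t) \<and>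
     (\<forall>\<alpha>\<in>roots h. \<forall>x\<in>root_space h \<alpha>. f x = exp (\<alpha> y) *\<^sub>C x))"

definition coweight_lattice :: "'g::complex_lie_algebra set \<Rightarrow> 'g set" where
  "coweight_lattice h = {t\<in>h. \<forall>\<alpha>\<in>roots h. \<alpha> t \<in> \<int>}"

(* The set of cosets y + 2 pi i P^vee, y in h. *)
definition torus :: "'g::complex_lie_algebra set \<Rightarrow> 'g set set" where
  "torus h = (\<lambda>y. {y + (2 * complex_of_real pi * \<i>) *\<^sub>C p | p. p \<in> coweight_lattice h}) ` h"


section \<open>Quotients of monoid algebras\<close>

definition monoid_algebra ::
  "('m, 'x) monoid_scheme \<Rightarrow> (complex, 'm \<Rightarrow>\<^sub>0 complex) module" where
  "monoid_algebra G =
     \<lparr>carrier = {p. Poly_Mapping.keys p \<subseteq> carrier G},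
      mult = (\<lambda>p q. \<Sum>a\<in>Poly_Mapping.keys p. \<Sum>b\<in>Poly_Mapping.keys q.
        Poly_Mapping.single (a \<otimes>\<^bsub>G\<^esub> b) (Poly_Mapping.lookup p a * Poly_Mapping.lookup q b)),
      one = Poly_Mapping.single \<one>\<^bsub>G\<^esub> 1,
      zero = 0,
      add = (+),
      smult = cscale\<rparr>"

(* The quotient algebra by the two-sided ideal generated by S. *)
definition quot_algebra :: "(complex, 'a) module \<Rightarrow> 'a set \<Rightarrow> (complex, 'a set) module" where
  "quot_algebra A S =
     (let I = Idl\<^bsub>A\<^esub> S; Q = A Quot I in
      \<lparr>carrier = carrier Q, mult = mult Q, one = one Q, zero = zero Q, add = add Q,
       smult = (\<lambda>c X. \<Union>x\<in>X. I +>\<^bsub>A\<^esub> (c \<odot>\<^bsub>A\<^esub> x))\<rparr>)"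

definition quot_class :: "(complex, 'a) module \<Rightarrow> 'a set \<Rightarrow> 'a \<Rightarrow> 'a set" where
  "quot_class A S a = Idl\<^bsub>A\<^esub> S +>\<^bsub>A\<^esub> a"


section \<open>Universal enveloping algebras\<close>

definition word_monoid :: "'a set \<Rightarrow> 'a list monoid" where
  "word_monoid k = \<lparr>carrier = lists k, mult = (@), one = []\<rparr>"

(* monoid_algebra (word_monoid k) is the free unital algebra on the set k. The first two families
   of relations turn it into the tensor algebra of the vector space k. *)
definition uea_relations :: "'g::complex_lie_algebra set \<Rightarrow> ('g list \<Rightarrow>\<^sub>0 complex) set" where
  "uea_relations k =
     {Poly_Mapping.single [x + y] 1 - Poly_Mapping.single [x] 1 - Poly_Mapping.single [y] 1
        | x y. x \<in> k \<and> y \<in> k} \<union>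
     {Poly_Mapping.single [c *\<^sub>C x] 1 - Poly_Mapping.single [x] c | c x. x \<in> k} \<union>
     {Poly_Mapping.single [x, y] 1 - Poly_Mapping.single [y, x] 1
        - Poly_Mapping.single [bracket x y] 1 | x y. x \<in> k \<and> y \<in> k}"

definition uea ::
  "'g::complex_lie_algebra set \<Rightarrow> (complex, ('g list \<Rightarrow>\<^sub>0 complex) set) module" where
  "uea k = quot_algebra (monoid_algebra (word_monoid k)) (uea_relations k)"

definition uea_in ::
  "'g::complex_lie_algebra set \<Rightarrow> 'g \<Rightarrow> ('g list \<Rightarrow>\<^sub>0 complex) set" where
  "uea_in k x =
     quot_class (monoid_algebra (word_monoid k)) (uea_relations k) (Poly_Mapping.single [x] 1)"

(* The multiplication map of U(g), on the subspace g \<otimes> g of U(g) \<otimes> U(g). *)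
definition uea_mult :: "('g::complex_lie_algebra, 'g) tensor \<Rightarrow> ('g list \<Rightarrow>\<^sub>0 complex) set" where
  "uea_mult = tensor_lift (uea UNIV) UNIV UNIV (\<lambda>x y. uea_in UNIV x \<otimes>\<^bsub>uea UNIV\<^esub> uea_in UNIV y)"


section \<open>Tensor products of families of algebras\<close>

definition product_monoid :: "'j set \<Rightarrow> ('j \<Rightarrow> (complex, 'a) module) \<Rightarrow> ('j \<Rightarrow> 'a) monoid" where
  "product_monoid J A =
     \<lparr>carrier = (\<Pi>\<^sub>E j\<in>J. carrier (A j)),
      mult = (\<lambda>f g. \<lambda>j\<in>J. f j \<otimes>\<^bsub>A j\<^esub> g j),
      one = (\<lambda>j\<in>J. \<one>\<^bsub>A j\<^esub>)\<rparr>"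

definition multilinear_relations ::
  "'j set \<Rightarrow> ('j \<Rightarrow> (complex, 'a) module) \<Rightarrow> (('j \<Rightarrow> 'a) \<Rightarrow>\<^sub>0 complex) set" where
  "multilinear_relations J A =
     {Poly_Mapping.single (f(j := u \<oplus>\<^bsub>A j\<^esub> v)) 1 - Poly_Mapping.single (f(j := u)) 1
        - Poly_Mapping.single (f(j := v)) 1
        | f j u v. f \<in> carrier (product_monoid J A) \<and> j \<in> J \<and>
            u \<in> carrier (A j) \<and> v \<in> carrier (A j)} \<union>
     {Poly_Mapping.single (f(j := c \<odot>\<^bsub>A j\<^esub> u)) 1 - Poly_Mapping.single (f(j := u)) c
        | f j c u. f \<in> carrier (product_monoid J A) \<and> j \<in> J \<and> u \<in> carrier (A j)}"

(* The linear span of multilinear_relations is already a two-sided ideal of the monoid algebra, so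
   the quotient below is the tensor product of the A j as vector spaces, with the componentwise
   multiplication of pure tensors. *)
definition tensor_algebras ::
  "'j set \<Rightarrow> ('j \<Rightarrow> (complex, 'a) module) \<Rightarrow> (complex, (('j \<Rightarrow> 'a) \<Rightarrow>\<^sub>0 complex) set) module"
  where
  "tensor_algebras J A =
     quot_algebra (monoid_algebra (product_monoid J A)) (multilinear_relations J A)"

(* The pure tensor with u in position j and 1 elsewhere. *)
definition in_position ::
  "'j set \<Rightarrow> ('j \<Rightarrow> (complex, 'a) module) \<Rightarrow> 'j \<Rightarrow> 'a \<Rightarrow> (('j \<Rightarrow> 'a) \<Rightarrow>\<^sub>0 complex) set" where
  "in_position J A j u =
     quot_class (monoid_algebra (product_monoid J A)) (multilinear_relations J A)
       (Poly_Mapping.single (\<lambda>l\<in>J. if l = j then u else \<one>\<^bsub>A l\<^esub>) 1)"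


section \<open>The algebra \<open>U(k) \<otimes> U(g)^N \<otimes> U(k)\<close>\<close>

(* The positions are 0, 1, ..., N, N + 1; N + 1 plays the role of 0'. *)
definition slot :: "nat \<Rightarrow> 'g set \<Rightarrow> nat \<Rightarrow> 'g set" where
  "slot N k j = (if j \<in> {1..N} then UNIV else k)"

definition boundary_algebra ::
  "nat \<Rightarrow> 'g::complex_lie_algebra set \<Rightarrow>
   (complex, ((nat \<Rightarrow> ('g list \<Rightarrow>\<^sub>0 complex) set) \<Rightarrow>\<^sub>0 complex) set) module" where
  "boundary_algebra N k = tensor_algebras {0..N + 1} (\<lambda>j. uea (slot N k j))"

definition place1 ::
  "nat \<Rightarrow> 'g::complex_lie_algebra set \<Rightarrow> nat \<Rightarrow> ('g list \<Rightarrow>\<^sub>0 complex) set \<Rightarrow>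
   ((nat \<Rightarrow> ('g list \<Rightarrow>\<^sub>0 complex) set) \<Rightarrow>\<^sub>0 complex) set" where
  "place1 N k j u = in_position {0..N + 1} (\<lambda>l. uea (slot N k l)) j u"

(* z_ij for distinct i, j and z in the tensor product of slot N k i and slot N k j. *)
definition place2 ::
  "nat \<Rightarrow> 'g::complex_lie_algebra set \<Rightarrow> nat \<Rightarrow> nat \<Rightarrow> ('g, 'g) tensor \<Rightarrow>
   ((nat \<Rightarrow> ('g list \<Rightarrow>\<^sub>0 complex) set) \<Rightarrow>\<^sub>0 complex) set" where
  "place2 N k i j z =
     tensor_lift (boundary_algebra N k) (slot N k i) (slot N k j)
       (\<lambda>x y. place1 N k i (uea_in (slot N k i) x) \<otimes>\<^bsub>boundary_algebra N k\<^esub>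
              place1 N k j (uea_in (slot N k j) y)) z"

end

theory Submission
  imports Defs "HOL-Computational_Algebra.Fundamental_Theorem_Algebra"
begin

text \<open>
  Since \<open>r + r' = 2 rp\<close>, every \<open>A i\<close> is a combination of one-site terms, of
  \<open>rp\<^sub>s\<^sub>i\<close> for all sites \<open>s \<noteq> i\<close> (boundary sites included) and of
  \<open>varpi\<^sub>i\<^sub>s\<close> for \<open>s > i\<close>. For dual bases \<open>u\<^sub>a, u'\<^sub>a\<close> of
  \<open>\<gg>\<close> one has \<open>2 rp = \<Sum>\<^sub>a \<Theta> u\<^sub>a \<otimes> u'\<^sub>a\<close>, where \<open>\<Theta>\<close> is the projection
  of \<open>\<gg>\<close> onto the fixed point subalgebra \<open>k\<close> along the negative Borel subalgebra (Iwasawa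
  decomposition). Both summands being subalgebras,
  \<open>[\<Theta> x, \<Theta> y] = \<Theta> ([\<Theta> x, y] + [x, \<Theta> y] - [x, y])\<close>, and this identity together with the
  invariance of \<open>varpi\<close> makes all two-site and three-site contributions to the commutators cancel.
  The Casimir element splits off from \<open>\<kappa>core\<close> as a central term.
\<close>

section \<open>Complex algebras as algebras of endomorphisms\<close>

text \<open>The commutator identities need no basis theorem for enveloping algebras: they follow
  from the defining relations. The structure theory has to supply dual bases, that is,
  one-dimensional root spaces and a nondegenerate Killing form. Both come from the data at hand: an
  orthonormal basis of h excludes a vanishing form, and \<sigma> = -1 on h makes h abelian.

  The asymmetric sum of varpi over s > i corrects the coupling of exactly one member of each pair of
  bulk sites, which is the balance that the two-site and three-site equations require. Since r
  differs from half the Casimir tensor by an antisymmetric part, \<kappa>core carries a linear term,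
  half the sum of the t_\<alpha>, besides the Casimir element; it cancels separately because it lies
  in h.

  At the boundary only k can be placed. Those sites enter through \<Theta> followed by the
  placement, a map defined on the whole algebra. So bulk and boundary obey one set of rules, and the
  three choices of \<kappa> differ only in the set of sites.\<close>

lemma lin_mapI:
  assumes "\<And>x y. f (x + y) = f x + f y" and "\<And>c x. f (c *\<^sub>C x) = c *\<^sub>C f x"
  shows "lin_map f"
  unfolding lin_map_def
  by (rule Vector_Spaces.linear_iff[THEN iffD2]) (simp add: assms cvec.vector_space_axioms)

lemma lin_map_add: "lin_map f \<Longrightarrow> f (x + y) = f x + f y"
  and lin_map_scale: "lin_map f \<Longrightarrow> f (c *\<^sub>C x) = c *\<^sub>C f x"
  unfolding lin_map_def by (simp_all add: Vector_Spaces.linear_iff)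

lemma lin_map_zero: "lin_map f \<Longrightarrow> f 0 = 0"
  using lin_map_add[of f 0 0] by simp

lemma lin_map_neg: "lin_map f \<Longrightarrow> f (- x) = - f x"
  using lin_map_scale[of f "-1" x] by simp

lemma lin_map_diff: "lin_map f \<Longrightarrow> f (x - y) = f x - f y"
  using lin_map_add[of f x "- y"] lin_map_neg[of f y] by simp

lemma lin_map_sum: "lin_map f \<Longrightarrow> f (sum g S) = (\<Sum>s\<in>S. f (g s))"
  by (induction S rule: infinite_finite_induct) (simp_all add: lin_map_zero lin_map_add)

lemmas lin_map_simps = lin_map_add lin_map_scale lin_map_zero lin_map_neg lin_map_diff lin_map_sum

lemma lin_map_id: "lin_map id" "lin_map (\<lambda>x. x)"
  by (simp_all add: lin_mapI)

lemma lin_map_comp: "lin_map f \<Longrightarrow> lin_map g \<Longrightarrow> lin_map (f \<circ> g)"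
  by (auto intro!: lin_mapI simp: lin_map_simps)

lemma sum_keys_superset:
  fixes F :: "'k \<Rightarrow> 'a::zero \<Rightarrow> 'b::comm_monoid_add"
  assumes "finite S" "Poly_Mapping.keys p \<subseteq> S" "\<And>k. F k 0 = 0"
  shows "(\<Sum>k\<in>Poly_Mapping.keys p. F k (Poly_Mapping.lookup p k)) = (\<Sum>k\<in>S. F k (Poly_Mapping.lookup p k))"
  by (rule sum.mono_neutral_left) (use assms in \<open>auto simp: in_keys_iff\<close>)

lemma sum_keys_single:
  fixes F :: "'k \<Rightarrow> 'a::zero \<Rightarrow> 'b::comm_monoid_add"
  assumes "\<And>k. F k 0 = 0"
  shows "(\<Sum>k\<in>Poly_Mapping.keys (Poly_Mapping.single a c). F k (Poly_Mapping.lookup (Poly_Mapping.single a c) k)) = F a c"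
  using sum_keys_superset[of "{a}" "Poly_Mapping.single a c" F] assms by simp

lemma sum_singles:
  "(\<Sum>k\<in>Poly_Mapping.keys p. Poly_Mapping.single k (Poly_Mapping.lookup p k)) = p"
  by (rule poly_mapping_eqI)
    (auto simp: lookup_sum lookup_single when_def sum.delta in_keys_iff)

text \<open>\<open>q\<close> stays fixed and the step adds only terms at keys of \<open>q\<close>.
  Hence a carrier condition on the support of \<open>q\<close> is still available in the step
  although it is not part of \<open>P\<close>.\<close>

lemma poly_mapping_single_induct [case_names zero add]:
  fixes P :: "('k \<Rightarrow>\<^sub>0 'a::comm_monoid_add) \<Rightarrow> bool"
  assumes "P 0"
    and "\<And>p k c. P p \<Longrightarrow> k \<in> Poly_Mapping.keys q \<Longrightarrow> P (Poly_Mapping.single k c + p)"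
  shows "P q"
proof -
  have "P (\<Sum>k\<in>S. Poly_Mapping.single k (Poly_Mapping.lookup q k))" if "S \<subseteq> Poly_Mapping.keys q" for S
    using finite_subset[OF that finite_keys] that by (induction S) (auto simp: assms)
  from this[of "Poly_Mapping.keys q"] show ?thesis by (simp add: sum_singles)
qed

lemma scale_single: "c *\<^sub>C Poly_Mapping.single k (d::complex) = Poly_Mapping.single k (c * d)"
  by (rule poly_mapping_eqI) (simp add: lookup_cscale lookup_single when_def cscale_complex_def)

lemma keys_scale: "Poly_Mapping.keys (c *\<^sub>C (p :: 'k \<Rightarrow>\<^sub>0 'b::complex_vec)) \<subseteq> Poly_Mapping.keys p"
  by (auto simp: in_keys_iff lookup_cscale)

definition lin_ext :: "('k \<Rightarrow> 'c::complex_vec) \<Rightarrow> ('k \<Rightarrow>\<^sub>0 complex) \<Rightarrow> 'c" where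
  "lin_ext \<phi> p = (\<Sum>k\<in>Poly_Mapping.keys p. Poly_Mapping.lookup p k *\<^sub>C \<phi> k)"

lemma lin_ext_superset:
  "finite S \<Longrightarrow> Poly_Mapping.keys p \<subseteq> S \<Longrightarrow> lin_ext \<phi> p = (\<Sum>k\<in>S. Poly_Mapping.lookup p k *\<^sub>C \<phi> k)"
  unfolding lin_ext_def by (rule sum_keys_superset[where F = "\<lambda>k c. c *\<^sub>C \<phi> k"]) simp_all

lemma lin_ext_single: "lin_ext \<phi> (Poly_Mapping.single k c) = c *\<^sub>C \<phi> k"
  unfolding lin_ext_def by (rule sum_keys_single[where F = "\<lambda>k c. c *\<^sub>C \<phi> k"]) simp

lemma lin_map_lin_ext: "lin_map (lin_ext \<phi>)"
proof (rule lin_mapI)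
  fix p q
  show "lin_ext \<phi> (p + q) = lin_ext \<phi> p + lin_ext \<phi> q"
    unfolding lin_ext_def
    by (rule setsum_keys_plus_distrib[where f = "\<lambda>k c. c *\<^sub>C \<phi> k"]) (simp_all add: cscale_add_left)
  fix c
  show "lin_ext \<phi> (c *\<^sub>C p) = c *\<^sub>C lin_ext \<phi> p"
    using lin_ext_superset[OF finite_keys keys_scale, of \<phi> c p]
    by (simp add: lin_ext_def lookup_cscale cscale_complex_def cscale_assoc cvec.scale_sum_right)
qed

section \<open>Complex algebras, as a type class and as carriers\<close>

class complex_algebra = ring + complex_vec +
  assumes cscale_mult_left: "(c *\<^sub>C x) * y = c *\<^sub>C (x * y)"
    and cscale_mult_right: "x * (c *\<^sub>C y) = c *\<^sub>C (x * y)"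

typedef (overloaded) 'v endo = "{f :: 'v::complex_vec \<Rightarrow> 'v. lin_map f}"
  morphisms endo_app Abs_endo
  using lin_map_id by blast

setup_lifting type_definition_endo

instantiation endo :: (complex_vec) complex_algebra
begin

lift_definition zero_endo :: "'a endo" is "\<lambda>_. 0" by (simp add: lin_mapI)
lift_definition plus_endo :: "'a endo \<Rightarrow> 'a endo \<Rightarrow> 'a endo" is "\<lambda>f g x. f x + g x"
  by (auto intro!: lin_mapI simp: lin_map_simps cscale_add_right)
lift_definition uminus_endo :: "'a endo \<Rightarrow> 'a endo" is "\<lambda>f x. - f x"
  by (auto intro!: lin_mapI simp: lin_map_simps)
lift_definition minus_endo :: "'a endo \<Rightarrow> 'a endo \<Rightarrow> 'a endo" is "\<lambda>f g x. f x - g x"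
  by (auto intro!: lin_mapI simp: lin_map_simps cvec.scale_right_diff_distrib)
lift_definition times_endo :: "'a endo \<Rightarrow> 'a endo \<Rightarrow> 'a endo" is "\<lambda>f g x. f (g x)"
  by (auto intro!: lin_mapI simp: lin_map_simps)
lift_definition cscale_endo :: "complex \<Rightarrow> 'a endo \<Rightarrow> 'a endo" is "\<lambda>c f x. c *\<^sub>C f x"
  by (auto intro!: lin_mapI simp: lin_map_simps cscale_add_right mult.commute)

instance
  by standard (transfer; simp add: lin_map_simps fun_eq_iff cscale_add_right cscale_add_left add.assoc;
      simp add: add.commute)+

end

text \<open>The algebras of the theorem consist of cosets and depend on the terms \<open>N\<close>
  and \<open>k\<close>, so they are carriers and not types. The locale adds to a HOL-Algebra ring a
  scalar action compatible with both factors of the product.\<close>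

locale calgebra = ring M for M :: "(complex, 'm) module" (structure) +
  assumes smult_closed [simp, intro]: "x \<in> carrier M \<Longrightarrow> c \<odot> x \<in> carrier M"
    and smult_l_distr: "x \<in> carrier M \<Longrightarrow> (a + b) \<odot> x = a \<odot> x \<oplus> b \<odot> x"
    and smult_r_distr: "x \<in> carrier M \<Longrightarrow> y \<in> carrier M \<Longrightarrow> c \<odot> (x \<oplus> y) = c \<odot> x \<oplus> c \<odot> y"
    and smult_assoc1: "x \<in> carrier M \<Longrightarrow> (a * b) \<odot> x = a \<odot> (b \<odot> x)"
    and smult_one: "x \<in> carrier M \<Longrightarrow> 1 \<odot> x = x"
    and smult_mult_left: "x \<in> carrier M \<Longrightarrow> y \<in> carrier M \<Longrightarrow> (c \<odot> x) \<otimes> y = c \<odot> (x \<otimes> y)"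
    and smult_mult_right: "x \<in> carrier M \<Longrightarrow> y \<in> carrier M \<Longrightarrow> x \<otimes> (c \<odot> y) = c \<odot> (x \<otimes> y)"
begin

lemma smult_zero_right [simp]: "c \<odot> \<zero> = \<zero>"
  by (metis add.l_cancel_one' smult_closed smult_r_distr zero_closed l_zero)

lemma smult_zero_left [simp]: "x \<in> carrier M \<Longrightarrow> 0 \<odot> x = \<zero>"
  by (metis add.l_cancel_one' smult_closed smult_l_distr add_0)

lemma smult_finsum:
  "finite S \<Longrightarrow> f \<in> S \<rightarrow> carrier M \<Longrightarrow> c \<odot> finsum M f S = (\<Oplus>s\<in>S. c \<odot> f s)"
  by (induction S rule: finite_induct) (auto simp: smult_r_distr Pi_iff)

text \<open>Truncation makes \<open>ev\<close> a linear map from all of the free vector space over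
  the type \<open>'m\<close> onto the carrier. Thus the carrier becomes a quotient of a genuine
  vector space type.\<close>

definition in_carrier :: "'m \<Rightarrow> 'm" where
  "in_carrier x = (if x \<in> carrier M then x else \<zero>)"

lemma in_carrier_closed [simp]: "in_carrier x \<in> carrier M"
  and in_carrier_id [simp]: "x \<in> carrier M \<Longrightarrow> in_carrier x = x"
  by (simp_all add: in_carrier_def)

definition ev :: "('m \<Rightarrow>\<^sub>0 complex) \<Rightarrow> 'm" where
  "ev p = (\<Oplus>k\<in>Poly_Mapping.keys p. Poly_Mapping.lookup p k \<odot> in_carrier k)"

lemma ev_closed [simp]: "ev p \<in> carrier M"
  by (simp add: ev_def)

lemma ev_superset:
  "finite S \<Longrightarrow> Poly_Mapping.keys p \<subseteq> S \<Longrightarrow> ev p = (\<Oplus>k\<in>S. Poly_Mapping.lookup p k \<odot> in_carrier k)"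
  unfolding ev_def
  by (rule add.finprod_mono_neutral_cong_left) (auto simp: in_keys_iff)

lemma ev_add: "ev (p + q) = ev p \<oplus> ev q"
proof -
  let ?S = "Poly_Mapping.keys p \<union> Poly_Mapping.keys q"
  have "ev (p + q) = (\<Oplus>k\<in>?S. Poly_Mapping.lookup p k \<odot> in_carrier k \<oplus> Poly_Mapping.lookup q k \<odot> in_carrier k)"
    using keys_add[of p q] by (simp add: ev_superset[of ?S] lookup_add smult_l_distr)
  also have "\<dots> = (\<Oplus>k\<in>?S. Poly_Mapping.lookup p k \<odot> in_carrier k) \<oplus> (\<Oplus>k\<in>?S. Poly_Mapping.lookup q k \<odot> in_carrier k)"
    by (rule add.finprod_multf) auto
  also have "\<dots> = ev p \<oplus> ev q"
    using ev_superset[of ?S p] ev_superset[of ?S q] by simp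
  finally show ?thesis .
qed

lemma ev_scale: "ev (c *\<^sub>C p) = c \<odot> ev p"
  by (simp add: ev_superset[OF finite_keys[of p] keys_scale] ev_def[of p] smult_finsum Pi_iff
      lookup_cscale cscale_complex_def smult_assoc1)

lemma ev_single: "ev (Poly_Mapping.single k c) = c \<odot> in_carrier k"
  using ev_superset[of "{k}" "Poly_Mapping.single k c"] by simp

lemma ev_zero [simp]: "ev 0 = \<zero>"
  by (simp add: ev_def)

lemma ev_diff_eq_zero: "ev (p - q) = \<zero> \<longleftrightarrow> ev p = ev q"
proof -
  have "ev p = ev (p - q) \<oplus> ev q" using ev_add[of "p - q" q] by simp
  then show ?thesis by (metis add.r_cancel_one' ev_closed l_zero)
qed

text \<open>The algebra acts on the free vector space over its carrier, modulo the kernel of \<^term>\<open>ev\<close>; composing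
  with a linear section \<open>sect\<close> of \<^term>\<open>ev\<close> gives an injective homomorphism into a type of
  endomorphisms, where the simplifier can compute without carrier conditions.\<close>

definition lmult :: "'m \<Rightarrow> ('m \<Rightarrow>\<^sub>0 complex) \<Rightarrow> ('m \<Rightarrow>\<^sub>0 complex)" where
  "lmult u = lin_ext (\<lambda>k. Poly_Mapping.single (u \<otimes> in_carrier k) 1)"

lemma ev_lmult: assumes "u \<in> carrier M" shows "ev (lmult u p) = u \<otimes> ev p"
proof (induction p rule: poly_mapping_single_induct)
  case zero
  show ?case by (simp add: lmult_def lin_map_zero[OF lin_map_lin_ext] assms)
next
  case (add p k c)
  then show ?case using assms
    by (simp add: lmult_def lin_map_add[OF lin_map_lin_ext] lin_ext_single scale_single ev_add ev_single
       r_distr smult_mult_right)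
qed

text \<open>Splitting off the kernel of \<open>ev\<close>: if \<open>g\<close> is a linear
  projection onto the kernel, then p - g p has the same value as p and vanishes for p in the kernel,
  hence depends only on the value of p.\<close>

lemma ex_section:
  "\<exists>P. lin_map P \<and> (\<forall>p. ev (P p) = ev p) \<and> (\<forall>p q. ev p = ev q \<longrightarrow> P p = P q)"
proof -
  let ?K = "{p. ev p = \<zero>}"
  have K: "cvec.subspace ?K"
    by (auto simp: cvec.subspace_def ev_add ev_scale)
  interpret pr: vector_space_pair "cscale :: complex \<Rightarrow> ('m \<Rightarrow>\<^sub>0 complex) \<Rightarrow> _" "cscale :: complex \<Rightarrow> ('m \<Rightarrow>\<^sub>0 complex) \<Rightarrow> _"
    by unfold_locales
  have l: "Vector_Spaces.linear cscale cscale (id :: ('m \<Rightarrow>\<^sub>0 complex) \<Rightarrow> _)"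
    using lin_map_id(1) by (simp add: lin_map_def)
  \<comment> \<open>A left inverse of the identity on the subspace \<open>?K\<close>, with values in
    \<open>?K\<close>, is a linear projection onto it.\<close>
  obtain g where g: "g ` UNIV \<subseteq> ?K" "Vector_Spaces.linear cscale cscale g" "\<forall>v\<in>?K. g (id v) = v"
    using pr.linear_exists_left_inverse_on[OF l K] by auto
  have g2: "lin_map g" using g(2) by (simp add: lin_map_def)
  have gK: "ev (g p) = \<zero>" for p using g(1) by auto
  have "lin_map (\<lambda>p. p - g p)"
    by (rule lin_mapI) (simp_all add: lin_map_simps[OF g2] cvec.scale_right_diff_distrib)
  moreover have "ev (p - g p) = ev p" for p
    using ev_add[of "p - g p" "g p"] by (simp add: gK)
  moreover have "p - g p = q - g q" if "ev p = ev q" for p q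
  proof -
    have "g (p - q) = p - q" using g(3) that by (auto simp: ev_diff_eq_zero)
    then show ?thesis by (simp add: lin_map_simps[OF g2] algebra_simps)
  qed
  ultimately show ?thesis by (intro exI[of _ "\<lambda>p. p - g p"]) blast
qed

definition sect :: "('m \<Rightarrow>\<^sub>0 complex) \<Rightarrow> ('m \<Rightarrow>\<^sub>0 complex)" where
  "sect = (SOME P. lin_map P \<and> (\<forall>p. ev (P p) = ev p) \<and> (\<forall>p q. ev p = ev q \<longrightarrow> P p = P q))"

lemma lin_map_sect: "lin_map sect" and ev_sect [simp]: "ev (sect p) = ev p"
  and sect_cong: "ev p = ev q \<Longrightarrow> sect p = sect q"
  using someI_ex[OF ex_section] unfolding sect_def by blast+

definition emb :: "'m \<Rightarrow> ('m \<Rightarrow>\<^sub>0 complex) endo" where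
  "emb u = Abs_endo (sect \<circ> lmult u)"

lemma emb_app: "endo_app (emb u) p = sect (lmult u p)"
  unfolding emb_def by (subst Abs_endo_inverse) (simp_all add: lin_map_comp lin_map_sect lmult_def lin_map_lin_ext)

lemma emb_add: "u \<in> carrier M \<Longrightarrow> v \<in> carrier M \<Longrightarrow> emb (u \<oplus> v) = emb u + emb v"
  by (auto simp: endo_app_inject[symmetric] plus_endo.rep_eq emb_app lin_map_add[OF lin_map_sect, symmetric]
      ev_lmult ev_add l_distr intro!: ext sect_cong)

lemma emb_mult: "u \<in> carrier M \<Longrightarrow> v \<in> carrier M \<Longrightarrow> emb (u \<otimes> v) = emb u * emb v"
  by (auto simp: endo_app_inject[symmetric] times_endo.rep_eq emb_app ev_lmult m_assoc intro!: ext sect_cong)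

lemma emb_smult: "u \<in> carrier M \<Longrightarrow> emb (c \<odot> u) = c *\<^sub>C emb u"
  by (auto simp: endo_app_inject[symmetric] cscale_endo.rep_eq emb_app lin_map_scale[OF lin_map_sect, symmetric]
      ev_lmult ev_scale smult_mult_left intro!: ext sect_cong)

text \<open>The operator of \<open>w\<close>, applied to the formal generator of the unit, evaluates
  to \<open>w\<close> again; so the left regular action is faithful.\<close>

lemma emb_inject: "u \<in> carrier M \<Longrightarrow> v \<in> carrier M \<Longrightarrow> emb u = emb v \<longleftrightarrow> u = v"
proof
  assume uv: "u \<in> carrier M" "v \<in> carrier M" "emb u = emb v"
  have "ev (endo_app (emb w) (Poly_Mapping.single \<one> 1)) = w" if "w \<in> carrier M" for w
    using that by (simp add: emb_app ev_lmult ev_single smult_one)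
  then show "u = v" using uv by metis
qed simp

lemma emb_zero: "emb \<zero> = 0"
  using emb_add[of \<zero> \<zero>] by simp

lemma emb_finsum: "f \<in> S \<rightarrow> carrier M \<Longrightarrow> finite S \<Longrightarrow> emb (finsum M f S) = (\<Sum>s\<in>S. emb (f s))"
proof (induction S rule: infinite_finite_induct)
  case (insert s S)
  then show ?case by (simp add: emb_add Pi_iff)
qed (simp_all add: emb_zero)

end

section \<open>Quotients of monoid algebras and tensor lifts\<close>

context calgebra begin

text \<open>The scalar \<open>c\<close> acts as multiplication by c times the unit, so a ring ideal
  is automatically a linear subspace.\<close>

lemma ideal_smult:
  assumes "ideal I M" "x \<in> I" shows "c \<odot> x \<in> I"
proof -
  have x: "x \<in> carrier M" using assms ideal.Icarr by metis
  have "c \<odot> x = (c \<odot> \<one>) \<otimes> x" using x by (simp add: smult_mult_left)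
  then show ?thesis using assms ideal.I_l_closed[of I M x "c \<odot> \<one>"] by simp
qed

context
  fixes S assumes S: "S \<subseteq> carrier M"
begin

lemma ideal_Idl: "ideal (Idl S) M"
  by (rule genideal_ideal[OF S])

lemma abelian_subgroup_Idl: "abelian_subgroup (Idl S) M"
  by (rule abelian_subgroupI3[OF ideal.axioms(1)[OF ideal_Idl] abelian_group_axioms])

lemma carrier_quot: "carrier (quot_algebra M S) = quot_class M S ` carrier M"
  by (auto simp: quot_algebra_def quot_class_def Let_def FactRing_simps)

lemma quot_class_closed: "x \<in> carrier M \<Longrightarrow> quot_class M S x \<in> carrier (quot_algebra M S)"
  by (simp add: carrier_quot)

lemma quot_class_add: "x \<in> carrier M \<Longrightarrow> y \<in> carrier M \<Longrightarrow>
    quot_class M S x \<oplus>\<^bsub>quot_algebra M S\<^esub> quot_class M S y = quot_class M S (x \<oplus> y)"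
  by (simp add: quot_algebra_def quot_class_def Let_def FactRing_def ideal.a_rcos_sum[OF ideal_Idl])

lemma quot_class_mult: "x \<in> carrier M \<Longrightarrow> y \<in> carrier M \<Longrightarrow>
    quot_class M S x \<otimes>\<^bsub>quot_algebra M S\<^esub> quot_class M S y = quot_class M S (x \<otimes> y)"
  by (simp add: quot_algebra_def quot_class_def Let_def FactRing_def ideal.rcoset_mult_add[OF ideal_Idl])

lemma quot_class_one: "\<one>\<^bsub>quot_algebra M S\<^esub> = quot_class M S \<one>"
  by (simp add: quot_algebra_def quot_class_def Let_def FactRing_def)

lemma quot_class_zero: "\<zero>\<^bsub>quot_algebra M S\<^esub> = quot_class M S \<zero>"
  using abelian_subgroup.a_rcos_const[OF abelian_subgroup_Idl, of \<zero>]
    additive_subgroup.zero_closed[OF ideal.axioms(1)[OF ideal_Idl]]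
  by (simp add: quot_algebra_def quot_class_def Let_def FactRing_def)

text \<open>Turns a defining relation into an equation of cosets: a member of \<open>S\<close> may
  be added without changing the class. The relations of the enveloping algebra and of the tensor
  product are all read off through it.\<close>

lemma quot_class_eqI:
  assumes "x \<in> carrier M" "r \<in> S" "y = r \<oplus> x"
  shows "quot_class M S y = quot_class M S x"
proof -
  have r: "r \<in> carrier M" "r \<in> Idl S" using assms(2) S genideal_self[OF S] by auto
  have "quot_class M S y = quot_class M S r \<oplus>\<^bsub>quot_algebra M S\<^esub> quot_class M S x"
    using assms r by (simp add: quot_class_add)
  also have "quot_class M S r = quot_class M S \<zero>"
    using abelian_subgroup.a_rcos_const[OF abelian_subgroup_Idl, of r] r(2)
      abelian_subgroup.a_rcos_const[OF abelian_subgroup_Idl, of \<zero>]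
      additive_subgroup.zero_closed[OF ideal.axioms(1)[OF ideal_Idl]]
    by (simp add: quot_class_def)
  finally show ?thesis using assms by (simp add: quot_class_add)
qed

text \<open>Scalar multiplication of a coset is the union of the cosets of \<open>c\<close> times
  \<open>y\<close> over all representatives \<open>y\<close>. Since the ideal is a subspace, these
  cosets coincide and the union is a single one.\<close>

lemma quot_class_smult:
  assumes "x \<in> carrier M"
  shows "c \<odot>\<^bsub>quot_algebra M S\<^esub> quot_class M S x = quot_class M S (c \<odot> x)"
proof -
  let ?I = "Idl S"
  have "?I +> (c \<odot> y) = ?I +> (c \<odot> x)" if y: "y \<in> ?I +> x" for y
  proof -
    obtain i where i: "i \<in> ?I" "y = i \<oplus> x" using y by (auto simp: a_r_coset_def')
    have ic: "i \<in> carrier M" using i ideal.Icarr[OF ideal_Idl] by metis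
    have "c \<odot> y \<in> ?I +> (c \<odot> x)"
      using i ic assms ideal_smult[OF ideal_Idl i(1), of c]
      by (auto simp: a_r_coset_def' smult_r_distr)
    then show ?thesis
      using abelian_subgroup.a_repr_independence'[OF abelian_subgroup_Idl] assms by simp
  qed
  moreover have "x \<in> ?I +> x" using abelian_subgroup.a_rcos_self[OF abelian_subgroup_Idl assms] .
  ultimately have "(\<Union>y\<in>?I +> x. ?I +> (c \<odot> y)) = ?I +> (c \<odot> x)" by blast
  then show ?thesis
    by (simp only: quot_algebra_def quot_class_def Let_def module.simps)
qed

lemma calgebra_quot: "calgebra (quot_algebra M S)"
proof -
  note q = carrier_quot quot_class_add quot_class_mult quot_class_one quot_class_zero quot_class_smult
  have "abelian_group (quot_algebra M S)"
  proof (rule abelian_groupI)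
    fix x assume "x \<in> carrier (quot_algebra M S)"
    then obtain a where a: "a \<in> carrier M" "x = quot_class M S a" by (auto simp: q)
    then show "\<exists>y\<in>carrier (quot_algebra M S). y \<oplus>\<^bsub>quot_algebra M S\<^esub> x = \<zero>\<^bsub>quot_algebra M S\<^esub>"
      by (intro bexI[of _ "quot_class M S (\<ominus> a)"]) (simp_all add: q l_neg)
  qed (auto simp: q a_ac)
  moreover have "Group.monoid (quot_algebra M S)"
    by (rule monoidI) (auto simp: q m_assoc)
  ultimately have "ring (quot_algebra M S)"
    by (rule ringI) (auto simp: q l_distr r_distr)
  then show ?thesis
    by (rule calgebra.intro) (unfold_locales; auto simp: q smult_l_distr smult_r_distr smult_assoc1
      smult_one smult_mult_left smult_mult_right)
qed

end

end

section \<open>Monoid algebras\<close>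

lemma monoid_algebra_simps:
  "carrier (monoid_algebra G) = {p. Poly_Mapping.keys p \<subseteq> carrier G}"
  "\<one>\<^bsub>monoid_algebra G\<^esub> = Poly_Mapping.single \<one>\<^bsub>G\<^esub> 1"
  "\<zero>\<^bsub>monoid_algebra G\<^esub> = 0"
  "p \<oplus>\<^bsub>monoid_algebra G\<^esub> q = p + q"
  "c \<odot>\<^bsub>monoid_algebra G\<^esub> p = c *\<^sub>C p"
  by (simp_all add: monoid_algebra_def)

lemma monoid_algebra_mult:
  "p \<otimes>\<^bsub>monoid_algebra G\<^esub> q = lin_ext (\<lambda>a. lin_ext (\<lambda>b. Poly_Mapping.single (a \<otimes>\<^bsub>G\<^esub> b) 1) q) p"
  by (simp add: monoid_algebra_def lin_ext_def cvec.scale_sum_right scale_single)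

lemma lin_map_lin_ext_fun:
  assumes "\<And>k. lin_map (F k)"
  shows "lin_map (\<lambda>q. lin_ext (\<lambda>a. F a q) p)"
  by (rule lin_mapI) (simp_all add: lin_ext_def lin_map_simps[OF assms] cscale_add_right sum.distrib
      cvec.scale_sum_right mult.commute)

lemma monoid_algebra_mult_lin:
  "lin_map (\<lambda>p. p \<otimes>\<^bsub>monoid_algebra G\<^esub> q)" "lin_map (\<lambda>q. p \<otimes>\<^bsub>monoid_algebra G\<^esub> q)"
  unfolding monoid_algebra_mult using lin_map_lin_ext lin_map_lin_ext_fun[of "\<lambda>a. lin_ext (\<lambda>b. Poly_Mapping.single (a \<otimes>\<^bsub>G\<^esub> b) 1)" p]
  by (auto simp: lin_map_lin_ext)

lemma monoid_algebra_mult_single: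
  "Poly_Mapping.single a c \<otimes>\<^bsub>monoid_algebra G\<^esub> Poly_Mapping.single b d = Poly_Mapping.single (a \<otimes>\<^bsub>G\<^esub> b) (c * d)"
  by (simp add: monoid_algebra_mult lin_ext_single scale_single)

text \<open>Bilinearity reduces every law to generators. These have to lie in the carrier of
  \<open>G\<close>, which is why each induction runs over the support of the given element.\<close>

lemma calgebra_monoid_algebra:
  assumes "monoid G" shows "calgebra (monoid_algebra G)"
proof -
  interpret G: monoid G by fact
  note lin = lin_map_simps[OF monoid_algebra_mult_lin(1)] lin_map_simps[OF monoid_algebra_mult_lin(2)]
  have cl: "p \<otimes>\<^bsub>monoid_algebra G\<^esub> q \<in> carrier (monoid_algebra G)"
    if "p \<in> carrier (monoid_algebra G)" "q \<in> carrier (monoid_algebra G)" for p q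
  proof -
    have "Poly_Mapping.keys (lin_ext (\<lambda>a. lin_ext (\<lambda>b. Poly_Mapping.single (a \<otimes>\<^bsub>G\<^esub> b) (1::complex)) q) p)
      \<subseteq> carrier G"
      unfolding lin_ext_def
      by (intro order_trans[OF keys_sum] UN_least order_trans[OF keys_scale])
        (use that in \<open>auto simp: monoid_algebra_simps\<close>)
    then show ?thesis by (simp add: monoid_algebra_mult monoid_algebra_simps)
  qed
  have one: "Poly_Mapping.single \<one>\<^bsub>G\<^esub> 1 \<otimes>\<^bsub>monoid_algebra G\<^esub> p = p"
            "p \<otimes>\<^bsub>monoid_algebra G\<^esub> Poly_Mapping.single \<one>\<^bsub>G\<^esub> 1 = p"
    if p: "p \<in> carrier (monoid_algebra G)" for p
  proof -
    have "Poly_Mapping.single \<one>\<^bsub>G\<^esub> 1 \<otimes>\<^bsub>monoid_algebra G\<^esub> p = p \<and>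
          p \<otimes>\<^bsub>monoid_algebra G\<^esub> Poly_Mapping.single \<one>\<^bsub>G\<^esub> 1 = p"
    proof (induction p rule: poly_mapping_single_induct)
      case (add r k c)
      then have "k \<in> carrier G" using p by (auto simp: monoid_algebra_simps)
      with add show ?case by (simp add: lin monoid_algebra_mult_single)
    qed (simp add: lin)
    then show "Poly_Mapping.single \<one>\<^bsub>G\<^esub> 1 \<otimes>\<^bsub>monoid_algebra G\<^esub> p = p"
      "p \<otimes>\<^bsub>monoid_algebra G\<^esub> Poly_Mapping.single \<one>\<^bsub>G\<^esub> 1 = p" by auto
  qed
  have assoc: "(p \<otimes>\<^bsub>monoid_algebra G\<^esub> q) \<otimes>\<^bsub>monoid_algebra G\<^esub> r = p \<otimes>\<^bsub>monoid_algebra G\<^esub> (q \<otimes>\<^bsub>monoid_algebra G\<^esub> r)"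
    if p: "p \<in> carrier (monoid_algebra G)" and q: "q \<in> carrier (monoid_algebra G)"
      and r: "r \<in> carrier (monoid_algebra G)" for p q r
  proof (induction p rule: poly_mapping_single_induct)
    case (add p' k c)
    have k: "k \<in> carrier G" using add p by (auto simp: monoid_algebra_simps)
    have "(Poly_Mapping.single k c \<otimes>\<^bsub>monoid_algebra G\<^esub> q) \<otimes>\<^bsub>monoid_algebra G\<^esub> r =
       Poly_Mapping.single k c \<otimes>\<^bsub>monoid_algebra G\<^esub> (q \<otimes>\<^bsub>monoid_algebra G\<^esub> r)"
    proof (induction q rule: poly_mapping_single_induct)
      case (add q' l d)
      have l: "l \<in> carrier G" using add q by (auto simp: monoid_algebra_simps)
      have "(Poly_Mapping.single k c \<otimes>\<^bsub>monoid_algebra G\<^esub> Poly_Mapping.single l d) \<otimes>\<^bsub>monoid_algebra G\<^esub> r =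
       Poly_Mapping.single k c \<otimes>\<^bsub>monoid_algebra G\<^esub> (Poly_Mapping.single l d \<otimes>\<^bsub>monoid_algebra G\<^esub> r)"
      proof (induction r rule: poly_mapping_single_induct)
        case (add r' m f)
        have "m \<in> carrier G" using add r by (auto simp: monoid_algebra_simps)
        with add k l show ?case by (simp add: lin monoid_algebra_mult_single G.m_assoc mult.assoc)
      qed (simp add: lin)
      with add show ?case by (simp add: lin)
    qed (simp add: lin)
    with add show ?case by (simp add: lin)
  qed (simp add: lin)
  have keys_add': "Poly_Mapping.keys (x + y) \<subseteq> carrier G"
    if "Poly_Mapping.keys x \<subseteq> carrier G" "Poly_Mapping.keys y \<subseteq> carrier G" for x y :: "'a \<Rightarrow>\<^sub>0 complex"
    using that keys_add[of x y] by blast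
  have keys_scale': "Poly_Mapping.keys (c *\<^sub>C x) \<subseteq> carrier G"
    if "Poly_Mapping.keys x \<subseteq> carrier G" for c and x :: "'a \<Rightarrow>\<^sub>0 complex"
    using that keys_scale[of c x] by blast
  have ag: "abelian_group (monoid_algebra G)"
  proof (rule abelian_groupI)
    fix x assume "x \<in> carrier (monoid_algebra G)"
    then show "\<exists>y\<in>carrier (monoid_algebra G). y \<oplus>\<^bsub>monoid_algebra G\<^esub> x = \<zero>\<^bsub>monoid_algebra G\<^esub>"
      using keys_scale'[of x "-1"] by (intro bexI[of _ "(-1) *\<^sub>C x"]) (simp_all add: monoid_algebra_simps)
  qed (auto simp: monoid_algebra_simps keys_add' add.assoc add.commute)
  show ?thesis
  proof (intro calgebra.intro calgebra_axioms.intro ringI ag monoidI cl assoc)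
    show "\<one>\<^bsub>monoid_algebra G\<^esub> \<in> carrier (monoid_algebra G)" by (simp add: monoid_algebra_simps)
  qed (use keys_scale' in \<open>simp_all add: monoid_algebra_simps(2-5) one lin cscale_add_left cscale_add_right\<close>,
       simp_all add: monoid_algebra_simps keys_scale')
qed

section \<open>Universal property of the tensor product\<close>

lemma lin_map_tensor: "lin_map (\<lambda>x. tensor x y)" "lin_map (tensor x)"
proof -
  have *: "tensor_eq p q" if "p - q \<in> bilinear_relations" for p q :: "'x::complex_vec \<times> 'y::complex_vec \<Rightarrow>\<^sub>0 complex"
    using that by (simp add: tensor_eq_def cvec.span_base)
  show "lin_map (\<lambda>x. tensor x y)"
  proof (rule lin_mapI)
    show "tensor (x + x') y = tensor x y + tensor x' y" for x x'
      by transfer (rule *, simp add: bilinear_relations_def diff_diff_eq, blast)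
    show "tensor (c *\<^sub>C x) y = c *\<^sub>C tensor x y" for c x
      by transfer (rule *, simp add: bilinear_relations_def scale_single, blast)
  qed
  show "lin_map (tensor x)"
  proof (rule lin_mapI)
    show "tensor x (y + y') = tensor x y + tensor x y'" for y y'
      by transfer (rule *, simp add: bilinear_relations_def diff_diff_eq, blast)
    show "tensor x (c *\<^sub>C y) = c *\<^sub>C tensor x y" for c y
      by transfer (rule *, simp add: bilinear_relations_def scale_single, blast)
  qed
qed

definition bilin :: "('a::complex_vec \<Rightarrow> 'b::complex_vec \<Rightarrow> 'c::complex_vec) \<Rightarrow> bool" where
  "bilin \<phi> \<longleftrightarrow> (\<forall>y. lin_map (\<lambda>x. \<phi> x y)) \<and> (\<forall>x. lin_map (\<phi> x))"

lemma bilinI: "(\<And>y. lin_map (\<lambda>x. \<phi> x y)) \<Longrightarrow> (\<And>x. lin_map (\<phi> x)) \<Longrightarrow> bilin \<phi>"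
  by (auto simp: bilin_def)

lemma bilinD: assumes "bilin \<phi>" shows "lin_map (\<lambda>x. \<phi> x y)" "lin_map (\<phi> x)"
  using assms by (auto simp: bilin_def)

lemma bilin_add_left: "bilin \<phi> \<Longrightarrow> \<phi> (x + x') y = \<phi> x y + \<phi> x' y"
  and bilin_add_right: "bilin \<phi> \<Longrightarrow> \<phi> x (y + y') = \<phi> x y + \<phi> x y'"
  and bilin_scale_left: "bilin \<phi> \<Longrightarrow> \<phi> (c *\<^sub>C x) y = c *\<^sub>C \<phi> x y"
  and bilin_scale_right: "bilin \<phi> \<Longrightarrow> \<phi> x (c *\<^sub>C y) = c *\<^sub>C \<phi> x y"
  by (simp_all add: lin_map_simps[OF bilinD(1)] lin_map_simps[OF bilinD(2)])

lemmas bilin_simps = bilin_add_left bilin_add_right bilin_scale_left bilin_scale_right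

lemma bilin_tensor: "bilin tensor"
  by (simp add: bilin_def lin_map_tensor)

lemma lin_ext_tensor_eq:
  assumes "bilin \<phi>" "tensor_eq p q"
  shows "lin_ext (case_prod \<phi>) p = lin_ext (case_prod \<phi>) q"
proof -
  note lin = lin_map_simps[OF lin_map_lin_ext] lin_map_simps[OF bilinD(1)[OF assms(1)]]
    lin_map_simps[OF bilinD(2)[OF assms(1)]] lin_ext_single
  have "lin_ext (case_prod \<phi>) r = 0" if "r \<in> cvec.span bilinear_relations" for r
    using that
  proof (induction rule: cvec.span_induct_alt)
    case (step c x y)
    have "lin_ext (case_prod \<phi>) x = 0"
      using step(1) by (auto simp: bilinear_relations_def lin)
    with step show ?case by (simp add: lin)
  qed (simp add: lin)
  from this[of "p - q"] show ?thesis using assms(2) by (simp add: tensor_eq_def lin)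
qed

text \<open>The representative is chosen in the same way as in \<open>tensor_map\<close>, which
  makes the latter an instance by mere unfolding.\<close>

definition tensor_ext :: "('a::complex_vec \<Rightarrow> 'b::complex_vec \<Rightarrow> 'c::complex_vec) \<Rightarrow> ('a, 'b) tensor \<Rightarrow> 'c" where
  "tensor_ext \<phi> z = lin_ext (case_prod \<phi>) (SOME p. abs_tensor p = z)"

lemma abs_tensor_surj: "\<exists>p. abs_tensor p = z"
  using Quotient_abs_rep[OF Quotient_tensor] by blast

lemma abs_tensor_eq_iff: "abs_tensor p = abs_tensor q \<longleftrightarrow> tensor_eq p q"
  by (rule tensor.abs_eq_iff)

lemma tensor_ext_abs: "bilin \<phi> \<Longrightarrow> tensor_ext \<phi> (abs_tensor p) = lin_ext (case_prod \<phi>) p"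
  unfolding tensor_ext_def
  by (rule lin_ext_tensor_eq) (auto simp: abs_tensor_eq_iff[symmetric] intro: someI)

lemma tensor_ext_tensor: "bilin \<phi> \<Longrightarrow> tensor_ext \<phi> (tensor x y) = \<phi> x y"
  by (simp add: tensor.abs_eq tensor_ext_abs lin_ext_single)

lemma lin_map_tensor_ext: assumes "bilin \<phi>" shows "lin_map (tensor_ext \<phi>)"
proof (rule lin_mapI)
  fix z w :: "('a, 'b) tensor"
  obtain p q where "z = abs_tensor p" "w = abs_tensor q" using abs_tensor_surj by metis
  then show "tensor_ext \<phi> (z + w) = tensor_ext \<phi> z + tensor_ext \<phi> w"
    by (simp add: plus_tensor.abs_eq tensor_ext_abs[OF assms] lin_map_add[OF lin_map_lin_ext])
  fix c
  show "tensor_ext \<phi> (c *\<^sub>C z) = c *\<^sub>C tensor_ext \<phi> z"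
    using \<open>z = _\<close> by (simp add: cscale_tensor.abs_eq tensor_ext_abs[OF assms] lin_map_scale[OF lin_map_lin_ext])
qed

lemma tensor_map_ext: "tensor_map f g = tensor_ext (\<lambda>x y. tensor (f x) (g y))"
  by (simp add: fun_eq_iff tensor_map_def tensor_ext_def lin_ext_def case_prod_unfold Let_def)

lemma bilin_comp: "bilin \<phi> \<Longrightarrow> lin_map f \<Longrightarrow> lin_map g \<Longrightarrow> bilin (\<lambda>x y. \<phi> (f x) (g y))"
  by (auto intro!: bilinI lin_mapI simp: lin_map_simps bilin_simps)

lemma bilin_mult: 
  "lin_map f \<Longrightarrow> lin_map g \<Longrightarrow> bilin (\<lambda>x y. f x * g y :: _ :: complex_algebra)"
  by (auto intro!: bilinI lin_mapI simp: lin_map_simps cscale_mult_left cscale_mult_right distrib_left distrib_right)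

text \<open>Linearity on a carrier with values in a vector space type. It is used for
  \<open>emb\<close>, for \<open>emb\<close> after a placement, and for the zero map.\<close>

definition mod_hom :: "(complex, 'm) module \<Rightarrow> ('m \<Rightarrow> 'c::complex_vec) \<Rightarrow> bool" where
  "mod_hom M H \<longleftrightarrow> (\<forall>x\<in>carrier M. \<forall>y\<in>carrier M. H (x \<oplus>\<^bsub>M\<^esub> y) = H x + H y) \<and>
     (\<forall>c. \<forall>x\<in>carrier M. H (c \<odot>\<^bsub>M\<^esub> x) = c *\<^sub>C H x)"

lemma (in calgebra) mod_hom_emb: "mod_hom M emb"
  by (simp add: mod_hom_def emb_add emb_smult)

lemma (in calgebra) mod_hom_finsum:
  assumes "mod_hom M H" "finite S" "f \<in> S \<rightarrow> carrier M"
  shows "H (finsum M f S) = (\<Sum>s\<in>S. H (f s))"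
proof -
  have "H \<zero> = 0" using assms(1)[unfolded mod_hom_def] by (metis add_cancel_right_left l_zero zero_closed)
  with assms(2,3) show ?thesis
    by (induction S rule: finite_induct) (use assms(1) in \<open>auto simp: mod_hom_def Pi_iff\<close>)
qed

lemma subtensor_rep:
  assumes "z \<in> subtensor V W"
  shows "\<exists>p. abs_tensor p = z \<and> Poly_Mapping.keys p \<subseteq> V \<times> W"
  using assms unfolding subtensor_def
proof (induction rule: cvec.span_induct_alt)
  case base
  show ?case by (rule exI[of _ 0]) (simp add: zero_tensor.abs_eq)
next
  case (step c t z)
  then obtain p x y where *: "abs_tensor p = z" "Poly_Mapping.keys p \<subseteq> V \<times> W" "t = tensor x y" "x \<in> V" "y \<in> W" by blast
  have "abs_tensor (c *\<^sub>C Poly_Mapping.single (x, y) 1 + p) = c *\<^sub>C t + z"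
    using * by (simp add: plus_tensor.abs_eq[symmetric] cscale_tensor.abs_eq[symmetric] tensor.abs_eq)
  moreover have "Poly_Mapping.keys (c *\<^sub>C Poly_Mapping.single (x, y) (1::complex) + p) \<subseteq> V \<times> W"
    using * keys_add[of "c *\<^sub>C Poly_Mapping.single (x, y) (1::complex)" p] keys_scale[of c "Poly_Mapping.single (x, y) (1::complex)"] by auto
  ultimately show ?case by blast
qed

text \<open>\<open>\<phi>\<close> makes sense only on V \<times> W, whereas two representatives of
  \<open>z\<close> may differ by relations that leave V \<times> W. Independence of the
  representative is therefore borrowed from a form \<open>\<psi>\<close> that is bilinear on the
  whole types and agrees with \<open>H\<close> after \<open>\<phi>\<close> on V \<times> W.\<close>

lemma (in calgebra) tensor_lift:
  assumes "z \<in> subtensor V W"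
    and \<phi>: "\<And>x y. x \<in> V \<Longrightarrow> y \<in> W \<Longrightarrow> \<phi> x y \<in> carrier M"
    and H: "mod_hom M H"
    and \<psi>: "bilin \<psi>" "\<And>x y. x \<in> V \<Longrightarrow> y \<in> W \<Longrightarrow> H (\<phi> x y) = \<psi> x y"
  shows "tensor_lift M V W \<phi> z \<in> carrier M" "H (tensor_lift M V W \<phi> z) = tensor_ext \<psi> z"
proof -
  define p where "p = (SOME p. abs_tensor p = z \<and> Poly_Mapping.keys p \<subseteq> V \<times> W)"
  have p: "abs_tensor p = z" "Poly_Mapping.keys p \<subseteq> V \<times> W"
    using someI_ex[OF subtensor_rep[OF assms(1)]] unfolding p_def by auto
  have tl: "tensor_lift M V W \<phi> z = (\<Oplus>xy\<in>Poly_Mapping.keys p.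
      Poly_Mapping.lookup p xy \<odot> \<phi> (fst xy) (snd xy))"
    by (simp add: tensor_lift_def p_def Let_def)
  have cl: "(\<lambda>xy. Poly_Mapping.lookup p xy \<odot> \<phi> (fst xy) (snd xy)) \<in> Poly_Mapping.keys p \<rightarrow> carrier M"
    using p(2) \<phi> by fastforce
  show "tensor_lift M V W \<phi> z \<in> carrier M"
    unfolding tl by (rule finsum_closed[OF cl])
  have "H (tensor_lift M V W \<phi> z) = (\<Sum>xy\<in>Poly_Mapping.keys p. Poly_Mapping.lookup p xy *\<^sub>C \<psi> (fst xy) (snd xy))"
    unfolding tl mod_hom_finsum[OF H finite_keys cl]
    by (rule sum.cong) (use p(2) \<phi> \<psi>(2) H in \<open>auto simp: mod_hom_def\<close>)
  also have "\<dots> = tensor_ext \<psi> z"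
    by (simp add: p(1)[symmetric] tensor_ext_abs[OF \<psi>(1)] lin_ext_def case_prod_unfold)
  finally show "H (tensor_lift M V W \<phi> z) = tensor_ext \<psi> z" .
qed

section \<open>Enveloping algebras and their tensor products\<close>

lemma monoid_word: "Group.monoid (word_monoid k)"
  by (rule monoidI) (auto simp: word_monoid_def)

lemma keys_diff_subset:
  fixes p q :: "'k \<Rightarrow>\<^sub>0 'b::ab_group_add"
  assumes "Poly_Mapping.keys p \<subseteq> C" "Poly_Mapping.keys q \<subseteq> C"
  shows "Poly_Mapping.keys (p - q) \<subseteq> C"
  using assms by (auto simp: in_keys_iff lookup_minus subset_iff) metis

lemma keys_single_subset: "w \<in> C \<Longrightarrow> Poly_Mapping.keys (Poly_Mapping.single w c) \<subseteq> C"
  by simp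

lemma lie_subalgebraD:
  assumes "lie_subalgebra k"
  shows "0 \<in> k" "x \<in> k \<Longrightarrow> y \<in> k \<Longrightarrow> x + y \<in> k" "x \<in> k \<Longrightarrow> c *\<^sub>C x \<in> k"
    "x \<in> k \<Longrightarrow> y \<in> k \<Longrightarrow> bracket x y \<in> k"
  using assms by (auto simp: lie_subalgebra_def cvec.subspace_def)

lemma lie_subalgebra_UNIV: "lie_subalgebra UNIV"
  by (simp add: lie_subalgebra_def)

lemma uea_relations_carrier:
  assumes "lie_subalgebra k"
  shows "uea_relations k \<subseteq> carrier (monoid_algebra (word_monoid k))"
  unfolding uea_relations_def
  by (intro Un_least subsetI; elim CollectE exE conjE;
      simp only: monoid_algebra_simps mem_Collect_eq;
      intro keys_diff_subset keys_single_subset;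
      simp add: word_monoid_def lie_subalgebraD[OF assms])

lemma calgebra_uea: "lie_subalgebra k \<Longrightarrow> calgebra (uea k)"
  unfolding uea_def
  by (intro calgebra.calgebra_quot calgebra_monoid_algebra monoid_word uea_relations_carrier)

context
  fixes k :: "'g::complex_lie_algebra set" assumes k: "lie_subalgebra k"
begin

interpretation W: calgebra "monoid_algebra (word_monoid k)"
  by (intro calgebra_monoid_algebra monoid_word)

lemma single_word_carrier: "x \<in> k \<Longrightarrow> Poly_Mapping.single [x] c \<in> carrier (monoid_algebra (word_monoid k))"
  by (auto simp: monoid_algebra_simps word_monoid_def)

lemma word_mult: "Poly_Mapping.single u c \<otimes>\<^bsub>monoid_algebra (word_monoid k)\<^esub> Poly_Mapping.single v d
   = Poly_Mapping.single (u @ v) (c * d)"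
  by (simp add: monoid_algebra_mult_single) (simp add: word_monoid_def)

lemma uea_in_closed: "x \<in> k \<Longrightarrow> uea_in k x \<in> carrier (uea k)"
  unfolding uea_in_def uea_def
  by (intro W.quot_class_closed uea_relations_carrier k single_word_carrier)

lemma uea_in_add:
  assumes "x \<in> k" "y \<in> k" shows "uea_in k (x + y) = uea_in k x \<oplus>\<^bsub>uea k\<^esub> uea_in k y"
proof -
  have "uea_in k (x + y) = quot_class (monoid_algebra (word_monoid k)) (uea_relations k)
     (Poly_Mapping.single [x] 1 \<oplus>\<^bsub>monoid_algebra (word_monoid k)\<^esub> Poly_Mapping.single [y] 1)"
    unfolding uea_in_def
  proof (rule W.quot_class_eqI[OF uea_relations_carrier[OF k], 
      where r = "Poly_Mapping.single [x + y] 1 - Poly_Mapping.single [x] 1 - Poly_Mapping.single [y] 1"])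
    show "Poly_Mapping.single [x + y] 1 - Poly_Mapping.single [x] 1 - Poly_Mapping.single [y] (1::complex) \<in> uea_relations k"
      using assms unfolding uea_relations_def by blast
  qed (simp_all add: assms single_word_carrier, simp add: monoid_algebra_simps)
  then show ?thesis
    by (simp add: uea_in_def uea_def W.quot_class_add[OF uea_relations_carrier[OF k]] assms single_word_carrier)
qed

lemma uea_in_scale:
  assumes "x \<in> k" shows "uea_in k (c *\<^sub>C x) = c \<odot>\<^bsub>uea k\<^esub> uea_in k x"
proof -
  have "uea_in k (c *\<^sub>C x) = quot_class (monoid_algebra (word_monoid k)) (uea_relations k)
     (c \<odot>\<^bsub>monoid_algebra (word_monoid k)\<^esub> Poly_Mapping.single [x] 1)"
    unfolding uea_in_def
  proof (rule W.quot_class_eqI[OF uea_relations_carrier[OF k], 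
      where r = "Poly_Mapping.single [c *\<^sub>C x] 1 - Poly_Mapping.single [x] c"])
    show "Poly_Mapping.single [c *\<^sub>C x] 1 - Poly_Mapping.single [x] c \<in> uea_relations k"
      using assms unfolding uea_relations_def by blast
  qed (simp_all add: assms single_word_carrier, simp add: monoid_algebra_simps scale_single)
  then show ?thesis
    by (simp add: uea_in_def uea_def W.quot_class_smult[OF uea_relations_carrier[OF k]] assms single_word_carrier)
qed

text \<open>The sum on the right, in place of a commutator on the left, avoids subtraction in the
  carrier and is the shape that \<open>quot_class_eqI\<close> delivers.\<close>

lemma uea_in_bracket:
  assumes "x \<in> k" "y \<in> k"
  shows "uea_in k x \<otimes>\<^bsub>uea k\<^esub> uea_in k y
    = uea_in k (bracket x y) \<oplus>\<^bsub>uea k\<^esub> uea_in k y \<otimes>\<^bsub>uea k\<^esub> uea_in k x"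
proof -
  let ?A = "monoid_algebra (word_monoid k)"
  note q = W.quot_class_add[OF uea_relations_carrier[OF k]] W.quot_class_mult[OF uea_relations_carrier[OF k]]
  have br: "bracket x y \<in> k" using lie_subalgebraD(4)[OF k assms] .
  have "quot_class ?A (uea_relations k) (Poly_Mapping.single [x] 1 \<otimes>\<^bsub>?A\<^esub> Poly_Mapping.single [y] 1) =
     quot_class ?A (uea_relations k) 
     (Poly_Mapping.single [bracket x y] 1 \<oplus>\<^bsub>?A\<^esub> Poly_Mapping.single [y] 1 \<otimes>\<^bsub>?A\<^esub> Poly_Mapping.single [x] 1)"
  proof (rule W.quot_class_eqI[OF uea_relations_carrier[OF k], 
      where r = "Poly_Mapping.single [x, y] 1 - Poly_Mapping.single [y, x] 1 - Poly_Mapping.single [bracket x y] 1"])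
    show "Poly_Mapping.single [x, y] 1 - Poly_Mapping.single [y, x] 1 - Poly_Mapping.single [bracket x y] (1::complex) \<in> uea_relations k"
      using assms unfolding uea_relations_def by blast
  qed (simp_all add: assms br single_word_carrier, simp add: monoid_algebra_simps(4) word_mult)
  then show ?thesis
    by (simp add: uea_in_def uea_def q assms br single_word_carrier)
qed

end

section \<open>Placing elements in a tensor product of algebras\<close>

lemma monoid_product:
  assumes "\<And>j. j \<in> J \<Longrightarrow> Group.monoid (A j)"
  shows "Group.monoid (product_monoid J A)"
proof (rule monoidI)
  note m = monoid.m_closed[OF assms] monoid.one_closed[OF assms] monoid.m_assoc[OF assms]
    monoid.l_one[OF assms] monoid.r_one[OF assms]
  show "x \<otimes>\<^bsub>product_monoid J A\<^esub> y \<in> carrier (product_monoid J A)"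
    if "x \<in> carrier (product_monoid J A)" "y \<in> carrier (product_monoid J A)" for x y
    using that m by (auto simp: product_monoid_def PiE_iff)
  show "x \<otimes>\<^bsub>product_monoid J A\<^esub> y \<otimes>\<^bsub>product_monoid J A\<^esub> z = x \<otimes>\<^bsub>product_monoid J A\<^esub> (y \<otimes>\<^bsub>product_monoid J A\<^esub> z)"
    if "x \<in> carrier (product_monoid J A)" "y \<in> carrier (product_monoid J A)" "z \<in> carrier (product_monoid J A)" for x y z
    using that m by (auto simp: product_monoid_def PiE_iff intro!: restrict_ext)
  show "\<one>\<^bsub>product_monoid J A\<^esub> \<in> carrier (product_monoid J A)"
    using m by (auto simp: product_monoid_def)
  show "\<one>\<^bsub>product_monoid J A\<^esub> \<otimes>\<^bsub>product_monoid J A\<^esub> x = x" if "x \<in> carrier (product_monoid J A)" for x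
    using that m by (auto simp: product_monoid_def PiE_iff extensional_def fun_eq_iff)
  show "x \<otimes>\<^bsub>product_monoid J A\<^esub> \<one>\<^bsub>product_monoid J A\<^esub> = x" if "x \<in> carrier (product_monoid J A)" for x
    using that m by (auto simp: product_monoid_def PiE_iff extensional_def fun_eq_iff)
qed

locale algebra_family =
  fixes J :: "'j set" and A :: "'j \<Rightarrow> (complex, 'a) module"
  assumes calg: "j \<in> J \<Longrightarrow> calgebra (A j)"
begin

abbreviation "PA \<equiv> monoid_algebra (product_monoid J A)"

lemma ring: "j \<in> J \<Longrightarrow> ring (A j)"
  using calg by (simp add: calgebra_def)

lemma mon: "j \<in> J \<Longrightarrow> Group.monoid (A j)"
  using ring by (simp add: ring_def)

sublocale P: calgebra PA
  by (intro calgebra_monoid_algebra monoid_product mon)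

definition pos_fun :: "'j \<Rightarrow> 'a \<Rightarrow> 'j \<Rightarrow> 'a" where
  "pos_fun j u = (\<lambda>l\<in>J. if l = j then u else \<one>\<^bsub>A l\<^esub>)"

lemma in_position_pos_fun:
  "in_position J A j u = quot_class PA (multilinear_relations J A) (Poly_Mapping.single (pos_fun j u) 1)"
  by (simp add: in_position_def pos_fun_def)

lemma fun_upd_carrier:
  "f \<in> carrier (product_monoid J A) \<Longrightarrow> j \<in> J \<Longrightarrow> u \<in> carrier (A j) \<Longrightarrow> f(j := u) \<in> carrier (product_monoid J A)"
  by (auto simp: product_monoid_def PiE_iff extensional_def)

lemma multilinear_relations_carrier: "multilinear_relations J A \<subseteq> carrier PA"
proof -
  have a: "u \<oplus>\<^bsub>A j\<^esub> v \<in> carrier (A j)" if "j \<in> J" "u \<in> carrier (A j)" "v \<in> carrier (A j)" for j u v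
    using that by (meson abelian_monoid.a_closed ring ring.is_abelian_group abelian_group.axioms(1))
  have s: "c \<odot>\<^bsub>A j\<^esub> u \<in> carrier (A j)" if "j \<in> J" "u \<in> carrier (A j)" for j u c
    using that calgebra.smult_closed[OF calg] by blast
  show ?thesis
    unfolding multilinear_relations_def
    by (intro Un_least subsetI; elim CollectE exE conjE;
      simp only: monoid_algebra_simps mem_Collect_eq;
      intro keys_diff_subset keys_single_subset;
      simp add: fun_upd_carrier a s)
qed

lemma calgebra_tensor: "calgebra (tensor_algebras J A)"
  unfolding tensor_algebras_def by (rule P.calgebra_quot[OF multilinear_relations_carrier])

lemma pos_fun_carrier: "u \<in> carrier (A j) \<Longrightarrow> pos_fun j u \<in> carrier (product_monoid J A)"
  using mon by (auto simp: product_monoid_def pos_fun_def monoid.one_closed)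

lemma single_pos_carrier: "u \<in> carrier (A j) \<Longrightarrow> Poly_Mapping.single (pos_fun j u) c \<in> carrier PA"
  using pos_fun_carrier by (auto simp: monoid_algebra_simps)

lemma pos_fun_upd: "j \<in> J \<Longrightarrow> (pos_fun j u)(j := v) = pos_fun j v"
  by (auto simp: pos_fun_def fun_eq_iff)

lemma in_position_closed: "u \<in> carrier (A j) \<Longrightarrow> in_position J A j u \<in> carrier (tensor_algebras J A)"
  unfolding in_position_pos_fun tensor_algebras_def
  by (intro P.quot_class_closed multilinear_relations_carrier single_pos_carrier)

lemma in_position_add:
  assumes "j \<in> J" "u \<in> carrier (A j)" "v \<in> carrier (A j)"
  shows "in_position J A j (u \<oplus>\<^bsub>A j\<^esub> v) = in_position J A j u \<oplus>\<^bsub>tensor_algebras J A\<^esub> in_position J A j v"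
proof -
  have "in_position J A j (u \<oplus>\<^bsub>A j\<^esub> v) = quot_class PA (multilinear_relations J A)
     (Poly_Mapping.single (pos_fun j u) 1 \<oplus>\<^bsub>PA\<^esub> Poly_Mapping.single (pos_fun j v) 1)"
    unfolding in_position_pos_fun
  proof (rule P.quot_class_eqI[OF multilinear_relations_carrier, 
      where r = "Poly_Mapping.single (pos_fun j (u \<oplus>\<^bsub>A j\<^esub> v)) 1 - Poly_Mapping.single (pos_fun j u) 1 - Poly_Mapping.single (pos_fun j v) 1"])
    show "Poly_Mapping.single (pos_fun j (u \<oplus>\<^bsub>A j\<^esub> v)) 1 - Poly_Mapping.single (pos_fun j u) 1 - Poly_Mapping.single (pos_fun j v) (1::complex) \<in> multilinear_relations J A"
      unfolding multilinear_relations_def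
      by (rule UnI1, rule CollectI, intro exI[of _ "pos_fun j u"] exI[of _ j] exI[of _ u] exI[of _ v])
        (simp add: pos_fun_upd assms pos_fun_carrier)
  qed (simp_all add: assms single_pos_carrier, simp add: monoid_algebra_simps)
  then show ?thesis
    by (simp add: in_position_pos_fun tensor_algebras_def P.quot_class_add[OF multilinear_relations_carrier] assms single_pos_carrier)
qed

lemma in_position_smult:
  assumes "j \<in> J" "u \<in> carrier (A j)"
  shows "in_position J A j (c \<odot>\<^bsub>A j\<^esub> u) = c \<odot>\<^bsub>tensor_algebras J A\<^esub> in_position J A j u"
proof -
  have "in_position J A j (c \<odot>\<^bsub>A j\<^esub> u) = quot_class PA (multilinear_relations J A)
     (c \<odot>\<^bsub>PA\<^esub> Poly_Mapping.single (pos_fun j u) 1)"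
    unfolding in_position_pos_fun
  proof (rule P.quot_class_eqI[OF multilinear_relations_carrier, 
      where r = "Poly_Mapping.single (pos_fun j (c \<odot>\<^bsub>A j\<^esub> u)) 1 - Poly_Mapping.single (pos_fun j u) c"])
    show "Poly_Mapping.single (pos_fun j (c \<odot>\<^bsub>A j\<^esub> u)) 1 - Poly_Mapping.single (pos_fun j u) c \<in> multilinear_relations J A"
      unfolding multilinear_relations_def
      by (rule UnI2, rule CollectI, intro exI[of _ "pos_fun j u"] exI[of _ j] exI[of _ c] exI[of _ u])
        (simp add: pos_fun_upd assms pos_fun_carrier)
  qed (simp_all add: assms single_pos_carrier, simp add: monoid_algebra_simps scale_single)
  then show ?thesis
    by (simp add: in_position_pos_fun tensor_algebras_def P.quot_class_smult[OF multilinear_relations_carrier] assms single_pos_carrier)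
qed

lemma in_position_mult_aux:
  assumes "u \<in> carrier (A i)" "v \<in> carrier (A j)"
  shows "in_position J A i u \<otimes>\<^bsub>tensor_algebras J A\<^esub> in_position J A j v =
    quot_class PA (multilinear_relations J A)
      (Poly_Mapping.single (pos_fun i u \<otimes>\<^bsub>product_monoid J A\<^esub> pos_fun j v) 1)"
  by (simp add: in_position_pos_fun tensor_algebras_def P.quot_class_mult[OF multilinear_relations_carrier] assms
      single_pos_carrier monoid_algebra_mult_single)

lemma in_position_mult:
  assumes "u \<in> carrier (A j)" "v \<in> carrier (A j)"
  shows "in_position J A j (u \<otimes>\<^bsub>A j\<^esub> v) = in_position J A j u \<otimes>\<^bsub>tensor_algebras J A\<^esub> in_position J A j v"
proof -
  have "pos_fun j u \<otimes>\<^bsub>product_monoid J A\<^esub> pos_fun j v = pos_fun j (u \<otimes>\<^bsub>A j\<^esub> v)"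
    using mon by (auto simp: pos_fun_def product_monoid_def monoid.l_one fun_eq_iff)
  then show ?thesis by (simp add: in_position_mult_aux assms) (simp add: in_position_pos_fun)
qed

text \<open>At every position of \<open>J\<close> at least one of the two entries is the
  unit.\<close>

lemma in_position_commute:
  assumes "i \<noteq> j" "u \<in> carrier (A i)" "v \<in> carrier (A j)"
  shows "in_position J A i u \<otimes>\<^bsub>tensor_algebras J A\<^esub> in_position J A j v =
    in_position J A j v \<otimes>\<^bsub>tensor_algebras J A\<^esub> in_position J A i u"
proof -
  have "pos_fun i u \<otimes>\<^bsub>product_monoid J A\<^esub> pos_fun j v = pos_fun j v \<otimes>\<^bsub>product_monoid J A\<^esub> pos_fun i u"
    using mon assms by (auto simp: pos_fun_def product_monoid_def monoid.l_one monoid.r_one fun_eq_iff)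
  then show ?thesis by (simp add: in_position_mult_aux assms)
qed

end

lemma subtensor_UNIV: "subtensor UNIV UNIV = UNIV"
proof -
  have "z \<in> subtensor UNIV UNIV" for z :: "('a::complex_vec, 'b::complex_vec) tensor"
  proof -
    obtain p where p: "z = abs_tensor p" using abs_tensor_surj by metis
    have "abs_tensor p \<in> subtensor UNIV UNIV"
    proof (induction p rule: poly_mapping_single_induct)
      case zero
      show ?case by (simp add: subtensor_def cvec.span_zero zero_tensor.abs_eq[symmetric])
    next
      case (add p k c)
      have "abs_tensor (Poly_Mapping.single k c) = c *\<^sub>C tensor (fst k) (snd k)"
        by (simp add: tensor.abs_eq cscale_tensor.abs_eq scale_single)
      moreover have "c *\<^sub>C tensor (fst k) (snd k) \<in> subtensor UNIV UNIV"
        unfolding subtensor_def by (intro cvec.span_scale cvec.span_base) auto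
      ultimately show ?case using add
        by (simp add: plus_tensor.abs_eq[symmetric] subtensor_def cvec.span_add)
    qed
    then show ?thesis by (simp add: p)
  qed
  then show ?thesis by blast
qed

section \<open>The boundary algebra and its sites\<close>

locale boundary_sites =
  fixes N :: nat and k :: "'g::complex_lie_algebra set"
  assumes k: "lie_subalgebra k"
begin

lemma lie_subalgebra_slot: "lie_subalgebra (slot N k j)"
  by (simp add: slot_def k lie_subalgebra_UNIV)

sublocale fam: algebra_family "{0..N + 1}" "\<lambda>j. uea (slot N k j)"
  by (rule algebra_family.intro) (simp add: calgebra_uea lie_subalgebra_slot)

abbreviation "T \<equiv> boundary_algebra N k"

sublocale T: calgebra T
  unfolding boundary_algebra_def by (rule fam.calgebra_tensor)

lemmas place_defs = place1_def boundary_algebra_def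

lemma place1_closed: "u \<in> carrier (uea (slot N k j)) \<Longrightarrow> place1 N k j u \<in> carrier T"
  unfolding place_defs by (rule fam.in_position_closed)

lemma place1_add:
  "j \<le> N + 1 \<Longrightarrow> u \<in> carrier (uea (slot N k j)) \<Longrightarrow> v \<in> carrier (uea (slot N k j)) \<Longrightarrow>
   place1 N k j (u \<oplus>\<^bsub>uea (slot N k j)\<^esub> v) = place1 N k j u \<oplus>\<^bsub>T\<^esub> place1 N k j v"
  unfolding place_defs by (rule fam.in_position_add) auto

lemma place1_smult:
  "j \<le> N + 1 \<Longrightarrow> u \<in> carrier (uea (slot N k j)) \<Longrightarrow>
   place1 N k j (c \<odot>\<^bsub>uea (slot N k j)\<^esub> u) = c \<odot>\<^bsub>T\<^esub> place1 N k j u"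
  unfolding place_defs by (rule fam.in_position_smult) auto

lemma place1_mult:
  "u \<in> carrier (uea (slot N k j)) \<Longrightarrow> v \<in> carrier (uea (slot N k j)) \<Longrightarrow>
   place1 N k j (u \<otimes>\<^bsub>uea (slot N k j)\<^esub> v) = place1 N k j u \<otimes>\<^bsub>T\<^esub> place1 N k j v"
  unfolding place_defs by (rule fam.in_position_mult)

lemma mod_hom_place1:
  assumes "j \<le> N + 1"
  shows "mod_hom (uea (slot N k j)) (\<lambda>u. T.emb (place1 N k j u))"
  using assms unfolding mod_hom_def
  by (simp add: place1_add place1_smult place1_closed T.emb_add T.emb_smult)

text \<open>The operator by which \<open>x\<close> acts when placed at position \<open>j\<close>. It
  obeys the rules below only for \<open>x\<close> in the slot, that is, in \<open>k\<close> at the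
  two boundary positions.\<close>

definition site :: "nat \<Rightarrow> 'g \<Rightarrow> ((((nat \<Rightarrow> ('g list \<Rightarrow>\<^sub>0 complex) set) \<Rightarrow>\<^sub>0 complex) set) \<Rightarrow>\<^sub>0 complex) endo" where
  "site j x = T.emb (place1 N k j (uea_in (slot N k j) x))"

lemma site_add: "j \<le> N + 1 \<Longrightarrow> x \<in> slot N k j \<Longrightarrow> y \<in> slot N k j \<Longrightarrow> site j (x + y) = site j x + site j y"
  using mod_hom_place1[of j] uea_in_closed[OF lie_subalgebra_slot]
  by (simp add: site_def uea_in_add[OF lie_subalgebra_slot] mod_hom_def)

lemma site_scale: "j \<le> N + 1 \<Longrightarrow> x \<in> slot N k j \<Longrightarrow> site j (c *\<^sub>C x) = c *\<^sub>C site j x"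
  using mod_hom_place1[of j] uea_in_closed[OF lie_subalgebra_slot]
  by (simp add: site_def uea_in_scale[OF lie_subalgebra_slot] mod_hom_def)

lemma emb_place1_mult: "u \<in> carrier (uea (slot N k j)) \<Longrightarrow> v \<in> carrier (uea (slot N k j)) \<Longrightarrow>
  T.emb (place1 N k j (u \<otimes>\<^bsub>uea (slot N k j)\<^esub> v)) = T.emb (place1 N k j u) * T.emb (place1 N k j v)"
  by (simp add: place1_mult T.emb_mult place1_closed)

lemma site_bracket:
  assumes "j \<le> N + 1" "x \<in> slot N k j" "y \<in> slot N k j"
  shows "site j (bracket x y) = site j x * site j y - site j y * site j x"
proof -
  interpret U: calgebra "uea (slot N k j)" by (rule calgebra_uea[OF lie_subalgebra_slot])
  note c = uea_in_closed[OF lie_subalgebra_slot] lie_subalgebraD(4)[OF lie_subalgebra_slot]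
  have "site j x * site j y = T.emb (place1 N k j (uea_in (slot N k j) x \<otimes>\<^bsub>uea (slot N k j)\<^esub> uea_in (slot N k j) y))"
    using assms by (simp add: site_def emb_place1_mult c)
  also have "\<dots> = site j (bracket x y) + site j y * site j x"
    unfolding uea_in_bracket[OF lie_subalgebra_slot assms(2,3)]
    using assms mod_hom_place1[OF assms(1)]
    by (simp add: c mod_hom_def emb_place1_mult site_def)
  finally show ?thesis by simp
qed

lemma site_commute:
  assumes "i \<noteq> j" "x \<in> slot N k i" "y \<in> slot N k j"
  shows "site i x * site j y = site j y * site i x"
proof -
  note c = uea_in_closed[OF lie_subalgebra_slot]
  have "place1 N k i (uea_in (slot N k i) x) \<otimes>\<^bsub>T\<^esub> place1 N k j (uea_in (slot N k j) y) =
    place1 N k j (uea_in (slot N k j) y) \<otimes>\<^bsub>T\<^esub> place1 N k i (uea_in (slot N k i) x)"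
    unfolding place_defs by (rule fam.in_position_commute) (simp_all add: assms c)
  then show ?thesis
    using assms by (simp add: site_def T.emb_mult[symmetric] place1_closed c)
qed

text \<open>At a boundary position \<open>site\<close> is known to be linear only on
  \<open>k\<close>. The form \<open>\<psi>\<close> replaces the product of the two site maps by one
  that is bilinear everywhere.\<close>

lemma place2:
  assumes "z \<in> subtensor (slot N k i) (slot N k j)" "bilin \<psi>"
    and "\<And>x y. x \<in> slot N k i \<Longrightarrow> y \<in> slot N k j \<Longrightarrow> \<psi> x y = site i x * site j y"
  shows "place2 N k i j z \<in> carrier T" "T.emb (place2 N k i j z) = tensor_ext \<psi> z"
  unfolding place2_def
  by (rule T.tensor_lift[OF assms(1) _ T.mod_hom_emb assms(2)];
      simp add: place1_closed uea_in_closed[OF lie_subalgebra_slot] T.emb_mult assms(3) site_def)+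

lemma lin_map_site: "j \<in> {1..N} \<Longrightarrow> lin_map (site j)"
  by (rule lin_mapI) (auto intro: site_add site_scale simp: slot_def)

lemma uea_mult_closed: "uea_mult z \<in> carrier (uea (UNIV :: 'g set))"
  and place1_uea_mult: "j \<in> {1..N} \<Longrightarrow>
     T.emb (place1 N k j (uea_mult z)) = tensor_ext (\<lambda>x y. site j x * site j y) z"
proof -
  interpret U: calgebra "uea (UNIV :: 'g set)" by (rule calgebra_uea[OF lie_subalgebra_UNIV])
  have z: "z \<in> subtensor UNIV UNIV" by (simp add: subtensor_UNIV)
  note c = uea_in_closed[OF lie_subalgebra_UNIV]
  \<comment> \<open>Only membership is wanted here, so the zero map and the zero form serve for
    \<open>H\<close> and \<open>\<psi>\<close>.\<close>
  have "mod_hom (uea (UNIV :: 'g set)) (\<lambda>_. 0 :: 'g)" by (simp add: mod_hom_def)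
  then show "uea_mult z \<in> carrier (uea (UNIV :: 'g set))"
    unfolding uea_mult_def
    by (rule U.tensor_lift(1)[OF z, where \<psi> = "\<lambda>_ _. 0", rotated]) (simp_all add: c bilin_def lin_map_def[symmetric] lin_mapI)
  assume j: "j \<in> {1..N}"
  then have s: "slot N k j = UNIV" by (simp add: slot_def)
  have "mod_hom (uea (UNIV :: 'g set)) (\<lambda>u. T.emb (place1 N k j u))"
    using mod_hom_place1[of j] j by (simp add: s)
  moreover have "bilin (\<lambda>x y. site j x * site j y)"
    by (intro bilin_mult lin_map_site j)
  ultimately show "T.emb (place1 N k j (uea_mult z)) = tensor_ext (\<lambda>x y. site j x * site j y) z"
    unfolding uea_mult_def
    by (rule U.tensor_lift(2)[OF z, rotated])
      (use emb_place1_mult[of _ j] in \<open>simp_all add: c s site_def\<close>)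
qed

end

section \<open>Commuting elements from a projection onto a subalgebra\<close>

definition commutator :: "'a::ring \<Rightarrow> 'a \<Rightarrow> 'a" where
  "commutator x y = x * y - y * x"

lemma commutator_add_left: "commutator (x + y) z = commutator x z + commutator y z"
  and commutator_add_right: "commutator x (y + z) = commutator x y + commutator x z"
  and commutator_diff_left: "commutator (x - y) z = commutator x z - commutator y z"
  and commutator_diff_right: "commutator x (y - z) = commutator x y - commutator x z"
  and commutator_zero: "commutator 0 x = 0" "commutator x 0 = 0"
  and commutator_mult_right: "commutator x (y * z) = y * commutator x z + commutator x y * z"
  and commutator_mult_left: "commutator (x * y) z = x * commutator y z + commutator x z * y"
  by (simp_all add: commutator_def algebra_simps)

lemma commutator_flip: "commutator x y = - commutator y x"
  by (simp add: commutator_def)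

lemma commutator_sum_left: "commutator (sum f S) z = (\<Sum>s\<in>S. commutator (f s) z)"
  by (induction S rule: infinite_finite_induct) (simp_all add: commutator_zero commutator_add_left)

lemma commutator_sum_right: "commutator z (sum f S) = (\<Sum>s\<in>S. commutator z (f s))"
  by (induction S rule: infinite_finite_induct) (simp_all add: commutator_zero commutator_add_right)

lemma commutator_eq_zero: "commutator x y = 0 \<longleftrightarrow> x * y = y * x"
  by (simp add: commutator_def)

lemma commutator_scale_left: "commutator (c *\<^sub>C x) y = c *\<^sub>C commutator x (y :: 'a::complex_algebra)"
  and commutator_scale_right: "commutator x (c *\<^sub>C y) = c *\<^sub>C commutator x (y :: 'a::complex_algebra)"
  by (simp_all add: commutator_def cscale_mult_left cscale_mult_right cvec.scale_right_diff_distrib)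

text \<open>The class demands linearity of the bracket only in its first argument. Linearity in the
  second is assumed here and supplied for simple algebras by \<open>simple_right_linear\<close>;
  antisymmetry follows from both.\<close>

locale right_linear_lie =
  fixes type :: "'g::complex_lie_algebra itself"
  assumes lin_map_bracket_right: "lin_map (bracket (x :: 'g))"
begin

lemma lin_map_bracket_left: "lin_map (\<lambda>x. bracket x (y :: 'g))"
  by (simp add: lin_mapI bracket_add_left bracket_scale_left)

lemmas bracket_simps = lin_map_simps[OF lin_map_bracket_right] lin_map_simps[OF lin_map_bracket_left]

lemma bracket_anti: "bracket x y = - bracket y (x :: 'g)"
proof -
  have "bracket x (x + y) + bracket y (x + y) = 0"
    using bracket_self[of "x + y"] by (simp only: bracket_add_left)
  then have "bracket x y + bracket y x = 0" by (simp only: bracket_simps bracket_self add_0_left add_0_right)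
  then show ?thesis by (simp add: eq_neg_iff_add_eq_0)
qed

end

lemma bilin_sum_left: "bilin F \<Longrightarrow> F (sum f S) y = (\<Sum>s\<in>S. F (f s) y)"
  and bilin_sum_right: "bilin F \<Longrightarrow> F x (sum f S) = (\<Sum>s\<in>S. F x (f s))"
  and bilin_neg_left: "bilin F \<Longrightarrow> F (- x) y = - F x y"
  and bilin_neg_right: "bilin F \<Longrightarrow> F x (- y) = - F x y"
  by (simp_all add: lin_map_simps[OF bilinD(1)] lin_map_simps[OF bilinD(2)])

text \<open>Duality is expressed by the two expansion formulas rather than by pairing values, since
  moving a bracket from one leg of the tensor to the other consists of two expansions.\<close>

locale dual_bases = right_linear_lie "TYPE('g::complex_lie_algebra)" +
  fixes K :: "'g::complex_lie_algebra \<Rightarrow> 'g \<Rightarrow> complex"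
    and J :: "'j set" and u u' :: "'j \<Rightarrow> 'g"
  assumes finite_J: "finite J"
    and K_bilin: "bilin K" and K_sym: "K x y = K y x" and K_inv: "K (bracket x y) z = K x (bracket y z)"
    and expand: "z = (\<Sum>a\<in>J. K (u' a) z *\<^sub>C u a)"
    and expand': "z = (\<Sum>a\<in>J. K (u a) z *\<^sub>C u' a)"
begin

text \<open>\<open>bracket z\<close> is skew for \<open>K\<close>, so its matrix in the basis
  \<open>u\<close> is minus the transpose of its matrix in the dual basis \<open>u'\<close>.
  \<open>F\<close> stands for the two legs together with whatever is multiplied around them.\<close>

lemma casimir_invariant:
  assumes F: "bilin F"
  shows "(\<Sum>a\<in>J. F (u a) (bracket z (u' a))) = - (\<Sum>a\<in>J. F (bracket z (u a)) (u' a))"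
proof -
  have "(\<Sum>a\<in>J. F (bracket z (u a)) (u' a)) = (\<Sum>a\<in>J. \<Sum>c\<in>J. K (u' c) (bracket z (u a)) *\<^sub>C F (u c) (u' a))"
    by (subst (2) expand) (simp add: bilin_sum_left[OF F] bilin_simps[OF F])
  also have "\<dots> = (\<Sum>c\<in>J. \<Sum>a\<in>J. - (K (u a) (bracket z (u' c)) *\<^sub>C F (u c) (u' a)))"
  proof -
    have "K (u' c) (bracket z (u a)) = - K (u a) (bracket z (u' c))" for a c
      using K_inv[of "u' c" z "u a"] bracket_anti[of "u' c" z]
        K_sym[of "bracket z (u' c)" "u a"] bilin_neg_left[OF K_bilin, of "bracket z (u' c)" "u a"] by simp
    then show ?thesis by (subst sum.swap) simp
  qed
  also have "\<dots> = - (\<Sum>c\<in>J. F (u c) (\<Sum>a\<in>J. K (u a) (bracket z (u' c)) *\<^sub>C u' a))"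
    by (simp add: bilin_sum_right[OF F] bilin_simps[OF F] sum_negf)
  also have "\<dots> = - (\<Sum>c\<in>J. F (u c) (bracket z (u' c)))" by (simp add: expand'[symmetric])
  finally show ?thesis by simp
qed

lemma casimir_invariant_flip:
  assumes F: "bilin F"
  shows "(\<Sum>a\<in>J. F (u a) (bracket (u' a) z)) = (\<Sum>a\<in>J. F (bracket z (u a)) (u' a))"
  using casimir_invariant[OF F, of z] by (subst bracket_anti) (simp add: bilin_neg_right[OF F] sum_negf)

end

text \<open>\<open>\<iota> i\<close> embeds the Lie algebra at a bulk site;
  \<open>\<theta> s\<close> is \<Theta> followed by the embedding at a site of \<open>S\<close>. At
  boundary sites only this composite is available. With p = \<Sum> \<Theta> u_a \<otimes> u'_a and
  the Casimir tensor w = \<Sum> u'_a \<otimes> u_a, the assumption on \<open>t\<close> says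
  [t_1, p_12] + [p_21 - w_12, t_2] = 0.\<close>

locale boundary_kz = dual_bases K J u u'
  for K :: "'g::complex_lie_algebra \<Rightarrow> 'g \<Rightarrow> complex" and J :: "'j set" and u u' :: "'j \<Rightarrow> 'g" +
  fixes \<Theta> :: "'g \<Rightarrow> 'g" and N :: nat and S :: "nat set"
    and \<iota> \<theta> :: "nat \<Rightarrow> 'g \<Rightarrow> 'r::complex_algebra" and t :: 'g
  assumes \<Theta>_lin: "lin_map \<Theta>"
    and \<Theta>_bracket: "bracket (\<Theta> x) (\<Theta> y) = \<Theta> (bracket (\<Theta> x) y + bracket x (\<Theta> y) - bracket x y)"
    and S: "finite S" "{1..N} \<subseteq> S"
    and \<iota>_lin: "i \<in> {1..N} \<Longrightarrow> lin_map (\<iota> i)"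
    and \<iota>_bracket: "i \<in> {1..N} \<Longrightarrow> \<iota> i (bracket x y) = commutator (\<iota> i x) (\<iota> i y)"
    and \<theta>_lin: "s \<in> S \<Longrightarrow> lin_map (\<theta> s)"
    and \<theta>_bracket: "s \<in> S \<Longrightarrow>
      commutator (\<theta> s x) (\<theta> s y) = \<theta> s (bracket (\<Theta> x) y + bracket x (\<Theta> y) - bracket x y)"
    and \<theta>_\<iota>: "i \<in> {1..N} \<Longrightarrow> \<theta> i x = \<iota> i (\<Theta> x)"
    and \<theta>_commute: "s \<in> S \<Longrightarrow> s' \<in> S \<Longrightarrow> s \<noteq> s' \<Longrightarrow> commutator (\<theta> s x) (\<theta> s' y) = 0"
    and \<theta>_\<iota>_commute: "s \<in> S \<Longrightarrow> i \<in> {1..N} \<Longrightarrow> s \<noteq> i \<Longrightarrow> commutator (\<theta> s x) (\<iota> i y) = 0"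
    and \<iota>_commute: "i \<in> {1..N} \<Longrightarrow> j \<in> {1..N} \<Longrightarrow> i \<noteq> j \<Longrightarrow> commutator (\<iota> i x) (\<iota> j y) = 0"
    and t: "bilin F \<Longrightarrow> (\<Sum>a\<in>J. F (bracket t (\<Theta> (u a))) (u' a) + F (u' a) (bracket (\<Theta> (u a)) t)
              - F (u' a) (bracket (u a) t)) = (0 :: 'r)"
begin

text \<open>\<open>Q\<close> places 2 rp, and \<open>W\<close> the Casimir tensor varpi, at two
  sites. \<open>M\<close> and \<open>C\<close> are the products of the same tensors inside one
  site.\<close>

definition Q :: "nat \<Rightarrow> nat \<Rightarrow> 'r" where "Q s i = (\<Sum>a\<in>J. \<theta> s (u a) * \<iota> i (u' a))"
definition W :: "nat \<Rightarrow> nat \<Rightarrow> 'r" where "W i j = (\<Sum>a\<in>J. \<iota> i (u' a) * \<iota> j (u a))"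
definition M :: "nat \<Rightarrow> 'r" where "M i = (\<Sum>a\<in>J. \<iota> i (\<Theta> (u a)) * \<iota> i (u' a))"
definition C :: "nat \<Rightarrow> 'r" where "C i = (\<Sum>a\<in>J. \<iota> i (u' a) * \<iota> i (u a))"

lemma \<iota>_\<theta>_commute: "s \<in> S \<Longrightarrow> i \<in> {1..N} \<Longrightarrow> s \<noteq> i \<Longrightarrow> commutator (\<iota> i y) (\<theta> s x) = 0"
  using \<theta>_\<iota>_commute[of s i x y] by (simp add: commutator_eq_zero)

lemmas derivation = commutator_sum_left commutator_sum_right commutator_mult_right commutator_mult_left

lemma site_swap:
  "s \<in> S \<Longrightarrow> i \<in> {1..N} \<Longrightarrow> s \<noteq> i \<Longrightarrow> \<iota> i y * \<theta> s x = \<theta> s x * \<iota> i y"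
  "i \<in> {1..N} \<Longrightarrow> j \<in> {1..N} \<Longrightarrow> i \<noteq> j \<Longrightarrow> \<iota> i x * \<iota> j y = \<iota> j y * \<iota> i x"
  using \<theta>_\<iota>_commute[of s i x y] \<iota>_commute[of i j x y] by (simp_all add: commutator_eq_zero)

text \<open>Together with the swap rules this sorts the factors of a product by site, so that
  simplification can compare products.\<close>

lemma left_swap: "x * y = y * x \<Longrightarrow> x * (y * z) = y * (x * z)" for x y z :: 'r
  by (metis mult.assoc)

text \<open>This and the next three forms are the \<open>F\<close> of Casimir invariance: two
  variable legs, in either order, and a fixed third factor beside or between them.\<close>

lemma bilin_site_right: "lin_map f \<Longrightarrow> lin_map g \<Longrightarrow> bilin (\<lambda>x y. f x * (g y * d) :: 'r)"
  by (auto intro!: bilinI lin_mapI simp: lin_map_simps cscale_mult_left cscale_mult_right distrib_left distrib_right)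

lemma bilin_site_mid: "lin_map f \<Longrightarrow> lin_map g \<Longrightarrow> bilin (\<lambda>x y. f x * (c * g y) :: 'r)"
  by (auto intro!: bilinI lin_mapI simp: lin_map_simps cscale_mult_left cscale_mult_right distrib_left distrib_right)

lemma bilin_site_left: "lin_map f \<Longrightarrow> lin_map g \<Longrightarrow> bilin (\<lambda>x y. c * (f x * g y) :: 'r)"
  by (auto intro!: bilinI lin_mapI simp: lin_map_simps cscale_mult_left cscale_mult_right distrib_left distrib_right)

lemma bilin_site_rev: "lin_map f \<Longrightarrow> lin_map g \<Longrightarrow> bilin (\<lambda>x y. g y * (f x * d) :: 'r)"
  by (auto intro!: bilinI lin_mapI simp: lin_map_simps cscale_mult_left cscale_mult_right distrib_left distrib_right)

lemma lin_\<iota>\<Theta>: "i \<in> {1..N} \<Longrightarrow> lin_map (\<lambda>x. \<iota> i (\<Theta> x))"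
  using lin_map_comp[OF \<iota>_lin \<Theta>_lin] by (simp add: comp_def)

lemma bracket_flip_lin: "lin_map f \<Longrightarrow> f (bracket x y) = - f (bracket y (x :: 'g))"
  by (subst bracket_anti) (simp add: lin_map_simps)

text \<open>A mixed classical Yang-Baxter equation. Casimir invariance moves every bracket to site
  s, where u_a belongs to site i and u_b to site j. What remains is a single expression in u_a and
  u_b, which vanishes by antisymmetry of the bracket; the projection identity enters through
  \<open>\<theta>_bracket\<close>.\<close>

lemma three_site:
  assumes s: "s \<in> S" and i: "i \<in> {1..N}" and j: "j \<in> {1..N}" and ne: "s \<noteq> i" "s \<noteq> j" "i \<noteq> j"
  shows "commutator (Q s i) (Q s j) + commutator (Q s i) (Q i j) + commutator (Q j i - W i j) (Q s j) = 0"
proof -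
  note ne' = ne[symmetric]
  have ijS: "i \<in> S" "j \<in> S" using S i j by auto
  have zz: "commutator (\<theta> s x) (\<iota> i y) = 0" "commutator (\<iota> i y) (\<theta> s x) = 0" 
    "commutator (\<theta> s x) (\<iota> j y) = 0" "commutator (\<iota> j y) (\<theta> s x) = 0" 
    "commutator (\<iota> i x) (\<iota> j y) = 0" "commutator (\<iota> j x) (\<iota> i y) = 0" for x y
    using \<theta>_\<iota>_commute \<iota>_\<theta>_commute \<iota>_commute s i j ne ne' by auto
  have sw: "\<iota> i y * \<theta> s x = \<theta> s x * \<iota> i y" "\<iota> j y * \<theta> s x = \<theta> s x * \<iota> j y" "\<iota> j x * \<iota> i y = \<iota> i y * \<iota> j x" for x y
    using site_swap s i j ne ne' by metis+
  note sws = sw left_swap[OF sw(1)] left_swap[OF sw(2)] left_swap[OF sw(3)] mult.assoc sum_distrib_left sum_distrib_right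
  note lin = \<theta>_lin[OF s] \<iota>_lin[OF i] \<iota>_lin[OF j]
  let ?R = "\<lambda>G. \<Sum>b\<in>J. \<Sum>a\<in>J. \<theta> s (G (u a) (u b)) * (\<iota> i (u' a) * \<iota> j (u' b))"
  have 1: "commutator (Q s i) (Q s j) = ?R (\<lambda>x y. bracket (\<Theta> x) y + bracket x (\<Theta> y) - bracket x y)"
    unfolding Q_def by (simp add: derivation zz \<theta>_bracket[OF s] sws)
  have 2: "commutator (Q s i) (Q i j) = ?R (\<lambda>x y. bracket (\<Theta> y) x)"
  proof -
    have "commutator (Q s i) (Q i j) = (\<Sum>b\<in>J. \<Sum>a\<in>J. \<theta> s (u a) * (\<iota> i (bracket (u' a) (\<Theta> (u b))) * \<iota> j (u' b)))"
      unfolding Q_def by (simp add: derivation zz \<theta>_\<iota>[OF i] \<iota>_bracket[OF i] sws)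
    then show ?thesis
      by (simp add: casimir_invariant_flip[OF bilin_site_right[OF lin(1,2)]])
  qed
  have 3: "commutator (Q j i) (Q s j) = ?R (\<lambda>x y. bracket y (\<Theta> x))"
  proof -
    have "commutator (Q j i) (Q s j) = (\<Sum>b\<in>J. \<Sum>a\<in>J. \<theta> s (u b) * (\<iota> i (u' a) * \<iota> j (bracket (\<Theta> (u a)) (u' b))))"
      unfolding Q_def by (simp add: derivation zz \<theta>_\<iota>[OF j] \<iota>_bracket[OF j] sws)
    \<comment> \<open>Invariance will be applied to the pair u_b, u'_b, so the sum over b has to be
      the inner one.\<close>
    also have "\<dots> = (\<Sum>a\<in>J. \<Sum>b\<in>J. \<theta> s (u b) * (\<iota> i (u' a) * \<iota> j (bracket (\<Theta> (u a)) (u' b))))"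
      by (rule sum.swap)
    also have "\<dots> = (\<Sum>a\<in>J. \<Sum>b\<in>J. \<theta> s (bracket (u b) (\<Theta> (u a))) * (\<iota> i (u' a) * \<iota> j (u' b)))"
      by (simp add: casimir_invariant[OF bilin_site_mid[OF lin(1,3)]] bracket_flip_lin[OF lin(1), of "u _" "\<Theta> _"] sum_negf)
    finally show ?thesis by (subst (asm) sum.swap)
  qed
  have 4: "commutator (W i j) (Q s j) = ?R (\<lambda>x y. bracket y x)"
  proof -
    have "commutator (W i j) (Q s j) = (\<Sum>b\<in>J. \<Sum>a\<in>J. \<theta> s (u b) * (\<iota> i (u' a) * \<iota> j (bracket (u a) (u' b))))"
      unfolding Q_def W_def by (simp add: derivation zz \<iota>_bracket[OF j] sws)
    also have "\<dots> = (\<Sum>a\<in>J. \<Sum>b\<in>J. \<theta> s (u b) * (\<iota> i (u' a) * \<iota> j (bracket (u a) (u' b))))"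
      by (rule sum.swap)
    also have "\<dots> = (\<Sum>a\<in>J. - (\<Sum>b\<in>J. \<theta> s (bracket (u a) (u b)) * (\<iota> i (u' a) * \<iota> j (u' b))))"
      by (simp add: casimir_invariant[OF bilin_site_mid[OF lin(1,3)]])
    also have "\<dots> = (\<Sum>a\<in>J. \<Sum>b\<in>J. \<theta> s (bracket (u b) (u a)) * (\<iota> i (u' a) * \<iota> j (u' b)))"
      by (subst bracket_flip_lin[OF lin(1)]) (simp add: sum_negf)
    finally show ?thesis by (subst (asm) sum.swap)
  qed
  have "?R (\<lambda>x y. bracket (\<Theta> x) y + bracket x (\<Theta> y) - bracket x y) + ?R (\<lambda>x y. bracket (\<Theta> y) x)
     + (?R (\<lambda>x y. bracket y (\<Theta> x)) - ?R (\<lambda>x y. bracket y x)) =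
     ?R (\<lambda>x y. bracket (\<Theta> x) y + bracket x (\<Theta> y) - bracket x y + bracket (\<Theta> y) x + (bracket y (\<Theta> x) - bracket y x))"
    by (simp only: sum.distrib[symmetric] sum_subtractf[symmetric] distrib_right[symmetric]
       left_diff_distrib[symmetric] lin_map_add[OF lin(1)] lin_map_diff[OF lin(1)])
  also have "\<dots> = 0"
  proof -
    have "bracket (\<Theta> x) y + bracket x (\<Theta> y) - bracket x y + bracket (\<Theta> y) x + (bracket y (\<Theta> x) - bracket y x) = 0" for x y
      using bracket_anti[of "\<Theta> x" y] bracket_anti[of "\<Theta> y" x] bracket_anti[of x y] by simp
    then show ?thesis by (simp add: lin_map_zero[OF lin(1)])
  qed
  finally show ?thesis by (simp add: 1 2 3 4 commutator_diff_left)
qed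

text \<open>The commutators consist of cubic terms, with two factors at i (\<open>?I\<close>) or two
  at j (\<open>?J\<close>), and of quadratic terms in t. After Casimir invariance each kind vanishes
  on its own: the cubic ones by the projection identity at site i and at site j, the quadratic ones
  by the assumption on t.\<close>

lemma two_site:
  assumes i: "i \<in> {1..N}" and j: "j \<in> {1..N}" and ne: "i \<noteq> j"
  shows "commutator (M i - \<iota> i t) (Q i j) + commutator (Q j i - W i j) (M j - \<iota> j t)
    + commutator (Q j i - W i j) (Q i j) = 0"
proof -
  note ne' = ne[symmetric]
  have z: "commutator (\<iota> i x) (\<iota> j y) = 0" "commutator (\<iota> j x) (\<iota> i y) = 0" for x y
    using \<iota>_commute i j ne ne' by auto
  have sw: "\<iota> j x * \<iota> i y = \<iota> i y * \<iota> j x" for x y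
    using site_swap i j ne ne' by metis
  note sws = sw left_swap[OF sw] mult.assoc sum_distrib_left sum_distrib_right sum.distrib distrib_left distrib_right
  note lin = \<iota>_lin[OF i] \<iota>_lin[OF j] lin_\<iota>\<Theta>[OF i] lin_\<iota>\<Theta>[OF j]
  note br = \<theta>_\<iota>[OF i] \<theta>_\<iota>[OF j] \<iota>_bracket[OF i, symmetric] \<iota>_bracket[OF j, symmetric]
  let ?I = "\<lambda>G. \<Sum>b\<in>J. \<Sum>a\<in>J. \<iota> i (G (u a) (u b)) * (\<iota> i (u' a) * \<iota> j (u' b))"
  let ?J = "\<lambda>G. \<Sum>b\<in>J. \<Sum>a\<in>J. \<iota> i (u' a) * (\<iota> j (G (u a) (u b)) * \<iota> j (u' b))"
  have a: "commutator (M i) (Q i j) = ?I (\<lambda>x y. \<Theta> (bracket (\<Theta> y) x)) + ?I (\<lambda>x y. bracket (\<Theta> x) (\<Theta> y))"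
  proof -
    have "commutator (M i) (Q i j) = 
       (\<Sum>b\<in>J. \<Sum>a\<in>J. \<iota> i (\<Theta> (u a)) * (\<iota> i (bracket (u' a) (\<Theta> (u b))) * \<iota> j (u' b)))
       + ?I (\<lambda>x y. bracket (\<Theta> x) (\<Theta> y))"
      unfolding M_def Q_def by (simp add: derivation z br sws)
    then show ?thesis by (simp add: casimir_invariant_flip[OF bilin_site_right[OF lin(3,1)]])
  qed
  have b: "commutator (Q j i) (Q i j) = ?J (\<lambda>x y. \<Theta> (bracket (\<Theta> y) x)) - ?I (\<lambda>x y. \<Theta> (bracket (\<Theta> x) y))"
  proof -
    have "commutator (Q j i) (Q i j) = 
       (\<Sum>b\<in>J. \<Sum>a\<in>J. \<iota> i (bracket (u' a) (\<Theta> (u b))) * (\<iota> j (\<Theta> (u a)) * \<iota> j (u' b)))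
       + (\<Sum>b\<in>J. \<Sum>a\<in>J. \<iota> i (\<Theta> (u b)) * (\<iota> i (u' a) * \<iota> j (bracket (\<Theta> (u a)) (u' b))))"
      unfolding Q_def by (simp add: derivation z br sws)
    also have "(\<Sum>b\<in>J. \<Sum>a\<in>J. \<iota> i (\<Theta> (u b)) * (\<iota> i (u' a) * \<iota> j (bracket (\<Theta> (u a)) (u' b))))
      = (\<Sum>a\<in>J. \<Sum>b\<in>J. \<iota> i (\<Theta> (u b)) * (\<iota> i (u' a) * \<iota> j (bracket (\<Theta> (u a)) (u' b))))"
      by (rule sum.swap)
    also have "\<dots> = - (\<Sum>a\<in>J. \<Sum>b\<in>J. \<iota> i (\<Theta> (bracket (\<Theta> (u a)) (u b))) * (\<iota> i (u' a) * \<iota> j (u' b)))"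
      by (simp add: casimir_invariant[OF bilin_site_mid[OF lin(3,2)]] sum_negf)
    also have "\<dots> = - ?I (\<lambda>x y. \<Theta> (bracket (\<Theta> x) y))" by (subst sum.swap) simp
    finally show ?thesis by (simp add: casimir_invariant_flip[OF bilin_site_rev[OF lin(4,1)]])
  qed
  have c: "commutator (Q j i) (M j) = ?J (\<lambda>x y. bracket (\<Theta> x) (\<Theta> y)) - ?J (\<lambda>x y. \<Theta> (bracket (\<Theta> x) y))"
  proof -
    have "commutator (Q j i) (M j) = 
       (\<Sum>b\<in>J. \<Sum>a\<in>J. \<iota> i (u' a) * (\<iota> j (\<Theta> (u b)) * \<iota> j (bracket (\<Theta> (u a)) (u' b))))
       + ?J (\<lambda>x y. bracket (\<Theta> x) (\<Theta> y))"
      unfolding Q_def M_def by (simp add: derivation z br sws)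
    also have "(\<Sum>b\<in>J. \<Sum>a\<in>J. \<iota> i (u' a) * (\<iota> j (\<Theta> (u b)) * \<iota> j (bracket (\<Theta> (u a)) (u' b))))
      = (\<Sum>a\<in>J. \<Sum>b\<in>J. \<iota> i (u' a) * (\<iota> j (\<Theta> (u b)) * \<iota> j (bracket (\<Theta> (u a)) (u' b))))"
      by (rule sum.swap)
    also have "\<dots> = - (\<Sum>a\<in>J. \<Sum>b\<in>J. \<iota> i (u' a) * (\<iota> j (\<Theta> (bracket (\<Theta> (u a)) (u b))) * \<iota> j (u' b)))"
      by (simp add: casimir_invariant[OF bilin_site_left[OF lin(4,2)]] sum_negf)
    also have "\<dots> = - ?J (\<lambda>x y. \<Theta> (bracket (\<Theta> x) y))" by (subst sum.swap) simp
    finally show ?thesis by simp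
  qed
  have d: "commutator (W i j) (M j) = ?J (\<lambda>x y. bracket x (\<Theta> y)) - ?J (\<lambda>x y. \<Theta> (bracket x y))"
  proof -
    have "commutator (W i j) (M j) = 
       (\<Sum>b\<in>J. \<Sum>a\<in>J. \<iota> i (u' a) * (\<iota> j (\<Theta> (u b)) * \<iota> j (bracket (u a) (u' b))))
       + ?J (\<lambda>x y. bracket x (\<Theta> y))"
      unfolding W_def M_def by (simp add: derivation z br sws)
    also have "(\<Sum>b\<in>J. \<Sum>a\<in>J. \<iota> i (u' a) * (\<iota> j (\<Theta> (u b)) * \<iota> j (bracket (u a) (u' b))))
      = (\<Sum>a\<in>J. \<Sum>b\<in>J. \<iota> i (u' a) * (\<iota> j (\<Theta> (u b)) * \<iota> j (bracket (u a) (u' b))))"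
      by (rule sum.swap)
    also have "\<dots> = - (\<Sum>a\<in>J. \<Sum>b\<in>J. \<iota> i (u' a) * (\<iota> j (\<Theta> (bracket (u a) (u b))) * \<iota> j (u' b)))"
      by (simp add: casimir_invariant[OF bilin_site_left[OF lin(4,2)]] sum_negf)
    also have "\<dots> = - ?J (\<lambda>x y. \<Theta> (bracket x y))" by (subst sum.swap) simp
    finally show ?thesis by simp
  qed
  \<comment> \<open>The \<open>?J\<close> terms with [x, \<Theta> y], here and in \<open>d\<close>,
    have opposite signs and cancel in the final sum.\<close>
  have e: "commutator (W i j) (Q i j) = - ?I (\<lambda>x y. \<Theta> (bracket x y)) - ?J (\<lambda>x y. bracket x (\<Theta> y))"
  proof -
    have "commutator (W i j) (Q i j) = 
       (\<Sum>b\<in>J. \<Sum>a\<in>J. \<iota> i (\<Theta> (u b)) * (\<iota> i (u' a) * \<iota> j (bracket (u a) (u' b))))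
       + (\<Sum>b\<in>J. \<Sum>a\<in>J. \<iota> i (bracket (u' a) (\<Theta> (u b))) * (\<iota> j (u a) * \<iota> j (u' b)))"
      unfolding W_def Q_def
      by (simp only: commutator_sum_left commutator_sum_right)
        (simp add: commutator_mult_right commutator_mult_left z br sws)
    also have "(\<Sum>b\<in>J. \<Sum>a\<in>J. \<iota> i (\<Theta> (u b)) * (\<iota> i (u' a) * \<iota> j (bracket (u a) (u' b))))
      = (\<Sum>a\<in>J. \<Sum>b\<in>J. \<iota> i (\<Theta> (u b)) * (\<iota> i (u' a) * \<iota> j (bracket (u a) (u' b))))"
      by (rule sum.swap)
    also have "\<dots> = - (\<Sum>a\<in>J. \<Sum>b\<in>J. \<iota> i (\<Theta> (bracket (u a) (u b))) * (\<iota> i (u' a) * \<iota> j (u' b)))"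
      by (simp add: casimir_invariant[OF bilin_site_mid[OF lin(3,2)]] sum_negf)
    also have "\<dots> = - ?I (\<lambda>x y. \<Theta> (bracket x y))" by (subst sum.swap) simp
    also have "(\<Sum>b\<in>J. \<Sum>a\<in>J. \<iota> i (bracket (u' a) (\<Theta> (u b))) * (\<iota> j (u a) * \<iota> j (u' b))) =
       - ?J (\<lambda>x y. bracket x (\<Theta> y))"
      by (simp add: casimir_invariant_flip[OF bilin_site_rev[OF lin(2,1)]] bracket_flip_lin[OF lin(2), of "\<Theta> _"] sum_negf)
    finally show ?thesis by simp
  qed
  \<comment> \<open>The projection identity with one bracket reversed by antisymmetry; it serves
    \<open>?I\<close> and \<open>?J\<close> alike.\<close>
  have zero: "\<Theta> (bracket (\<Theta> y) x) + bracket (\<Theta> x) (\<Theta> y) - \<Theta> (bracket (\<Theta> x) y) + \<Theta> (bracket x y) = 0" for x y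
    using bracket_flip_lin[OF \<Theta>_lin, of "\<Theta> y" x]
    by (simp add: \<Theta>_bracket lin_map_simps[OF \<Theta>_lin])
  have i0: "?I (\<lambda>x y. \<Theta> (bracket (\<Theta> y) x)) + ?I (\<lambda>x y. bracket (\<Theta> x) (\<Theta> y))
      - ?I (\<lambda>x y. \<Theta> (bracket (\<Theta> x) y)) + ?I (\<lambda>x y. \<Theta> (bracket x y)) = 0"
    by (simp only: sum.distrib[symmetric] sum_subtractf[symmetric] distrib_right[symmetric] distrib_left[symmetric]
       left_diff_distrib[symmetric] right_diff_distrib[symmetric] lin_map_add[OF lin(1), symmetric] lin_map_diff[OF lin(1), symmetric] zero)
      (simp add: lin_map_zero[OF lin(1)])
  have j0: "?J (\<lambda>x y. \<Theta> (bracket (\<Theta> y) x)) + ?J (\<lambda>x y. bracket (\<Theta> x) (\<Theta> y))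
      - ?J (\<lambda>x y. \<Theta> (bracket (\<Theta> x) y)) + ?J (\<lambda>x y. \<Theta> (bracket x y)) = 0"
    by (simp only: sum.distrib[symmetric] sum_subtractf[symmetric] distrib_right[symmetric] distrib_left[symmetric]
       left_diff_distrib[symmetric] right_diff_distrib[symmetric] lin_map_add[OF lin(2), symmetric] lin_map_diff[OF lin(2), symmetric] zero)
      (simp add: lin_map_zero[OF lin(2)])
  have t0: "commutator (\<iota> i t) (Q i j) + commutator (Q j i) (\<iota> j t) - commutator (W i j) (\<iota> j t) = 0"
    using t[OF bilin_mult[OF lin(1,2)]]
    unfolding Q_def W_def
    by (simp add: derivation z br sws sum_subtractf)
  show ?thesis
  proof -
    have t3: "commutator (W i j) (\<iota> j t) = commutator (\<iota> i t) (Q i j) + commutator (Q j i) (\<iota> j t)"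
      using t0 by simp
    have i4: "?I (\<lambda>x y. \<Theta> (bracket x y)) = - (?I (\<lambda>x y. \<Theta> (bracket (\<Theta> y) x)) + ?I (\<lambda>x y. bracket (\<Theta> x) (\<Theta> y))
      - ?I (\<lambda>x y. \<Theta> (bracket (\<Theta> x) y)))"
      unfolding eq_neg_iff_add_eq_0 by (subst add.commute) (rule i0)
    have j4: "?J (\<lambda>x y. \<Theta> (bracket x y)) = - (?J (\<lambda>x y. \<Theta> (bracket (\<Theta> y) x)) + ?J (\<lambda>x y. bracket (\<Theta> x) (\<Theta> y))
      - ?J (\<lambda>x y. \<Theta> (bracket (\<Theta> x) y)))"
      unfolding eq_neg_iff_add_eq_0 by (subst add.commute) (rule j0)
    show ?thesis
      by (simp only: a b c d e commutator_diff_left commutator_diff_right i4 j4 t3) simp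
  qed
qed

text \<open>Casimir invariance for the diagonal action on the sites i and j. It is the source of the
  infinitesimal braid relations \<open>W_Q_commute\<close> and \<open>W_W_commute\<close>.\<close>

lemma W_invariant:
  assumes i: "i \<in> {1..N}" and j: "j \<in> {1..N}" and ne: "i \<noteq> j"
  shows "commutator (W i j) (\<iota> i x + \<iota> j x) = 0"
proof -
  have z: "commutator (\<iota> i x) (\<iota> j y) = 0" "commutator (\<iota> j x) (\<iota> i y) = 0" for x y
    using \<iota>_commute i j ne by auto
  have "commutator (W i j) (\<iota> i x + \<iota> j x) = (\<Sum>a\<in>J. \<iota> i (u' a) * \<iota> j (bracket (u a) x)) + (\<Sum>a\<in>J. \<iota> i (bracket (u' a) x) * \<iota> j (u a))"
    by (simp add: W_def commutator_add_right derivation z \<iota>_bracket[OF i] \<iota>_bracket[OF j])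
  also have "(\<Sum>a\<in>J. \<iota> i (bracket (u' a) x) * \<iota> j (u a)) = (\<Sum>a\<in>J. \<iota> i (u' a) * \<iota> j (bracket x (u a)))"
    by (rule casimir_invariant_flip[where F = "\<lambda>p q. \<iota> i q * \<iota> j p"])
      (auto intro!: bilinI lin_mapI simp: lin_map_simps[OF \<iota>_lin[OF i]] lin_map_simps[OF \<iota>_lin[OF j]]
         cscale_mult_left cscale_mult_right distrib_left distrib_right)
  finally show ?thesis
    by (subst (asm) bracket_flip_lin[OF \<iota>_lin[OF j]]) (simp add: sum_negf)
qed

lemma C_central_\<iota>:
  assumes i: "i \<in> {1..N}" and j: "j \<in> {1..N}"
  shows "commutator (C i) (\<iota> j x) = 0"
proof (cases "i = j")
  case True
  have "commutator (C i) (\<iota> i x) = (\<Sum>a\<in>J. \<iota> i (u' a) * \<iota> i (bracket (u a) x)) + (\<Sum>a\<in>J. \<iota> i (bracket (u' a) x) * \<iota> i (u a))"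
    by (simp add: C_def derivation \<iota>_bracket[OF i] sum.distrib)
  also have "(\<Sum>a\<in>J. \<iota> i (bracket (u' a) x) * \<iota> i (u a)) = (\<Sum>a\<in>J. \<iota> i (u' a) * \<iota> i (bracket x (u a)))"
    by (rule casimir_invariant_flip[where F = "\<lambda>p q. \<iota> i q * \<iota> i p"])
      (auto intro!: bilinI lin_mapI simp: lin_map_simps[OF \<iota>_lin[OF i]]
         cscale_mult_left cscale_mult_right distrib_left distrib_right)
  finally show ?thesis unfolding True
    by (subst (asm) bracket_flip_lin[OF \<iota>_lin[OF j], of "u _"]) (simp add: sum_negf True)
next
  case False
  then show ?thesis by (simp add: C_def derivation \<iota>_commute[OF i j])
qed

lemma C_central_\<theta>: "i \<in> {1..N} \<Longrightarrow> s \<in> S \<Longrightarrow> commutator (C i) (\<theta> s x) = 0"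
  by (cases "s = i") (simp_all add: \<theta>_\<iota> C_central_\<iota>, simp add: C_def derivation \<iota>_\<theta>_commute)

text \<open>The two-site part of twice the Hamiltonian at i. For bulk sites i < j it gives P i j = Q
  i j and P j i = Q j i - W i j, exactly the pair occurring in \<open>two_site\<close> and
  \<open>three_site\<close>.\<close>

definition P :: "nat \<Rightarrow> nat \<Rightarrow> 'r" where
  "P s i = (if s \<in> {i + 1..N} then Q s i - W i s else Q s i)"

text \<open>Twice the Hamiltonian plus half of \<open>C i\<close>, so that only a central term
  separates the two.\<close>

definition B :: "nat \<Rightarrow> 'r" where
  "B i = M i - \<iota> i t + (\<Sum>s\<in>S - {i}. P s i)"

lemma C_central_B:
  assumes i: "i \<in> {1..N}" and j: "j \<in> {1..N}"
  shows "commutator (C i) (B j) = 0"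
proof -
  have "commutator (C i) (P s j) = 0" if "s \<in> S" for s
    using C_central_\<iota>[OF i] C_central_\<theta>[OF i] that j
    by (auto simp: P_def Q_def W_def commutator_diff_right derivation)
  then show ?thesis
    using C_central_\<iota>[OF i j]
    by (simp add: B_def M_def commutator_add_right commutator_diff_right derivation)
qed

lemma C_central_C: "i \<in> {1..N} \<Longrightarrow> j \<in> {1..N} \<Longrightarrow> commutator (C i) (C j) = 0"
  using C_central_\<iota>[of i j] by (simp add: C_def[of j] derivation)

lemma W_Q_commute:
  assumes i: "i \<in> {1..N}" and j: "j \<in> {1..N}" and l: "l \<in> {1..N}" and ne: "i \<noteq> j" "i \<noteq> l" "j \<noteq> l"
  shows "commutator (W i j) (Q i l + Q j l) = 0"
proof -
  have "Q i l + Q j l = (\<Sum>a\<in>J. (\<iota> i (\<Theta> (u a)) + \<iota> j (\<Theta> (u a))) * \<iota> l (u' a))"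
    by (simp add: Q_def \<theta>_\<iota>[OF i] \<theta>_\<iota>[OF j] distrib_right sum.distrib)
  moreover have "commutator (W i j) (\<iota> l x) = 0" for x
    using \<iota>_commute[OF i l] \<iota>_commute[OF j l] ne by (simp add: W_def derivation)
  ultimately show ?thesis
    by (simp add: commutator_sum_right commutator_mult_right W_invariant[OF i j ne(1)])
qed

lemma W_W_commute:
  assumes i: "i \<in> {1..N}" and j: "j \<in> {1..N}" and l: "l \<in> {1..N}" and ne: "i \<noteq> j" "i \<noteq> l" "j \<noteq> l"
  shows "commutator (W i j) (W l i + W l j) = 0"
proof -
  have "W l i + W l j = (\<Sum>a\<in>J. \<iota> l (u' a) * (\<iota> i (u a) + \<iota> j (u a)))"
    by (simp add: W_def distrib_left sum.distrib)
  moreover have "commutator (W i j) (\<iota> l x) = 0" for x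
    using \<iota>_commute[OF i l] \<iota>_commute[OF j l] ne by (simp add: W_def derivation)
  ultimately show ?thesis
    by (simp add: commutator_sum_right commutator_mult_right W_invariant[OF i j ne(1)])
qed

text \<open>Relative to \<open>three_site\<close> the third site brings corrections by W i s and W j
  s, according to whether it lies above i and above j. They cancel by the braid relations. Elements
  of \<open>S\<close> outside {1..N} carry no correction and belong to the first case.\<close>

lemma three_site_P:
  assumes i: "i \<in> {1..N}" and j: "j \<in> {1..N}" and "i < j" and s: "s \<in> S - {i} - {j}"
  shows "commutator (P s i) (P s j) + commutator (P s i) (P i j) + commutator (P j i) (P s j) = 0"
proof -
  have ne: "s \<noteq> i" "s \<noteq> j" "i \<noteq> j" and sS: "s \<in> S" using assms by auto
  have Pij: "P i j = Q i j" "P j i = Q j i - W i j" using assms by (auto simp: P_def)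
  note E = three_site[OF sS i j ne]
  consider "s \<notin> {i + 1..N}" | "s \<in> {i + 1..N}" "s < j" | "s \<in> {j + 1..N}" using ne by force
  then show ?thesis
  proof cases
    case 1
    then have "P s i = Q s i" "P s j = Q s j" using assms by (auto simp: P_def)
    then show ?thesis using E Pij by simp
  next
    case 2
    then have P: "P s i = Q s i - W i s" "P s j = Q s j" by (auto simp: P_def)
    have sN: "s \<in> {1..N}" using 2 by auto
    have "commutator (W i s) (Q i j + Q s j) = 0" using W_Q_commute[OF i sN j] ne by auto
    then show ?thesis using E by (simp add: P Pij commutator_diff_left commutator_add_right algebra_simps)
  next
    case 3
    then have P: "P s i = Q s i - W i s" "P s j = Q s j - W j s" using assms by (auto simp: P_def)
    have sN: "s \<in> {1..N}" using 3 by auto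
    have 1: "commutator (W i s) (Q i j + Q s j) = 0" using W_Q_commute[OF i sN j] ne by auto
    have 2: "commutator (Q j i + Q s i) (W j s) = 0"
      using W_Q_commute[OF j sN i] ne commutator_flip[of "Q j i + Q s i" "W j s"] by auto
    have 3: "commutator (W i j + W i s) (W j s) = 0"
      using W_W_commute[OF j sN i] ne commutator_flip[of "W i j + W i s" "W j s"] by auto
    have e: "commutator (W i j) (Q s j) = commutator (Q s i) (Q s j) + commutator (Q s i) (Q i j) + commutator (Q j i) (Q s j)"
      using E by (simp add: commutator_diff_left algebra_simps)
    have "commutator (W i s) (Q i j) = - commutator (W i s) (Q s j)"
      "commutator (Q j i) (W j s) = - commutator (Q s i) (W j s)"
      "commutator (W i j) (W j s) = - commutator (W i s) (W j s)"
      using 1 2 3 unfolding eq_neg_iff_add_eq_0 by (simp_all only: commutator_add_left commutator_add_right)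
    then show ?thesis
      by (simp only: P Pij commutator_diff_left commutator_diff_right e) simp
  qed
qed

lemma P_\<iota>_commute:
  "s \<in> S \<Longrightarrow> i \<in> {1..N} \<Longrightarrow> j \<in> {1..N} \<Longrightarrow> s \<noteq> j \<Longrightarrow> i \<noteq> j \<Longrightarrow> commutator (P s i) (\<iota> j x) = 0"
  by (auto simp: P_def Q_def W_def commutator_diff_left derivation \<theta>_\<iota>_commute \<iota>_commute)

lemma P_\<theta>_commute:
  "s \<in> S \<Longrightarrow> i \<in> {1..N} \<Longrightarrow> s' \<in> S \<Longrightarrow> s \<noteq> s' \<Longrightarrow> i \<noteq> s' \<Longrightarrow> commutator (P s i) (\<theta> s' x) = 0"
  by (auto simp: P_def Q_def W_def commutator_diff_left derivation \<theta>_commute \<iota>_\<theta>_commute)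

lemma P_P_commute:
  assumes "s \<in> S" "s' \<in> S" "i \<in> {1..N}" "j \<in> {1..N}" "distinct [s, s', i, j]"
  shows "commutator (P s i) (P s' j) = 0"
  using assms P_\<iota>_commute[of s i j] P_\<theta>_commute[of s i s'] P_\<iota>_commute[of s i s']
  by (auto simp: P_def[of s'] Q_def[of s'] W_def[of j] commutator_diff_right commutator_sum_right commutator_mult_right)

text \<open>The coupling to the partner is split off from each sum. The one-site parts and the
  couplings of the pair give \<open>two_site\<close>, each further site gives one instance of
  \<open>three_site_P\<close>, and all other commutators are between commuting sites.\<close>

lemma B_commute_less:
  assumes i: "i \<in> {1..N}" and j: "j \<in> {1..N}" and ij: "i < j"
  shows "commutator (B i) (B j) = 0"
proof -
  define S' where "S' = S - {i} - {j}"
  have fin: "finite S'" using S by (simp add: S'_def)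
  have iS: "i \<in> S" and jS: "j \<in> S" using i j S by auto
  have Si: "(\<Sum>s\<in>S - {i}. P s i) = P j i + (\<Sum>s\<in>S'. P s i)"
    unfolding S'_def using S ij jS by (intro sum.remove) auto
  have "S' = S - {j} - {i}" by (auto simp: S'_def)
  then have Sj: "(\<Sum>s\<in>S - {j}. P s j) = P i j + (\<Sum>s\<in>S'. P s j)"
    using S ij iS by (simp, intro sum.remove) auto
  let ?X = "\<Sum>s\<in>S'. P s i" and ?Y = "\<Sum>s\<in>S'. P s j"
  let ?Mi = "M i - \<iota> i t" and ?Mj = "M j - \<iota> j t"
  have Pij: "P i j = Q i j" "P j i = Q j i - W i j" using ij j by (auto simp: P_def)
  have two: "commutator ?Mi (P i j) + commutator (P j i) ?Mj + commutator (P j i) (P i j) = 0"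
    using two_site[OF i j] ij by (simp add: Pij)
  have XM: "commutator ?X ?Mj = 0"
    using P_\<iota>_commute[OF _ i j] ij
    by (auto simp: S'_def commutator_sum_left commutator_diff_right M_def commutator_sum_right commutator_mult_right intro!: sum.neutral)
  have MY: "commutator ?Mi ?Y = 0"
  proof -
    have "commutator (\<iota> i x) (P s j) = 0" if "s \<in> S'" for s x
      using P_\<iota>_commute[OF _ j i, of s x] ij that commutator_flip[of "\<iota> i x" "P s j"] by (auto simp: S'_def)
    then show ?thesis
      by (auto simp: commutator_sum_right commutator_diff_left M_def commutator_sum_left commutator_mult_left intro!: sum.neutral)
  qed
  have MM: "commutator ?Mi ?Mj = 0"
    using \<iota>_commute[OF i j] ij
    by (simp add: M_def commutator_diff_left commutator_diff_right derivation)
  have "commutator ?X ?Y = (\<Sum>s\<in>S'. \<Sum>s'\<in>S'. commutator (P s i) (P s' j))"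
    by (simp add: commutator_sum_left commutator_sum_right) (subst sum.swap, simp)
  \<comment> \<open>For s different from s' the four sites are distinct and the commutator is zero;
    only the diagonal survives.\<close>
  also have "\<dots> = (\<Sum>s\<in>S'. \<Sum>s'\<in>S'. if s' = s then commutator (P s i) (P s j) else 0)"
    using i j ij by (intro sum.cong refl) (auto simp: S'_def intro!: P_P_commute)
  also have "\<dots> = (\<Sum>s\<in>S'. commutator (P s i) (P s j))" using fin by simp
  finally have XY: "commutator ?X ?Y = (\<Sum>s\<in>S'. commutator (P s i) (P s j))" .
  have "commutator ?X ?Y + commutator ?X (P i j) + commutator (P j i) ?Y = 
      (\<Sum>s\<in>S'. commutator (P s i) (P s j) + commutator (P s i) (P i j) + commutator (P j i) (P s j))"
    unfolding XY by (simp add: commutator_sum_left commutator_sum_right sum.distrib)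
  also have "\<dots> = 0"
    using three_site_P[OF i j ij] by (simp add: S'_def)
  finally have three: "commutator ?X ?Y + commutator ?X (P i j) + commutator (P j i) ?Y = 0" .
  have "commutator (B i) (B j) = commutator (?Mi + (P j i + ?X)) (?Mj + (P i j + ?Y))"
    by (simp add: B_def Si Sj)
  also have "\<dots> = commutator ?Mi ?Mj + commutator ?Mi ?Y + commutator ?X ?Mj
     + (commutator ?Mi (P i j) + commutator (P j i) ?Mj + commutator (P j i) (P i j))
     + (commutator ?X ?Y + commutator ?X (P i j) + commutator (P j i) ?Y)"
    by (simp only: commutator_add_left commutator_add_right) (simp only: ac_simps)
  also have "\<dots> = 0" by (simp only: MM MY XM two three) simp
  finally show ?thesis .
qed

lemma B_commute: "i \<in> {1..N} \<Longrightarrow> j \<in> {1..N} \<Longrightarrow> commutator (B i) (B j) = 0"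
  using B_commute_less[of i j] B_commute_less[of j i] commutator_flip[of "B i" "B j"]
  by (cases i j rule: linorder_cases) (simp_all add: commutator_def)

text \<open>The hypothesis on \<open>A\<close> is what the Hamiltonian becomes as an operator. It
  equals B i / 2 - C i / 4, and the C i commute with every B j and C j.\<close>

theorem boundary_hamiltonians_commute:
  assumes A: "\<And>i. i \<in> {1..N} \<Longrightarrow> A i = (1/2) *\<^sub>C (M i - \<iota> i t) - (1/4) *\<^sub>C C i
      + (1/2) *\<^sub>C (\<Sum>s\<in>S - {i}. Q s i) - (1/2) *\<^sub>C (\<Sum>s\<in>{i + 1..N}. W i s)"
    and i: "i \<in> {1..N}" and j: "j \<in> {1..N}"
  shows "A i * A j = A j * A i"
proof -
  have A': "A i = (1/2) *\<^sub>C B i - (1/4) *\<^sub>C C i" if i: "i \<in> {1..N}" for i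
  proof -
    have "(\<Sum>s\<in>S - {i}. P s i) = (\<Sum>s\<in>S - {i}. Q s i - (if s \<in> {i + 1..N} then W i s else 0))"
      by (intro sum.cong) (auto simp: P_def)
    also have "\<dots> = (\<Sum>s\<in>S - {i}. Q s i) - (\<Sum>s\<in>{i + 1..N}. W i s)"
    proof -
      have "(S - {i}) \<inter> {i + 1..N} = {i + 1..N}" using S by auto
      then show ?thesis using S by (simp add: sum_subtractf sum.If_cases Int_def Collect_conj_eq[symmetric])
    qed
    finally show ?thesis
      by (simp add: A[OF i] B_def cvec.scale_right_distrib cvec.scale_right_diff_distrib)
  qed
  have "commutator (B i) (C j) = 0" using C_central_B[OF j i] commutator_flip[of "B i" "C j"] by simp
  then have "commutator (A i) (A j) = 0"
    using C_central_B[OF i j] B_commute[OF i j] C_central_C[OF i j]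
    by (simp only: A'[OF i] A'[OF j] commutator_diff_left commutator_diff_right commutator_scale_left commutator_scale_right) simp
  then show ?thesis by (simp add: commutator_def)
qed

end

section \<open>Linear algebra\<close>

lemma scale_cancel: "n *\<^sub>C x = 0 \<Longrightarrow> n \<noteq> 0 \<Longrightarrow> x = 0" for x :: "'v::complex_vec"
  using cvec.scale_eq_0_iff by blast

lemma double_eq_zero: "x + x = 0 \<Longrightarrow> x = 0" for x :: "'v::complex_vec"
proof -
  assume "x + x = 0"
  then have "2 *\<^sub>C x = 0" using cscale_add_left[of 1 1 x] by (simp add: cscale_one)
  then show ?thesis by (rule scale_cancel) simp
qed

text \<open>Right linearity is not yet available, but the Jacobi identity for x, x, x reads 3 [x, 0]
  = 0.\<close>

lemma bracket_zero_right: "bracket x 0 = (0 :: 'g::complex_lie_algebra)"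
proof -
  have "bracket x 0 + bracket x 0 + bracket x 0 = 0" using jacobi[of x x x] by (simp add: bracket_self)
  then have "3 *\<^sub>C bracket x 0 = 0"
    using cscale_add_left[of 1 1 "bracket x 0"] cscale_add_left[of 2 1 "bracket x 0"] by (simp add: cscale_one)
  then show ?thesis by (rule scale_cancel) simp
qed

lemma bracket_neg_left: "bracket (- x) y = - bracket x (y :: 'g::complex_lie_algebra)"
  using bracket_scale_left[of "-1" x y] by simp

section \<open>Simplicity forces a bilinear bracket\<close>

context
  fixes type :: "'g::complex_lie_algebra itself"
  assumes simple: "simple_lie_algebra TYPE('g)"
begin

text \<open>The class \<open>complex_lie_algebra\<close> requires linearity of the bracket in the first argument only.
  Simplicity forces linearity in the second one: by the Jacobi identity the additivity defect \<open>F\<close> of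
  \<open>[y, [z, x]]\<close> in \<open>x\<close> becomes symmetric in one and antisymmetric in another pair of
  arguments, so triple brackets are trilinear; a defect of \<open>[x, a]\<close> is then killed by two brackets
  and would span an ideal.\<close>

lemma null_vector:
  assumes "\<And>y c. bracket y (c *\<^sub>C v) = (0 :: 'g)" shows "v = 0"
proof -
  have "lie_ideal (cvec.span {v})"
    using assms by (auto simp: lie_ideal_def cvec.span_singleton cvec.subspace_span[of "{v}", unfolded cvec.span_singleton]
      intro: range_eqI[of 0 _ 0])
  then consider "cvec.span {v} = {0}" | "cvec.span {v} = UNIV"
    using simple unfolding simple_lie_algebra_def by blast
  then show ?thesis
  proof cases
    case 1
    then show ?thesis using cvec.span_base[of v "{v}"] by auto
  next
    case 2
    have "bracket x y = 0" for x y :: 'g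
    proof -
      obtain c where "y = c *\<^sub>C v" using 2 by (auto simp: cvec.span_singleton)
      then show ?thesis using assms by simp
    qed
    then show ?thesis using simple unfolding simple_lie_algebra_def by blast
  qed
qed

private definition F :: "'g \<Rightarrow> 'g \<Rightarrow> 'g \<Rightarrow> 'g \<Rightarrow> 'g" where
  "F x x' y z = bracket y (bracket z (x + x')) - bracket y (bracket z x) - bracket y (bracket z x')"

text \<open>The Jacobi identity splits [y, [z, x]] into -[x, [y, z]], which is additive in x, and
  -[z, [x, y]]. So the defect is also, up to sign, the additivity defect of \<open>bracket z\<close>
  at [x, y] and [x', y].\<close>

private lemma F_flip: "F x x' y z = - (bracket z (bracket x y + bracket x' y)
   - bracket z (bracket x y) - bracket z (bracket x' y))"
proof -
  have j: "bracket y (bracket z w) = - bracket w (bracket y z) - bracket z (bracket w y)" for w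
    using jacobi[of y z w] by (simp add: eq_diff_eq eq_neg_iff_add_eq_0 add.assoc)
  show ?thesis unfolding F_def j by (simp add: bracket_add_left)
qed

text \<open>Like every additivity defect, F is symmetric in its first two arguments and satisfies a
  cocycle rule. It vanishes when the third argument equals the first or the second, which makes it
  antisymmetric in the second and third. Transpositions are conjugate, so acting by 1 and by -1 at
  once means F = -F.\<close>

private lemma F_zero: "F x x' y z = 0"
proof -
  have 1: "F a b a z = 0" "F a b b z = 0" for a b by (simp_all add: F_flip bracket_self bracket_zero_right)
  have add: "F a b (c + d) z = F a b c z + F a b d z" for a b c d
    by (simp add: F_def bracket_add_left)
  have cocycle: "F a b y z + F (a + b) c y z = F b c y z + F a (b + c) y z" for a b c y
    by (simp add: F_def algebra_simps)
  \<comment> \<open>In the cocycle rule with y = c two of the four terms vanish.\<close>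
  have shift: "F a b c z = F a (b + c) c z" for a b c
    using cocycle[of a b c c] 1 by simp
  have anti: "F a b c z = - F a c b z" for a b c
  proof -
    have "F a (b + c) b z + F a (b + c) c z = 0" using 1(2)[of a "b + c"] by (simp add: add)
    then show ?thesis using shift[of a b c] shift[of a c b] by (simp add: add.commute eq_neg_iff_add_eq_0)
  qed
  have sym: "F a b c z = F b a c z" for a b c by (simp add: F_def add.commute)
  have "F x x' y z = - F x x' y z"
    using anti[of x x' y] sym[of x y x'] anti[of y x x'] sym[of y x' x] anti[of x' y x] sym[of x' x y] by simp
  then show ?thesis using double_eq_zero[of "F x x' y z"] by (simp add: eq_neg_iff_add_eq_0)
qed

private lemma triple_add3: "bracket y (bracket z (x + x')) = bracket y (bracket z x) + bracket y (bracket z (x' :: 'g))"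
  using F_zero[of x x' y z] by (simp add: F_def algebra_simps)

private lemma triple_add2: "bracket z (bracket (x + x') y) = bracket z (bracket x y) + bracket z (bracket x' (y :: 'g))"
  using F_zero[of x x' y z] by (simp add: F_flip algebra_simps bracket_add_left)

private lemma triple_anti: "bracket x (bracket y z) = - bracket x (bracket z (y :: 'g))"
  using triple_add2[of x y z "y + z"] triple_add3[of x y y z] triple_add3[of x z y z] bracket_self[of "y + z"]
  by (simp add: bracket_self bracket_zero_right eq_neg_iff_add_eq_0)

private definition G :: "complex \<Rightarrow> 'g \<Rightarrow> 'g \<Rightarrow> 'g \<Rightarrow> 'g" where
  "G c x y z = bracket x (bracket (c *\<^sub>C y) z) - c *\<^sub>C bracket x (bracket y z)"

text \<open>The same argument for homogeneity: G is symmetric in its outer arguments by the Jacobi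
  identity, and alternating, hence antisymmetric, in the last two.\<close>

private lemma G_zero: "G c x y z = 0"
proof -
  have sym: "G c a b d = G c d b a" for a b d
  proof -
    have 1: "bracket a (bracket (c *\<^sub>C b) d) + c *\<^sub>C bracket b (bracket d a) + bracket d (bracket a (c *\<^sub>C b)) = 0"
      using jacobi[of a "c *\<^sub>C b" d] by (simp add: bracket_scale_left)
    have 2: "c *\<^sub>C bracket a (bracket b d) + c *\<^sub>C bracket b (bracket d a) + c *\<^sub>C bracket d (bracket a b) = 0"
      using jacobi[of a b d] by (simp only: cscale_add_right[symmetric]) simp
    have 3: "bracket d (bracket a (c *\<^sub>C b)) = - bracket d (bracket (c *\<^sub>C b) a)"
      "bracket d (bracket a b) = - bracket d (bracket b a)" by (rule triple_anti)+
    have P: "bracket a (bracket (c *\<^sub>C b) d) + c *\<^sub>C bracket b (bracket d a) = bracket d (bracket (c *\<^sub>C b) a)"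
      using 1 unfolding 3 by simp
    have P0: "c *\<^sub>C bracket a (bracket b d) + c *\<^sub>C bracket b (bracket d a) = c *\<^sub>C bracket d (bracket b a)"
      using 2 unfolding 3 by simp
    show ?thesis unfolding G_def P[symmetric] P0[symmetric] by simp
  qed
  have "G c a b b = 0" for a b by (simp add: G_def bracket_scale_left bracket_self bracket_zero_right)
  moreover have "G c a (b + b') d = G c a b d + G c a b' d" "G c a b (d + d') = G c a b d + G c a b d'" for a b b' d d'
    by (simp_all add: G_def triple_add2 triple_add3 cscale_add_right)
  ultimately have anti: "G c a b d = - G c a d b" for a b d
    by (metis (no_types, lifting) add.right_neutral add_0 eq_neg_iff_add_eq_0)
  have "G c x y z = - G c x y z"
    using sym[of x y z] anti[of z y x] sym[of z x y] anti[of y x z] sym[of y z x] anti[of x z y] by simp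
  then show ?thesis using double_eq_zero[of "G c x y z"] by (simp add: eq_neg_iff_add_eq_0)
qed

private lemma triple_scale2: "bracket x (bracket (c *\<^sub>C y) z) = c *\<^sub>C bracket x (bracket y (z :: 'g))"
  using G_zero[of c x y z] by (simp add: G_def)

private lemma triple_scale3: "bracket x (bracket z (c *\<^sub>C y)) = c *\<^sub>C bracket x (bracket z (y :: 'g))"
  using triple_scale2[of x c y z] triple_anti[of x z y] triple_anti[of x z "c *\<^sub>C y"] by simp

private lemma triple_lin3: "lin_map (\<lambda>z. bracket x (bracket y (z :: 'g)))"
  by (simp add: lin_mapI triple_add3 triple_scale3)

private lemma triple_bracket_flip: "bracket v (bracket w (bracket x a)) = - bracket v (bracket w (bracket a (x :: 'g)))"
proof -
  have "bracket v (bracket w (bracket x a)) = bracket v (bracket ((-1) *\<^sub>C w) (bracket a x))"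
    by (subst triple_anti[of w x a]) (simp add: bracket_neg_left)
  then show ?thesis by (simp only: triple_scale2) simp
qed

text \<open>Two applications of \<open>null_vector\<close>, whose scalars are absorbed by left
  homogeneity and by homogeneity of triple brackets.\<close>

private lemma null_defect:
  assumes "\<And>v w. bracket v (bracket w d) = (0 :: 'g)" shows "d = 0"
proof (rule null_vector)
  fix w c
  show "bracket w (c *\<^sub>C d) = 0"
  proof (rule null_vector)
    fix v c'
    have "bracket v (bracket (c' *\<^sub>C w) (c *\<^sub>C d)) = 0" by (simp add: triple_scale3 assms)
    then show "bracket v (c' *\<^sub>C bracket w (c *\<^sub>C d)) = 0" by (simp add: bracket_scale_left)
  qed
qed

lemma simple_right_linear: "right_linear_lie TYPE('g)"
proof
  fix x :: 'g
  show "lin_map (bracket x)"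
  proof (rule lin_mapI)
    fix a b :: 'g
    have "bracket x (a + b) - bracket x a - bracket x b = 0"
    proof (rule null_defect)
      fix v w :: 'g
      note L = lin_map_simps[OF triple_lin3[of v w]]
      \<comment> \<open>Inside two further brackets [x, a] may be reversed, which turns the defect
        into one of the first argument.\<close>
      have "bracket v (bracket w (bracket x (a + b) - bracket x a - bracket x b)) =
        - bracket v (bracket w (bracket (a + b) x - bracket a x - bracket b x))"
        by (simp only: L triple_bracket_flip[of v w x]) simp
      also have "\<dots> = 0" by (simp add: bracket_add_left bracket_zero_right)
      finally show "bracket v (bracket w (bracket x (a + b) - bracket x a - bracket x b)) = 0" .
    qed
    then show "bracket x (a + b) = bracket x a + bracket x b" by (simp add: algebra_simps)
  next
    fix c and a :: 'g
    have "bracket x (c *\<^sub>C a) - c *\<^sub>C bracket x a = 0"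
    proof (rule null_defect)
      fix v w :: 'g
      note L = lin_map_simps[OF triple_lin3[of v w]]
      have "bracket v (bracket w (bracket x (c *\<^sub>C a) - c *\<^sub>C bracket x a)) =
        - bracket v (bracket w (bracket (c *\<^sub>C a) x - c *\<^sub>C bracket a x))"
        by (simp only: L triple_bracket_flip[of v w x]) simp
      also have "\<dots> = 0" by (simp add: bracket_scale_left bracket_zero_right)
      finally show "bracket v (bracket w (bracket x (c *\<^sub>C a) - c *\<^sub>C bracket x a)) = 0" .
    qed
    then show "bracket x (c *\<^sub>C a) = c *\<^sub>C bracket x a" by simp
  qed
qed

end

section \<open>Traces of nilpotent operators\<close>

definition fin_dim :: "'v::complex_vec itself \<Rightarrow> bool" where
  "fin_dim _ \<longleftrightarrow> (\<exists>B :: 'v set. finite B \<and> cvec.span B = UNIV)"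

lemma fin_dim_independent: "fin_dim TYPE('v::complex_vec) \<Longrightarrow> cvec.independent (B :: 'v set) \<Longrightarrow> finite B"
  unfolding fin_dim_def using cvec.independent_span_bound by blast

text \<open>The trace on the span of an independent set, of which \<open>lin_trace\<close> is the
  case of a full basis. The relative form allows an induction that passes to invariant
  subspaces.\<close>

definition trace_on :: "'v::complex_vec set \<Rightarrow> ('v \<Rightarrow> 'v) \<Rightarrow> complex" where
  "trace_on B f = (\<Sum>b\<in>B. cvec.representation B (f b) b)"

lemma lin_trace_trace_on: "lin_trace f = trace_on (cvec.extend_basis {}) f"
  by (simp add: lin_trace_def trace_on_def)

lemma representation_sum_scale:
  assumes "cvec.independent B" "\<And>s. s \<in> S \<Longrightarrow> v s \<in> cvec.span B"
  shows "cvec.representation B (\<Sum>s\<in>S. c s *\<^sub>C v s) b = (\<Sum>s\<in>S. c s * cvec.representation B (v s) b)"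
  using assms by (subst cvec.representation_sum)
    (auto simp: cvec.span_scale cvec.representation_scale intro!: sum.cong)

lemma trace_on_cong_span:
  assumes B: "cvec.independent B" "finite B" and B': "cvec.independent B'" "finite B'"
    and S: "cvec.span B = cvec.span B'" and f: "lin_map f" "f ` cvec.span B \<subseteq> cvec.span B"
  shows "trace_on B f = trace_on B' f"
proof -
  let ?r = "cvec.representation B" and ?r' = "cvec.representation B'"
  have eq: "v = (\<Sum>b\<in>B. ?r v b *\<^sub>C b)" "v = (\<Sum>b\<in>B'. ?r' v b *\<^sub>C b)" if "v \<in> cvec.span B" for v
    using cvec.sum_representation_eq[OF B(1) that B(2)] cvec.sum_representation_eq[OF B'(1) _ B'(2)] that S by auto
  have fb: "f b \<in> cvec.span B" if "b \<in> cvec.span B" for b using f that by auto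
  have "trace_on B f = (\<Sum>b\<in>B. ?r (\<Sum>b'\<in>B'. ?r' b b' *\<^sub>C f b') b)"
    unfolding trace_on_def
  proof (intro sum.cong refl)
    fix b assume "b \<in> B"
    have "f b = f (\<Sum>b'\<in>B'. ?r' b b' *\<^sub>C b')" using eq(2)[of b] \<open>b \<in> B\<close> by (simp add: cvec.span_base)
    then show "?r (f b) b = ?r (\<Sum>b'\<in>B'. ?r' b b' *\<^sub>C f b') b" by (simp add: lin_map_simps[OF f(1)])
  qed
  also have "\<dots> = (\<Sum>b\<in>B. \<Sum>b'\<in>B'. ?r' b b' * ?r (f b') b)"
    using S by (intro sum.cong refl representation_sum_scale B fb) (simp add: cvec.span_base)
  also have "\<dots> = (\<Sum>b'\<in>B'. \<Sum>b\<in>B. ?r (f b') b * ?r' b b')"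
    by (subst sum.swap) (simp add: mult.commute)
  also have "\<dots> = (\<Sum>b'\<in>B'. ?r' (\<Sum>b\<in>B. ?r (f b') b *\<^sub>C b) b')"
    using S cvec.span_base[of _ B] by (intro sum.cong refl representation_sum_scale[symmetric] B') auto
  also have "\<dots> = trace_on B' f"
    unfolding trace_on_def using S cvec.span_base[of _ B']
    by (intro sum.cong refl) (auto simp: eq(1)[OF fb, symmetric])
  finally show ?thesis .
qed

text \<open>Induction on the nilpotency degree, passing to the image of f, on which one power fewer
  is needed. In a basis extending one of the image the vectors f b have no coordinates outside the
  image, so both traces agree.\<close>

lemma trace_on_nilpotent:
  assumes "cvec.independent B" "finite B" "lin_map f" "f ` cvec.span B \<subseteq> cvec.span B"
    and "\<And>v. v \<in> cvec.span B \<Longrightarrow> (f ^^ n) v = 0"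
  shows "trace_on B f = 0"
  using assms
proof (induction n arbitrary: B)
  case 0
  then have "b = 0" if "b \<in> B" for b using that cvec.span_base[of b B] by auto
  moreover have "0 \<notin> B" using 0(1) cvec.dependent_zero by blast
  ultimately have "B = {}" by auto
  then show ?case by (simp add: trace_on_def)
next
  case (Suc n)
  let ?W = "f ` cvec.span B"
  have "cvec.subspace ?W"
    using cvec.subspace_span[of B] unfolding cvec.subspace_def
    by (auto simp: lin_map_add[OF Suc(4), symmetric] lin_map_scale[OF Suc(4), symmetric]
      intro!: rev_image_eqI[of 0] simp: lin_map_zero[OF Suc(4)] cvec.span_zero)
  obtain C where C: "C \<subseteq> ?W" "cvec.independent C" "?W \<subseteq> cvec.span C"
    using cvec.maximal_independent_subset by blast
  have spC: "cvec.span C = ?W" using C cvec.span_minimal[OF C(1) \<open>cvec.subspace ?W\<close>] by auto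
  have "C \<subseteq> cvec.span B" using C(1) Suc(5) by auto
  from cvec.maximal_independent_subset_extend[OF this C(2)]
  obtain C' where C': "C \<subseteq> C'" "C' \<subseteq> cvec.span B" "cvec.independent C'" "cvec.span B \<subseteq> cvec.span C'" by auto
  have fin: "finite C'" using cvec.independent_span_bound[OF Suc(3) C'(3,2)] by simp
  have spC': "cvec.span C' = cvec.span B" using C' cvec.span_minimal[OF C'(2) cvec.subspace_span] by auto
  have "trace_on B f = trace_on C' f"
    using trace_on_cong_span[OF Suc(2,3) C'(3) fin spC'[symmetric] Suc(4,5)] .
  also have "\<dots> = (\<Sum>b\<in>C'. cvec.representation C (f b) b)"
    unfolding trace_on_def
  proof (intro sum.cong refl)
    fix b assume "b \<in> C'"
    then have "f b \<in> cvec.span C" using spC spC' cvec.span_base[of b C'] by auto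
    then show "cvec.representation C' (f b) b = cvec.representation C (f b) b"
      using cvec.representation_extend[OF C'(3) _ C'(1)] by metis
  qed
  also have "\<dots> = trace_on C f"
    unfolding trace_on_def using C'(1) fin cvec.representation_ne_zero[of C]
    by (intro sum.mono_neutral_right) auto
  also have "\<dots> = 0"
  proof (rule Suc.IH)
    show "f ` cvec.span C \<subseteq> cvec.span C" using spC Suc(5) by auto
    fix v assume "v \<in> cvec.span C"
    then obtain w where "w \<in> cvec.span B" "v = f w" using spC by auto
    then show "(f ^^ n) v = 0" using Suc(6)[of w] by (simp add: funpow_swap1)
  qed (use C C'(1) fin finite_subset Suc(4) in auto)
  finally show ?case .
qed

lemma lin_map_funpow: "lin_map (f :: 'v::complex_vec \<Rightarrow> 'v) \<Longrightarrow> lin_map (f ^^ n)"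
proof (induction n)
  case 0 show ?case using lin_map_id(1) by (simp only: funpow.simps)
next
  case (Suc n) then show ?case using lin_map_comp[of f "f ^^ n"] by (simp only: funpow.simps)
qed

lemma funpow_zero_mono:
  fixes f :: "'v::complex_vec \<Rightarrow> 'v"
  assumes "lin_map f" "(f ^^ m) v = 0" "m \<le> n" shows "(f ^^ n) v = 0"
proof -
  have "f ^^ n = (f ^^ (n - m)) \<circ> (f ^^ m)" using assms(3) by (simp add: funpow_add[symmetric])
  then show ?thesis using assms lin_map_zero[OF lin_map_funpow[OF assms(1)]] by simp
qed

context
  fixes type :: "'v::complex_vec itself"
  assumes fd: "fin_dim TYPE('v)"
begin

lemma extend_basis_finite: "finite (cvec.extend_basis {} :: 'v set)"
  using fin_dim_independent[OF fd] cvec.independent_extend_basis[OF cvec.independent_empty] .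

lemma lin_trace_nilpotent:
  assumes "lin_map (f :: 'v \<Rightarrow> 'v)" "\<And>v. \<exists>n. (f ^^ n) v = 0"
  shows "lin_trace f = 0"
proof -
  let ?B = "cvec.extend_basis {} :: 'v set"
  note B = cvec.independent_extend_basis[OF cvec.independent_empty] cvec.span_extend_basis[OF cvec.independent_empty]
  from assms(2) obtain k where k: "\<And>v. (f ^^ k v) v = 0" by metis
  define n where "n = Max (insert 0 (k ` ?B))"
  have nb: "(f ^^ n) b = 0" if "b \<in> ?B" for b
    using that extend_basis_finite by (intro funpow_zero_mono[OF assms(1) k[of b]]) (auto simp: n_def)
  have "(f ^^ n) v = 0" if "v \<in> cvec.span ?B" for v
    using that
  proof (induction rule: cvec.span_induct_alt)
    case base
    show ?case using lin_map_zero[OF lin_map_funpow[OF assms(1)]] .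
  next
    case (step c x y)
    then show ?case by (simp add: lin_map_simps[OF lin_map_funpow[OF assms(1)]] nb)
  qed
  then show ?thesis unfolding lin_trace_trace_on
    by (intro trace_on_nilpotent[where n = n] B assms extend_basis_finite) (auto simp: B)
qed

lemma lin_trace_add: "lin_trace (\<lambda>v :: 'v. f v + g v) = lin_trace f + lin_trace g"
  and lin_trace_scale: "lin_trace (\<lambda>v :: 'v. c *\<^sub>C f v) = c * lin_trace f"
  and lin_trace_diff: "lin_trace (\<lambda>v :: 'v. f v - g v) = lin_trace f - lin_trace g"
  by (simp_all add: lin_trace_def cvec.representation_add cvec.representation_scale cvec.representation_diff
      cvec.independent_extend_basis cvec.independent_empty sum.distrib sum_distrib_left sum_subtractf)

lemma lin_trace_commute:
  assumes "lin_map (f :: 'v \<Rightarrow> 'v)" "lin_map g"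
  shows "lin_trace (\<lambda>v. f (g v)) = lin_trace (\<lambda>v. g (f v))"
proof -
  let ?B = "cvec.extend_basis {} :: 'v set"
  let ?r = "cvec.representation ?B"
  note B = cvec.independent_extend_basis[OF cvec.independent_empty]
  have tr: "lin_trace (\<lambda>v. f (g v)) = (\<Sum>b\<in>?B. \<Sum>c\<in>?B. ?r (g b) c * ?r (f c) b)"
    if "lin_map f" for f g :: "'v \<Rightarrow> 'v"
    unfolding lin_trace_def
  proof (intro sum.cong refl)
    fix b
    have "g b = (\<Sum>c\<in>?B. ?r (g b) c *\<^sub>C c)"
      by (rule cvec.sum_representation_eq[symmetric]) (simp_all add: B extend_basis_finite cvec.independent_empty)
    then have "f (g b) = (\<Sum>c\<in>?B. ?r (g b) c *\<^sub>C f c)"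
      by (metis (no_types, lifting) lin_map_scale lin_map_sum sum.cong that)
    then show "?r (f (g b)) b = (\<Sum>c\<in>?B. ?r (g b) c * ?r (f c) b)"
      by (simp add: representation_sum_scale[OF B] cvec.independent_empty)
  qed
  show ?thesis
    unfolding tr[OF assms(1), of g] tr[OF assms(2), of f] by (subst sum.swap) (simp add: mult.commute)
qed

end

section \<open>Polynomials in an operator and generalized eigenspaces\<close>

definition polyop :: "('v::complex_vec \<Rightarrow> 'v) \<Rightarrow> complex poly \<Rightarrow> 'v \<Rightarrow> 'v" where
  "polyop T p v = fold_coeffs (\<lambda>a w. a *\<^sub>C v + T w) p 0"

lemma polyop_0: "polyop T 0 v = 0"
  by (simp add: polyop_def)

lemma polyop_pCons: "lin_map T \<Longrightarrow> polyop T (pCons a p) v = a *\<^sub>C v + T (polyop T p v)"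
  by (cases "p = 0"; cases "a = 0") (simp_all add: polyop_def lin_map_zero)

lemma polyop_add: "lin_map T \<Longrightarrow> polyop T (p + q) v = polyop T p v + polyop T q v"
  by (induction p q rule: poly_induct2) (simp_all add: polyop_0 polyop_pCons lin_map_simps cscale_add_left)

lemma polyop_smult: "lin_map T \<Longrightarrow> polyop T (smult c p) v = c *\<^sub>C polyop T p v"
  by (induction p) (simp_all add: polyop_0 polyop_pCons lin_map_simps cscale_add_right)

lemma polyop_shift: "lin_map T \<Longrightarrow> polyop T p (T v - a *\<^sub>C v) = T (polyop T p v) - a *\<^sub>C polyop T p v"
  by (induction p) (simp_all add: polyop_0 polyop_pCons lin_map_simps cscale_add_right
      cvec.scale_right_diff_distrib mult.commute)

lemma polyop_linear_factor: "lin_map T \<Longrightarrow> polyop T ([:- a, 1:] * p) v = polyop T p (T v - a *\<^sub>C v)"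
proof -
  assume T: "lin_map T"
  have "[:- a, 1:] * p = smult (- a) p + pCons 0 p" by simp
  then show ?thesis by (simp only: polyop_add[OF T] polyop_smult[OF T] polyop_pCons[OF T] polyop_shift[OF T]) simp
qed

lemma polyop_monom: "lin_map T \<Longrightarrow> polyop T (monom c n) v = c *\<^sub>C (T ^^ n) v"
  by (induction n) (simp_all add: monom_0 monom_Suc polyop_0 polyop_pCons lin_map_simps)

lemma polyop_sum: "lin_map T \<Longrightarrow> polyop T (sum p I) v = (\<Sum>i\<in>I. polyop T (p i) v)"
  by (induction I rule: infinite_finite_induct) (simp_all add: polyop_0 polyop_add)

text \<open>Finite dimension makes infinitely many vectors T^i v dependent. Dependence concerns the
  set of these vectors and is blind to repetitions, so coinciding powers form a case of their
  own.\<close>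

lemma annihilating_poly:
  assumes fd: "fin_dim TYPE('v::complex_vec)" and T: "lin_map (T :: 'v \<Rightarrow> 'v)"
  shows "\<exists>p. p \<noteq> 0 \<and> polyop T p v = 0"
proof (cases "inj (\<lambda>i. (T ^^ i) v)")
  case False
  then obtain i j where ij: "i \<noteq> j" "(T ^^ i) v = (T ^^ j) v" by (auto simp: inj_def)
  have "coeff (monom 1 i + monom (-1) j :: complex poly) i \<noteq> 0" using ij by simp
  then have "monom 1 i + monom (-1) j \<noteq> (0 :: complex poly)" by (metis coeff_0)
  moreover have "polyop T (monom 1 i + monom (-1) j) v = 0" using ij by (simp add: polyop_add T polyop_monom)
  ultimately show ?thesis by blast
next
  case True
  let ?S = "range (\<lambda>i. (T ^^ i) v)"
  have "infinite ?S" using True finite_imageD by blast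
  then have "cvec.dependent ?S" using fin_dim_independent[OF fd] by blast
  then obtain U u where U: "finite U" "U \<subseteq> ?S" "\<exists>w\<in>U. u w \<noteq> 0" "(\<Sum>w\<in>U. u w *\<^sub>C w) = 0"
    unfolding cvec.dependent_explicit by blast
  obtain I where I: "U = (\<lambda>i. (T ^^ i) v) ` I" using U(2) subset_imageE by metis
  have finI: "finite I" using U(1) I True finite_imageD inj_on_subset by blast
  let ?p = "\<Sum>i\<in>I. monom (u ((T ^^ i) v)) i"
  obtain k where k: "k \<in> I" "u ((T ^^ k) v) \<noteq> 0" using U(3) I by auto
  have "coeff ?p k = u ((T ^^ k) v)" using k finI by (simp add: coeff_sum)
  then have "?p \<noteq> 0" using k by (metis coeff_0)
  moreover have "polyop T ?p v = (\<Sum>w\<in>U. u w *\<^sub>C w)"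
    unfolding I using True by (subst sum.reindex) (auto intro: inj_on_subset simp: polyop_sum T polyop_monom)
  ultimately show ?thesis using U(4) by metis
qed

definition gen_eig :: "('v::complex_vec \<Rightarrow> 'v) \<Rightarrow> complex \<Rightarrow> 'v set" where
  "gen_eig T a = {v. \<exists>n. ((\<lambda>w. T w - a *\<^sub>C w) ^^ n) v = 0}"

lemma lin_map_shift: "lin_map T \<Longrightarrow> lin_map (\<lambda>w. T w - a *\<^sub>C w)"
  by (auto intro!: lin_mapI simp: lin_map_simps cscale_add_right cvec.scale_right_diff_distrib mult.commute)

lemma subspace_loc_nilpotent:
  assumes "lin_map (T :: 'v::complex_vec \<Rightarrow> 'v)" shows "cvec.subspace {v. \<exists>n. (T ^^ n) v = 0}"
proof -
  note l = lin_map_simps[OF lin_map_funpow[OF assms]]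
  show ?thesis unfolding cvec.subspace_def
  proof (intro conjI ballI allI; simp)
    show "\<exists>n. (T ^^ n) 0 = 0" by (simp add: l)
    fix x assume x: "\<exists>n. (T ^^ n) x = 0"
    then show "\<exists>n. (T ^^ n) (c *\<^sub>C x) = 0" for c by (auto simp: l)
    fix y assume y: "\<exists>n. (T ^^ n) y = 0"
    from x y obtain m n where "(T ^^ m) x = 0" "(T ^^ n) y = 0" by auto
    then have "(T ^^ max m n) (x + y) = 0"
      using funpow_zero_mono[OF assms, of m x "max m n"] funpow_zero_mono[OF assms, of n y "max m n"] by (simp add: l)
    then show "\<exists>n. (T ^^ n) (x + y) = 0" by blast
  qed
qed

lemma subspace_gen_eig: "lin_map T \<Longrightarrow> cvec.subspace (gen_eig T a)"
  unfolding gen_eig_def by (rule subspace_loc_nilpotent[OF lin_map_shift])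

text \<open>On this space T - a is the nonzero scalar b - a plus the locally nilpotent T -
  b.\<close>

lemma gen_eig_shift_surj:
  assumes T: "lin_map T" and ne: "a \<noteq> b" and w: "w \<in> gen_eig T b"
  shows "\<exists>x\<in>gen_eig T b. T x - a *\<^sub>C x = w"
proof -
  note sub = subspace_gen_eig[OF T, of b]
  have "\<exists>x\<in>gen_eig T b. T x - a *\<^sub>C x = w" if "((\<lambda>w. T w - b *\<^sub>C w) ^^ n) w = 0" for n
    using that
  proof (induction n arbitrary: w)
    case 0
    then show ?case using cvec.subspace_0[OF sub] by (intro bexI[of _ 0]) (simp_all add: lin_map_zero[OF T])
  next
    case (Suc n)
    then have "((\<lambda>w. T w - b *\<^sub>C w) ^^ n) (T w - b *\<^sub>C w) = 0" by (simp only: funpow_Suc_right comp_apply)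
    then obtain x where x: "x \<in> gen_eig T b" "T x - a *\<^sub>C x = T w - b *\<^sub>C w" using Suc.IH by blast
    have wb: "w \<in> gen_eig T b" using Suc.prems unfolding gen_eig_def by blast
    \<comment> \<open>As (T - a) x = (T - b) w by the choice of x, applying T - a to w - x leaves (b
      - a) w.\<close>
    let ?y = "(1 / (b - a)) *\<^sub>C (w - x)"
    have y: "?y \<in> gen_eig T b" using x(1) wb sub by (simp add: cvec.subspace_diff cvec.subspace_scale)
    have "T (w - x) - a *\<^sub>C (w - x) = (T w - a *\<^sub>C w) - (T x - a *\<^sub>C x)"
      by (simp add: lin_map_simps[OF T] cvec.scale_right_diff_distrib)
    also have "\<dots> = (b - a) *\<^sub>C w" unfolding x(2) by (simp add: cvec.scale_left_diff_distrib)
    finally have k: "T (w - x) - a *\<^sub>C (w - x) = (b - a) *\<^sub>C w" .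
    have "T ?y - a *\<^sub>C ?y = (1 / (b - a)) *\<^sub>C (T (w - x) - a *\<^sub>C (w - x))"
      unfolding lin_map_scale[OF T] cvec.scale_right_diff_distrib[of _ "T (w - x)"]
      by (simp only: cscale_assoc mult.commute)
    then have "T ?y - a *\<^sub>C ?y = (1 / (b - a)) *\<^sub>C ((b - a) *\<^sub>C w)" unfolding k .
    then show ?case using y ne by (intro bexI[of _ ?y]) simp_all
  qed
  then show ?thesis using w by (auto simp: gen_eig_def)
qed

text \<open>Given p(T) v = 0, split off a root a of p. By induction (T - a) v lies in the sum
  \<open>?E\<close> of the generalized eigenspaces, where T - a is surjective up to the generalized
  eigenspace of a. Subtracting such a preimage from v leaves a generalized eigenvector for
  a.\<close>

lemma gen_eig_span:
  assumes fd: "fin_dim TYPE('v::complex_vec)" and T: "lin_map (T :: 'v \<Rightarrow> 'v)"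
  shows "cvec.span (\<Union>a. gen_eig T a) = UNIV"
proof -
  let ?E = "cvec.span (\<Union>a. gen_eig T a)"
  have surj: "\<exists>x\<in>?E. w - (T x - a *\<^sub>C x) \<in> gen_eig T a" if "w \<in> ?E" for w a
    using that
  proof (induction rule: cvec.span_induct_alt)
    case base
    then show ?case using cvec.subspace_0[OF subspace_gen_eig[OF T]]
      by (intro bexI[of _ 0]) (simp_all add: cvec.span_zero lin_map_zero[OF T])
  next
    case (step c g w)
    then obtain x where x: "x \<in> ?E" "w - (T x - a *\<^sub>C x) \<in> gen_eig T a" by blast
    obtain b where b: "g \<in> gen_eig T b" using step by auto
    show ?case
    proof (cases "a = b")
      case True
      then have "c *\<^sub>C g + (w - (T x - a *\<^sub>C x)) \<in> gen_eig T a"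
        using b x subspace_gen_eig[OF T, of a] by (simp add: cvec.subspace_add cvec.subspace_scale)
      then show ?thesis using x(1) by (intro bexI[of _ x]) (simp_all add: algebra_simps)
    next
      case False
      then obtain z where z: "z \<in> gen_eig T b" "T z - a *\<^sub>C z = g" using gen_eig_shift_surj[OF T _ b] by blast
      have zE: "z \<in> ?E" using z(1) by (intro cvec.span_base) auto
      have eq: "c *\<^sub>C g + w - (T (x + c *\<^sub>C z) - a *\<^sub>C (x + c *\<^sub>C z)) = w - (T x - a *\<^sub>C x)"
        unfolding z(2)[symmetric]
        by (simp add: lin_map_simps[OF T] cscale_add_right cvec.scale_right_diff_distrib mult.commute)
      show ?thesis using x zE
        by (intro bexI[of _ "x + c *\<^sub>C z"]) (simp_all only: eq cvec.span_add cvec.span_scale)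
    qed
  qed
  have "v \<in> ?E" if "p \<noteq> 0" "polyop T p v = 0" for p v
    using that
  proof (induction "degree p" arbitrary: p v)
    case 0
    then obtain c where "p = [:c:]" "c \<noteq> 0" by (metis degree_eq_zeroE pCons_0_0)
    then show ?case using 0 by (simp add: polyop_pCons[OF T] polyop_0 lin_map_zero[OF T] cvec.span_zero)
  next
    case (Suc n)
    then have "\<not> constant (poly p)" by (metis constant_degree nat.distinct(1))
    then obtain a where "poly p a = 0" using fundamental_theorem_of_algebra by blast
    then obtain q where q: "p = [:- a, 1:] * q" by (metis poly_eq_0_iff_dvd dvdE)
    have "q \<noteq> 0" using q Suc(3) by auto
    then have "degree p = Suc (degree q)" unfolding q by (subst degree_mult_eq) auto
    then have dq: "n = degree q" using Suc(2) by simp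
    have "polyop T q (T v - a *\<^sub>C v) = 0" using Suc(4) by (simp only: q polyop_linear_factor[OF T])
    then have "T v - a *\<^sub>C v \<in> ?E" using Suc(1)[OF dq \<open>q \<noteq> 0\<close>] by blast
    then obtain x where x: "x \<in> ?E" "T v - a *\<^sub>C v - (T x - a *\<^sub>C x) \<in> gen_eig T a" using surj by blast
    have "T (v - x) - a *\<^sub>C (v - x) = T v - a *\<^sub>C v - (T x - a *\<^sub>C x)"
      by (simp add: lin_map_simps[OF T] cvec.scale_right_diff_distrib)
    then obtain k where "((\<lambda>w. T w - a *\<^sub>C w) ^^ k) (T (v - x) - a *\<^sub>C (v - x)) = 0"
      using x(2) by (auto simp: gen_eig_def)
    then have "((\<lambda>w. T w - a *\<^sub>C w) ^^ Suc k) (v - x) = 0" by (simp only: funpow_Suc_right comp_apply)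
    then have "v - x \<in> gen_eig T a" unfolding gen_eig_def by blast
    then have "v - x \<in> ?E" by (intro cvec.span_base) auto
    then show ?case using cvec.span_add[OF _ x(1), of "v - x"] by simp
  qed
  then show ?thesis using annihilating_poly[OF fd T] by blast
qed

section \<open>Direct sums of subspaces\<close>

definition tot :: "('i \<Rightarrow>\<^sub>0 'v) \<Rightarrow> 'v::complex_vec" where
  "tot v = (\<Sum>i\<in>Poly_Mapping.keys v. Poly_Mapping.lookup v i)"

lemma tot_superset: "finite S \<Longrightarrow> Poly_Mapping.keys v \<subseteq> S \<Longrightarrow> tot v = (\<Sum>i\<in>S. Poly_Mapping.lookup v i)"
  unfolding tot_def by (rule sum_keys_superset[where F = "\<lambda>i x. x"]) simp_all

lemma tot_add: "tot (v + w) = tot v + tot w"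
  unfolding tot_def by (rule setsum_keys_plus_distrib[where f = "\<lambda>i x. x"]) simp_all

lemma tot_scale: "tot (c *\<^sub>C v) = c *\<^sub>C tot v"
  using tot_superset[OF finite_keys keys_scale, of c v] by (simp add: tot_def lookup_cscale cvec.scale_sum_right)

definition indep_fam :: "('i \<Rightarrow> 'v::complex_vec set) \<Rightarrow> bool" where
  "indep_fam W \<longleftrightarrow> (\<forall>v. (\<forall>i. Poly_Mapping.lookup v i \<in> W i) \<longrightarrow> tot v = 0 \<longrightarrow> v = 0)"

text \<open>In a nontrivial vanishing sum with smallest support, a power of T removes the component
  at j but not the one at i, and so produces a smaller one.\<close>

lemma indep_famI:
  fixes W :: "'i \<Rightarrow> 'v::complex_vec set"
  assumes "\<And>i j. i \<noteq> j \<Longrightarrow> \<exists>T. lin_map T \<and> (\<forall>l. T ` W l \<subseteq> W l) \<and> (\<forall>v\<in>W j. \<exists>n. (T ^^ n) v = 0) \<and>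
      (\<forall>v\<in>W i. T v = 0 \<longrightarrow> v = 0)"
  shows "indep_fam W"
proof -
  have "v = 0" if "\<And>i. Poly_Mapping.lookup v i \<in> W i" "tot v = 0" for v :: "'i \<Rightarrow>\<^sub>0 'v"
    using that
  proof (induction "card (Poly_Mapping.keys v)" arbitrary: v rule: less_induct)
    case less
    show ?case
    proof (rule ccontr)
      assume "v \<noteq> 0"
      then obtain i where i: "i \<in> Poly_Mapping.keys v" by fastforce
      have "Poly_Mapping.keys v \<noteq> {i}"
        using less(3) i unfolding in_keys_iff by (auto simp: tot_def)
      then obtain j where j: "j \<in> Poly_Mapping.keys v" "i \<noteq> j" using i by blast
      from assms[OF j(2)] obtain T where T: "lin_map T" "\<And>l. T ` W l \<subseteq> W l" 
        "\<And>v. v \<in> W j \<Longrightarrow> \<exists>n. (T ^^ n) v = 0" "\<And>v. v \<in> W i \<Longrightarrow> T v = 0 \<Longrightarrow> v = 0" by blast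
      obtain n where n: "(T ^^ n) (Poly_Mapping.lookup v j) = 0" using T(3) less(2) by blast
      note Tn = lin_map_funpow[OF T(1), of n]
      define v' where "v' = Poly_Mapping.map (T ^^ n) v"
      have lk: "Poly_Mapping.lookup v' l = (T ^^ n) (Poly_Mapping.lookup v l)" for l
        by (simp add: v'_def Poly_Mapping.map.rep_eq when_def lin_map_zero[OF Tn])
      have keys: "Poly_Mapping.keys v' \<subseteq> Poly_Mapping.keys v - {j}"
        using n by (auto simp: in_keys_iff lk lin_map_zero[OF Tn])
      have W: "(T ^^ m) x \<in> W l" if "x \<in> W l" for l x m
        using that T(2) by (induction m) auto
      have "tot v' = (T ^^ n) (tot v)"
        using keys by (subst tot_superset[of "Poly_Mapping.keys v"]) (auto simp: tot_def lk lin_map_sum[OF Tn])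
      then have "v' = 0"
        using less(2,3) W keys j(1) finite_keys[of v]
        by (intro less(1)) (auto simp: lk lin_map_zero[OF Tn] intro!: psubset_card_mono)
      then have "(T ^^ n) (Poly_Mapping.lookup v i) = 0" by (simp add: lk[symmetric])
      moreover have "x = 0" if "x \<in> W i" "(T ^^ m) x = 0" for x m
        using that T(4) W by (induction m) auto
      ultimately show False using less(2) i by (auto simp: in_keys_iff)
    qed
  qed
  then show ?thesis by (auto simp: indep_fam_def)
qed

lemma span_family_rep:
  assumes "\<And>i. cvec.subspace (W i)" "x \<in> cvec.span (\<Union>i. W i)"
  shows "\<exists>v. (\<forall>i. Poly_Mapping.lookup v i \<in> W i) \<and> tot v = x"
  using assms(2)
proof (induction rule: cvec.span_induct_alt)
  case base
  show ?case using assms(1) by (intro exI[of _ 0]) (simp add: tot_def cvec.subspace_0)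
next
  case (step c w x)
  then obtain v where v: "\<forall>i. Poly_Mapping.lookup v i \<in> W i" "tot v = x" by blast
  obtain i where i: "w \<in> W i" using step by blast
  have "tot (Poly_Mapping.single i (c *\<^sub>C w) + v) = c *\<^sub>C w + x"
    using tot_superset[of "{i}" "Poly_Mapping.single i (c *\<^sub>C w)"] by (simp add: tot_add v)
  moreover have "Poly_Mapping.lookup (Poly_Mapping.single i (c *\<^sub>C w) + v) l \<in> W l" for l
    using assms(1)[of l] v(1) i
    by (auto simp: lookup_add lookup_single when_def cvec.subspace_add cvec.subspace_scale)
  ultimately show ?case by blast
qed

text \<open>A scalar may be prescribed on each summand of a direct sum. This yields the semisimple
  part of an operator as well as the torus automorphism.\<close>

lemma family_scaling:
  fixes W :: "'i \<Rightarrow> 'v::complex_vec set"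
  assumes sub: "\<And>i. cvec.subspace (W i)" and span: "cvec.span (\<Union>i. W i) = UNIV" and ind: "indep_fam W"
  shows "\<exists>s. lin_map s \<and> (\<forall>i. \<forall>v\<in>W i. s v = c i *\<^sub>C v)"
proof -
  have ex: "\<exists>v. (\<forall>i. Poly_Mapping.lookup v i \<in> W i) \<and> tot v = x" for x
    by (rule span_family_rep[OF sub]) (simp add: span)
  define R where "R x = (SOME v. (\<forall>i. Poly_Mapping.lookup v i \<in> W i) \<and> tot v = x)" for x
  have R: "Poly_Mapping.lookup (R x) i \<in> W i" "tot (R x) = x" for x i
    using someI_ex[OF ex[of x]] unfolding R_def by blast+
  have uniq: "v = R (tot v)" if "\<And>i. Poly_Mapping.lookup v i \<in> W i" for v
  proof -
    have "tot (v + (-1) *\<^sub>C R (tot v)) = 0" by (simp only: tot_add tot_scale R) simp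
    moreover have "Poly_Mapping.lookup (v + (-1) *\<^sub>C R (tot v)) i \<in> W i" for i
      unfolding lookup_add lookup_cscale
      by (intro cvec.subspace_add cvec.subspace_scale sub that R)
    ultimately have "v + (-1) *\<^sub>C R (tot v) = 0" using ind unfolding indep_fam_def by blast
    then show ?thesis by simp
  qed
  have R_add: "R (x + y) = R x + R y" for x y
    using uniq[of "R x + R y"] R sub by (simp add: lookup_add cvec.subspace_add tot_add)
  have R_scale: "R (d *\<^sub>C x) = d *\<^sub>C R x" for d x
    using uniq[of "d *\<^sub>C R x"] R sub by (simp add: lookup_cscale cvec.subspace_scale tot_scale)
  define s where "s x = (\<Sum>i\<in>Poly_Mapping.keys (R x). c i *\<^sub>C Poly_Mapping.lookup (R x) i)" for x
  have "lin_map s"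
  proof (rule lin_mapI)
    show "s (x + y) = s x + s y" for x y
      unfolding s_def R_add
      by (rule setsum_keys_plus_distrib[where f = "\<lambda>i v. c i *\<^sub>C v"]) (simp_all add: cscale_add_right)
    show "s (d *\<^sub>C x) = d *\<^sub>C s x" for d x
      using sum_keys_superset[OF finite_keys keys_scale, of "\<lambda>i v. c i *\<^sub>C v" d "R x"]
      by (simp add: s_def R_scale lookup_cscale cvec.scale_sum_right mult.commute)
  qed
  moreover have "s v = c i *\<^sub>C v" if v: "v \<in> W i" for i v
  proof -
    have "tot (Poly_Mapping.single i v) = v"
      using tot_superset[of "{i}" "Poly_Mapping.single i v"] by simp
    moreover have "Poly_Mapping.lookup (Poly_Mapping.single i v) l \<in> W l" for l
      using v cvec.subspace_0[OF sub] by (auto simp: lookup_single when_def)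
    ultimately have "R v = Poly_Mapping.single i v" using uniq[of "Poly_Mapping.single i v"] by simp
    then show ?thesis unfolding s_def
      by (simp only: sum_keys_single[where F = "\<lambda>i v. c i *\<^sub>C v", OF cvec.scale_zero_right])
  qed
  ultimately show ?thesis by blast
qed

lemma gen_eig_indep:
  assumes T: "lin_map T" shows "indep_fam (gen_eig T)"
proof (rule indep_famI)
  fix a b :: complex assume ne: "a \<noteq> b"
  let ?T = "\<lambda>w. T w - b *\<^sub>C w"
  have pres: "?T v \<in> gen_eig T l" if "v \<in> gen_eig T l" for v l
  proof -
    have comm: "((\<lambda>w. T w - l *\<^sub>C w) ^^ n) (?T v) = ?T (((\<lambda>w. T w - l *\<^sub>C w) ^^ n) v)" for n
      by (induction n) (simp_all add: lin_map_simps[OF T] cvec.scale_right_diff_distrib mult.commute)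
    obtain n where "((\<lambda>w. T w - l *\<^sub>C w) ^^ n) v = 0" using \<open>v \<in> gen_eig T l\<close> by (auto simp: gen_eig_def)
    then have "((\<lambda>w. T w - l *\<^sub>C w) ^^ n) (?T v) = 0" by (simp only: comm) (simp add: lin_map_zero[OF T])
    then show ?thesis unfolding gen_eig_def by blast
  qed
  have inj: "v = 0" if "v \<in> gen_eig T a" "?T v = 0" for v
  proof -
    have "((\<lambda>w. T w - a *\<^sub>C w) ^^ n) v = (b - a) ^ n *\<^sub>C v" for n
      using that(2) by (induction n) (simp_all add: lin_map_simps[OF T] cvec.scale_left_diff_distrib algebra_simps)
    then show ?thesis using that(1) ne by (auto simp: gen_eig_def)
  qed
  show "\<exists>T'. lin_map T' \<and> (\<forall>l. T' ` gen_eig T l \<subseteq> gen_eig T l) \<and> (\<forall>v\<in>gen_eig T b. \<exists>n. (T' ^^ n) v = 0) \<and>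
      (\<forall>v\<in>gen_eig T a. T' v = 0 \<longrightarrow> v = 0)"
    using pres inj by (intro exI[of _ ?T] conjI lin_map_shift[OF T]) (auto simp: gen_eig_def[of T b])
qed

section \<open>Root space decomposition\<close>

text \<open>The orthonormal basis belongs to the locale because it is the source of all
  nondegeneracy statements about the Killing form.\<close>

locale chevalley =
  fixes h :: "'g::complex_lie_algebra set" and \<sigma> :: "'g \<Rightarrow> 'g" and X :: "'g set"
  assumes simple: "simple_lie_algebra TYPE('g)"
    and cartan: "cartan_subalgebra h"
    and chevalley: "chevalley_involution h \<sigma>"
    and basis: "orthonormal_basis h X"
begin

sublocale right_linear_lie "TYPE('g)"
  by (rule simple_right_linear[OF simple])

lemma fd: "fin_dim TYPE('g)"
  using simple unfolding simple_lie_algebra_def fin_dim_def by blast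

lemma jacobi_derivation: "bracket x (bracket y z) = bracket (bracket x y) z + bracket y (bracket x (z :: 'g))"
proof -
  have "bracket x (bracket y z) + bracket y (bracket z x) + bracket z (bracket x y) = 0" by (rule jacobi)
  moreover have "bracket y (bracket z x) = - bracket y (bracket x z)"
    by (subst bracket_anti[of z x]) (simp add: bracket_simps)
  moreover have "bracket z (bracket x y) = - bracket (bracket x y) z" by (rule bracket_anti)
  ultimately show ?thesis by (simp add: algebra_simps)
qed

lemma bracket_bracket_left: "bracket (bracket x y) z = bracket x (bracket y z) - bracket y (bracket x (z :: 'g))"
  using jacobi_derivation[of x y z] by simp

lemma lin_map_bracket2: "lin_map (\<lambda>z. bracket x (bracket y (z :: 'g)))"
  using lin_map_comp[OF lin_map_bracket_right lin_map_bracket_right] by (simp add: comp_def)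

lemma killing_sym: "killing x y = killing y (x :: 'g)"
  unfolding killing_def by (rule lin_trace_commute[OF fd lin_map_bracket_right lin_map_bracket_right])

lemma killing_bilin: "bilin (killing :: 'g \<Rightarrow> 'g \<Rightarrow> complex)"
proof -
  have l: "lin_map (\<lambda>x :: 'g. killing x y)" for y
    unfolding killing_def
    by (rule lin_mapI) (simp_all add: bracket_add_left bracket_scale_left lin_trace_add[OF fd] lin_trace_scale[OF fd] cscale_complex_def)
  moreover have "lin_map (killing x)" for x :: 'g
  proof -
    have "killing x = (\<lambda>y. killing y x)" using killing_sym by blast
    then show ?thesis using l[of x] by simp
  qed
  ultimately show ?thesis by (rule bilinI)
qed

lemmas killing_simps = bilin_simps[OF killing_bilin] bilin_sum_left[OF killing_bilin] bilin_sum_right[OF killing_bilin]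
  bilin_neg_left[OF killing_bilin] bilin_neg_right[OF killing_bilin]

lemma killing_zero: "killing 0 (x :: 'g) = 0" "killing (x :: 'g) 0 = 0"
  using lin_map_zero[OF bilinD(1)[OF killing_bilin]] lin_map_zero[OF bilinD(2)[OF killing_bilin]] by auto

lemma killing_diff: "killing (x - y) z = killing x z - killing y (z :: 'g)"
  using lin_map_diff[OF bilinD(1)[OF killing_bilin]] .

text \<open>Cyclicity of the trace moves \<open>bracket y\<close> from the left end of the second
  product to its right end.\<close>

lemma killing_inv: "killing (bracket x y) z = killing x (bracket y (z :: 'g))"
proof -
  have "killing (bracket x y) z = lin_trace (\<lambda>w. bracket x (bracket y (bracket z w))) - lin_trace (\<lambda>w. bracket y (bracket x (bracket z w)))"
    by (simp add: killing_def bracket_bracket_left lin_trace_diff[OF fd])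
  also have "lin_trace (\<lambda>w. bracket y (bracket x (bracket z w))) = lin_trace (\<lambda>w. bracket x (bracket z (bracket y w)))"
    by (rule lin_trace_commute[OF fd lin_map_bracket_right lin_map_bracket2])
  also have "lin_trace (\<lambda>w. bracket x (bracket y (bracket z w))) - \<dots> = killing x (bracket y z)"
    by (simp add: killing_def bracket_bracket_left lin_trace_diff[OF fd] bracket_simps)
  finally show ?thesis .
qed

lemma h_subspace: "cvec.subspace h" and h_bracket: "s \<in> h \<Longrightarrow> t \<in> h \<Longrightarrow> bracket s t \<in> h"
  using cartan by (auto simp: cartan_subalgebra_def lie_subalgebra_def)

lemmas h_closed = cvec.subspace_0[OF h_subspace] cvec.subspace_add[OF h_subspace] cvec.subspace_scale[OF h_subspace]
  cvec.subspace_neg[OF h_subspace] cvec.subspace_diff[OF h_subspace] cvec.subspace_sum[OF h_subspace]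

lemma h_normalizer: "(\<And>t. t \<in> h \<Longrightarrow> bracket x t \<in> h) \<Longrightarrow> x \<in> h"
  using cartan unfolding cartan_subalgebra_def by blast

lemma h_centralizer: "(\<And>t. t \<in> h \<Longrightarrow> bracket t x = 0) \<Longrightarrow> x \<in> h"
  by (rule h_normalizer, subst bracket_anti) (simp add: h_closed)

lemma \<sigma>_lin: "lin_map \<sigma>" and \<sigma>_bracket: "\<sigma> (bracket x y) = bracket (\<sigma> x) (\<sigma> y)"
  and \<sigma>_\<sigma>: "\<sigma> (\<sigma> x) = x" and \<sigma>_h: "t \<in> h \<Longrightarrow> \<sigma> t = - t" and \<sigma>_bij: "bij \<sigma>"
  using chevalley by (auto simp: chevalley_involution_def lie_automorphism_def fun_eq_iff)

text \<open>As \<sigma> is -1 on h, applying it to [s, t] gives both -[s, t] and [-s, -t].\<close>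

lemma h_abelian: assumes "s \<in> h" "t \<in> h" shows "bracket s t = 0"
proof (rule double_eq_zero)
  have "- bracket s t = bracket (- s) (- t)"
    using \<sigma>_bracket[of s t] unfolding \<sigma>_h[OF assms(1)] \<sigma>_h[OF assms(2)] \<sigma>_h[OF h_bracket[OF assms]] .
  also have "\<dots> = bracket s t" by (simp only: bracket_simps minus_minus)
  finally show "bracket s t + bracket s t = 0" by (metis add.left_inverse)
qed

lemma X_facts: "cvec.independent X" "cvec.span X = h" "x \<in> X \<Longrightarrow> x' \<in> X \<Longrightarrow> killing x x' = (if x = x' then 1 else 0)"
  using basis by (auto simp: orthonormal_basis_def)

lemma X_h: "x \<in> X \<Longrightarrow> x \<in> h"
  using X_facts(2) cvec.span_base by blast

lemma finite_X: "finite X"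
  by (rule fin_dim_independent[OF fd X_facts(1)])

lemma h_expand: assumes "t \<in> h" shows "t = (\<Sum>x\<in>X. killing x t *\<^sub>C x)"
proof -
  let ?r = "cvec.representation X t"
  have t: "t = (\<Sum>x\<in>X. ?r x *\<^sub>C x)"
    using assms X_facts finite_X by (intro cvec.sum_representation_eq[symmetric]) auto
  have "killing x t = ?r x" if x: "x \<in> X" for x
  proof -
    have "killing x t = (\<Sum>x'\<in>X. ?r x' * killing x x')"
      by (subst t) (simp add: killing_simps cscale_complex_def)
    also have "\<dots> = (\<Sum>x'\<in>X. if x' = x then ?r x else 0)"
      using x by (intro sum.cong) (auto simp: X_facts)
    finally show ?thesis using x finite_X by simp
  qed
  then show ?thesis using t by simp
qed

lemma h_nondeg: "t \<in> h \<Longrightarrow> (\<And>s. s \<in> h \<Longrightarrow> killing t s = 0) \<Longrightarrow> t = 0"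
  using h_expand[of t] X_h killing_sym by simp

lemma ex_bracket_nonzero: "\<exists>x y :: 'g. bracket x y \<noteq> 0"
  using simple unfolding simple_lie_algebra_def by blast

lemma ideal_trivial: "lie_ideal (I :: 'g set) \<Longrightarrow> I = {0} \<or> I = UNIV"
  using simple unfolding simple_lie_algebra_def by blast

text \<open>The radical of the form is an ideal. If it were everything, the orthonormal basis would
  be empty and h zero; but the zero subspace is normalized by the whole algebra, so it is not a
  Cartan subalgebra here.\<close>

lemma killing_nondeg: assumes "\<And>x. killing x y = 0" shows "y = (0 :: 'g)"
proof -
  let ?I = "{y :: 'g. \<forall>x. killing x y = 0}"
  have "lie_ideal ?I"
    unfolding lie_ideal_def cvec.subspace_def
    by (auto simp: killing_simps killing_zero killing_inv[symmetric] cscale_complex_def)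
  moreover have "?I \<noteq> UNIV"
  proof
    assume I: "?I = UNIV"
    have "X = {}"
    proof (rule ccontr)
      assume "X \<noteq> {}"
      then obtain x where "x \<in> X" by blast
      moreover have "x \<in> ?I" using I by blast
      ultimately show False using X_facts(3)[of x x] by simp
    qed
    then have h0: "h = {0}" using X_facts by auto
    have "x \<in> h" for x by (rule h_normalizer) (simp add: h0 bracket_simps)
    then have "x = 0" for x :: 'g using h0 by blast
    then show False using ex_bracket_nonzero by metis
  qed
  ultimately have "?I = {0}" using ideal_trivial by blast
  then show ?thesis using assms by blast
qed

lemma killing_dual:
  assumes \<phi>: "lin_map (\<phi> :: 'g \<Rightarrow> complex)" shows "\<exists>d. \<forall>z. killing d z = \<phi> z"
proof -
  let ?B = "cvec.extend_basis {} :: 'g set"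
  have B: "cvec.independent ?B" "cvec.span ?B = UNIV" "finite ?B"
    using cvec.independent_extend_basis[OF cvec.independent_empty] cvec.span_extend_basis[OF cvec.independent_empty]
      extend_basis_finite[OF fd] by auto
  interpret V: finite_dimensional_vector_space "cscale :: complex \<Rightarrow> 'g \<Rightarrow> 'g" ?B
    by unfold_locales (use B in auto)
  \<comment> \<open>Records the functional K(d, -) by its values on a basis, as a vector.
    Nondegeneracy becomes injectivity, hence surjectivity in finite dimension.\<close>
  let ?F = "\<lambda>d. \<Sum>b\<in>?B. killing d b *\<^sub>C b"
  have lin: "lin_map ?F"
    by (rule lin_mapI) (simp_all add: killing_simps cscale_add_left sum.distrib cvec.scale_sum_right cscale_complex_def)
  have eqI: "\<forall>z. f z = g z" if f: "lin_map f" "lin_map g" and e: "\<And>b. b \<in> ?B \<Longrightarrow> f b = g b" for f g :: "'g \<Rightarrow> complex"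
  proof
    fix z :: 'g
    have "z \<in> cvec.span ?B" using B by simp
    then show "f z = g z"
      by (induction rule: cvec.span_induct_alt) (simp_all add: lin_map_simps[OF f(1)] lin_map_simps[OF f(2)] e)
  qed
  have coef: "\<forall>b\<in>?B. f b = 0" if "(\<Sum>b\<in>?B. f b *\<^sub>C b) = 0" for f
    using B that unfolding cvec.independent_explicit_finite_subsets by blast
  have "inj ?F"
  proof (rule injI)
    fix d d' assume "?F d = ?F d'"
    then have "(\<Sum>b\<in>?B. killing (d - d') b *\<^sub>C b) = 0"
      by (simp add: killing_diff cvec.scale_left_diff_distrib sum_subtractf)
    then have "\<forall>b\<in>?B. killing (d - d') b = 0" by (rule coef)
    then have "\<forall>z. killing (d - d') z = 0"
      by (intro eqI bilinD(2)[OF killing_bilin]) (auto intro: lin_mapI)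
    then have "d - d' = 0" using killing_nondeg[of "d - d'"] killing_sym by metis
    then show "d = d'" by simp
  qed
  then have "surj ?F" using V.linear_inj_imp_surj[of ?F] lin by (simp add: lin_map_def)
  from surjD[OF this, of "\<Sum>b\<in>?B. \<phi> b *\<^sub>C b"]
  obtain d where "?F d = (\<Sum>b\<in>?B. \<phi> b *\<^sub>C b)" by auto
  then have "(\<Sum>b\<in>?B. (killing d b - \<phi> b) *\<^sub>C b) = 0" by (simp add: cvec.scale_left_diff_distrib sum_subtractf)
  then have "\<forall>b\<in>?B. killing d b = \<phi> b" using coef by fastforce
  then have "\<forall>z. killing d z = \<phi> z" by (intro eqI bilinD(2)[OF killing_bilin] \<phi>) auto
  then show ?thesis by blast
qed

text \<open>The functional sending z to tr (D \<circ> ad z) is represented by some d under the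
  Killing form. For E = D - ad d these traces vanish. Since ad (E x) is the commutator of E and ad
  x, also K(E x, y) = tr (E \<circ> ad [x, y]) vanishes.\<close>

lemma derivation_inner:
  assumes D: "lin_map D" "\<And>x y. D (bracket x y) = bracket (D x) y + bracket x (D (y :: 'g))"
  shows "\<exists>d. \<forall>z. D z = bracket d z"
proof -
  have "lin_map (\<lambda>z. lin_trace (\<lambda>w. D (bracket z w)))"
    by (rule lin_mapI) (simp_all add: bracket_simps lin_map_simps[OF D(1)] lin_trace_add[OF fd] lin_trace_scale[OF fd] cscale_complex_def)
  then obtain d where d: "\<And>z. killing d z = lin_trace (\<lambda>w. D (bracket z w))" using killing_dual by blast
  define E where "E z = D z - bracket d z" for z
  have E: "lin_map E" unfolding E_def
    by (rule lin_mapI) (simp_all add: lin_map_simps[OF D(1)] bracket_simps cvec.scale_right_diff_distrib)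
  have Eder: "E (bracket x y) = bracket (E x) y + bracket x (E y)" for x y
    by (simp add: E_def D(2) jacobi_derivation[of d x y] bracket_simps)
  have tr0: "lin_trace (\<lambda>w. E (bracket z w)) = 0" for z
    using d[of z] by (simp add: E_def lin_trace_diff[OF fd] killing_def)
  have "killing (E x) y = 0" for x y
  proof -
    have "bracket (E x) w = E (bracket x w) - bracket x (E w)" for w using Eder[of x w] by simp
    then have "killing (E x) y = lin_trace (\<lambda>w. E (bracket x (bracket y w))) - lin_trace (\<lambda>w. bracket x (E (bracket y w)))"
      by (simp add: killing_def lin_trace_diff[OF fd])
    also have "lin_trace (\<lambda>w. bracket x (E (bracket y w))) = lin_trace (\<lambda>w. E (bracket y (bracket x w)))"
      using lin_trace_commute[OF fd lin_map_bracket_right lin_map_comp[OF E lin_map_bracket_right]] by (simp add: comp_def)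
    also have "lin_trace (\<lambda>w. E (bracket x (bracket y w))) - \<dots> = lin_trace (\<lambda>w. E (bracket (bracket x y) w))"
      by (simp add: bracket_bracket_left lin_map_simps[OF E] lin_trace_diff[OF fd])
    finally show ?thesis by (simp add: tr0)
  qed
  then have "E x = 0" for x using killing_nondeg[of "E x"] killing_sym by metis
  then have "\<forall>z. D z = bracket d z" by (simp add: E_def)
  then show ?thesis by blast
qed

section \<open>Simultaneous diagonalization of the Cartan subalgebra\<close>

lemma gen_eig_bracket:
  assumes "u \<in> gen_eig (bracket x) a" "v \<in> gen_eig (bracket x) (b :: complex)"
  shows "bracket u v \<in> gen_eig (bracket (x :: 'g)) (a + b)"
proof -
  let ?N = "\<lambda>a w. bracket x w - a *\<^sub>C w"
  have "\<exists>k. (?N (a + b) ^^ k) (bracket u v) = 0" if "(?N a ^^ m) u = 0" "(?N b ^^ n) v = 0" for m n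
    using that
  proof (induction "m + n" arbitrary: m n u v)
    case 0
    then show ?case by (intro exI[of _ 0]) (simp add: bracket_simps)
  next
    case (Suc l)
    note linN = lin_map_funpow[OF lin_map_shift[OF lin_map_bracket_right[of x]]]
    \<comment> \<open>The Leibniz rule for the shifted operators; each summand lowers one of the two
      exponents.\<close>
    have step: "?N (a + b) (bracket u v) = bracket (?N a u) v + bracket u (?N b v)"
      by (simp add: jacobi_derivation[of x u v] bracket_simps cscale_add_left)
    show ?case
    proof (cases "m = 0 \<or> n = 0")
      case True
      then have "bracket u v = 0" using Suc by (auto simp: bracket_simps)
      then show ?thesis by (intro exI[of _ 0]) simp
    next
      case False
      then obtain m' n' where mn: "m = Suc m'" "n = Suc n'" by (metis not0_implies_Suc)
      have "(?N a ^^ m') (?N a u) = 0" "(?N b ^^ n') (?N b v) = 0"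
        using Suc(3,4) by (simp_all only: mn funpow_Suc_right comp_apply)
      then obtain k k' where k: "(?N (a + b) ^^ k) (bracket (?N a u) v) = 0" "(?N (a + b) ^^ k') (bracket u (?N b v)) = 0"
        using Suc(1)[of m' n "?N a u" v] Suc(1)[of m n' u "?N b v"] Suc(2-4) mn by auto
      have "(?N (a + b) ^^ max k k') (bracket (?N a u) v) = 0" "(?N (a + b) ^^ max k k') (bracket u (?N b v)) = 0"
        by (rule funpow_zero_mono[OF lin_map_shift[OF lin_map_bracket_right[of x]] k(1)], simp,
            rule funpow_zero_mono[OF lin_map_shift[OF lin_map_bracket_right[of x]] k(2)], simp)
      then have "(?N (a + b) ^^ Suc (max k k')) (bracket u v) = 0"
        by (simp only: funpow_Suc_right comp_apply step lin_map_add[OF linN]) simp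
      then show ?thesis by blast
    qed
  qed
  then show ?thesis using assms unfolding gen_eig_def by blast
qed

lemma span_extend2:
  assumes S: "cvec.span S = UNIV" and f: "bilin (f :: 'g \<Rightarrow> 'g \<Rightarrow> 'g)" "bilin g"
    and eq: "\<And>x y. x \<in> S \<Longrightarrow> y \<in> S \<Longrightarrow> f x y = g x y"
  shows "f x y = g x y"
proof -
  have 1: "f x y = g x y" if "x \<in> S" for x y
  proof -
    have "y \<in> cvec.span S" using S by simp
    then show ?thesis
      by (induction rule: cvec.span_induct_alt)
        (simp_all add: lin_map_simps[OF bilinD(2)[OF f(1)]] lin_map_simps[OF bilinD(2)[OF f(2)]] eq that)
  qed
  have "x \<in> cvec.span S" using S by simp
  then show ?thesis
    by (induction rule: cvec.span_induct_alt)
      (simp_all add: lin_map_simps[OF bilinD(1)[OF f(1)]] lin_map_simps[OF bilinD(1)[OF f(2)]] 1)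
qed

lemma bilin_bracket: "lin_map f \<Longrightarrow> lin_map g \<Longrightarrow> bilin (\<lambda>x y. bracket (f x) (g y :: 'g))"
  by (auto intro!: bilinI lin_mapI simp: lin_map_simps bracket_simps)

text \<open>The semisimple part of \<^term>\<open>bracket x\<close> is a derivation commuting with \<^term>\<open>h\<close>, hence
  inner and given by some \<^term>\<open>d \<in> h\<close>; the difference \<^term>\<open>x - d\<close> is orthogonal to
  \<^term>\<open>h\<close> because it acts nilpotently.\<close>

lemma h_diagonalizable:
  assumes x: "x \<in> h" and v: "v \<in> gen_eig (bracket x) a"
  shows "bracket x v = a *\<^sub>C v"
proof -
  note lx = lin_map_bracket_right[of x]
  note sub = subspace_gen_eig[OF lx] and span = gen_eig_span[OF fd lx] and ind = gen_eig_indep[OF lx]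
  from family_scaling[OF sub span ind, of "\<lambda>a. a"] obtain s where
    s: "lin_map s" "\<And>a v. v \<in> gen_eig (bracket x) a \<Longrightarrow> s v = a *\<^sub>C v" by blast
  \<comment> \<open>On generalized eigenspaces \<open>s\<close> is a scalar, and eigenvalues add
    under the bracket; such vectors span.\<close>
  have der: "s (bracket y z) = bracket (s y) z + bracket y (s z)" for y z
  proof (rule span_extend2[OF span, where f = "\<lambda>y z. s (bracket y z)" and g = "\<lambda>y z. bracket (s y) z + bracket y (s z)"])
    show "bilin (\<lambda>y z. s (bracket y z))"
      by (auto intro!: bilinI lin_mapI simp: lin_map_simps[OF s(1)] bracket_simps)
    show "bilin (\<lambda>y z. bracket (s y) z + bracket y (s z))"
      by (auto intro!: bilinI lin_mapI simp: lin_map_simps[OF s(1)] bracket_simps cscale_add_right)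
    fix y z assume "y \<in> (\<Union>a. gen_eig (bracket x) a)" "z \<in> (\<Union>a. gen_eig (bracket x) a)"
    then obtain a b where yz: "y \<in> gen_eig (bracket x) a" "z \<in> gen_eig (bracket x) b" by blast
    show "s (bracket y z) = bracket (s y) z + bracket y (s z)"
      using s(2)[OF yz(1)] s(2)[OF yz(2)] s(2)[OF gen_eig_bracket[OF yz]] by (simp add: bracket_simps cscale_add_left)
  qed
  obtain d where d: "\<And>z. s z = bracket d z" using derivation_inner[OF s(1) der] by blast
  \<comment> \<open>Elements of h commute with x, so they belong to the eigenvalue 0, where
    \<open>s\<close> vanishes; hence d normalizes h.\<close>
  have "bracket d t = 0" if t: "t \<in> h" for t
  proof -
    have "t \<in> gen_eig (bracket x) 0" unfolding gen_eig_def
      using h_abelian[OF x t] by (auto intro!: exI[of _ "Suc 0"])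
    then show ?thesis using s(2)[of t 0] d[of t] by simp
  qed
  then have dh: "d \<in> h" using h_closed(1) by (intro h_normalizer[of d]) simp
  let ?n = "\<lambda>z. bracket (x - d) z"
  have loc: "\<exists>n. (?n ^^ n) z = 0" for z
  proof -
    have *: "\<exists>n. (?n ^^ n) z = 0" if z: "z \<in> gen_eig (bracket x) a" for z a
    proof -
      have nz: "?n w = bracket x w - a *\<^sub>C w \<and> bracket x w - a *\<^sub>C w \<in> gen_eig (bracket x) a" if w: "w \<in> gen_eig (bracket x) a" for w
      proof
        show "?n w = bracket x w - a *\<^sub>C w" using s(2)[OF w] d[of w] by (simp add: bracket_simps)
        obtain k where "((\<lambda>w. bracket x w - a *\<^sub>C w) ^^ k) w = 0" using w by (auto simp: gen_eig_def)
        then have "((\<lambda>w. bracket x w - a *\<^sub>C w) ^^ Suc k) w = 0" by (simp add: bracket_simps)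
        then show "bracket x w - a *\<^sub>C w \<in> gen_eig (bracket x) a"
          unfolding gen_eig_def by (simp only: funpow_Suc_right comp_apply) blast
      qed
      have pow: "(?n ^^ k) z = ((\<lambda>w. bracket x w - a *\<^sub>C w) ^^ k) z \<and> (?n ^^ k) z \<in> gen_eig (bracket x) a" for k
      proof (induction k)
        case 0
        show ?case using z by simp
      next
        case (Suc k)
        then have e: "(?n ^^ k) z = ((\<lambda>w. bracket x w - a *\<^sub>C w) ^^ k) z" and m: "(?n ^^ k) z \<in> gen_eig (bracket x) a" by auto
        note n = nz[OF m]
        show ?case unfolding funpow.simps comp_apply e[symmetric] conjunct1[OF n] using conjunct2[OF n] by blast
      qed
      obtain k where "((\<lambda>w. bracket x w - a *\<^sub>C w) ^^ k) z = 0" using z by (auto simp: gen_eig_def)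
      then have "(?n ^^ k) z = 0" using pow[of k] by simp
      then show ?thesis by blast
    qed
    have "z \<in> cvec.span (\<Union>a. gen_eig (bracket x) a)" using span by simp
    moreover have "cvec.span (\<Union>a. gen_eig (bracket x) a) \<subseteq> {z. \<exists>n. (?n ^^ n) z = 0}"
      by (rule cvec.span_minimal[OF _ subspace_loc_nilpotent[OF lin_map_bracket_right]]) (use * in auto)
    ultimately show ?thesis by blast
  qed
  \<comment> \<open>ad (x - d) is locally nilpotent and commutes with ad t, so their product has
    trace zero.\<close>
  have kd: "killing (x - d) t = 0" if t: "t \<in> h" for t
  proof -
    have xd: "x - d \<in> h" using x dh h_closed by blast
    have comm: "bracket t (bracket (x - d) z) = bracket (x - d) (bracket t z)" for z
      using jacobi_derivation[of t "x - d" z] h_abelian[OF t xd] by (simp add: bracket_simps)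
    have pow: "((\<lambda>z. bracket (x - d) (bracket t z)) ^^ k) z = ((\<lambda>z. bracket t z) ^^ k) ((?n ^^ k) z)" for k z
    proof (induction k)
      case (Suc k)
      have c: "bracket (x - d) ((bracket t ^^ k) w) = (bracket t ^^ k) (bracket (x - d) w)" for w
        by (induction k) (simp_all add: comm[symmetric])
      have "((\<lambda>z. bracket (x - d) (bracket t z)) ^^ Suc k) z = bracket (x - d) (bracket t ((bracket t ^^ k) ((?n ^^ k) z)))"
        by (simp only: funpow.simps comp_apply Suc)
      also have "\<dots> = bracket t ((bracket t ^^ k) (?n ((?n ^^ k) z)))" by (simp only: comm[symmetric] c)
      finally show ?case by (simp only: funpow.simps comp_apply)
    qed simp
    show ?thesis unfolding killing_def
    proof (rule lin_trace_nilpotent[OF fd lin_map_bracket2])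
      fix z obtain k where "(?n ^^ k) z = 0" using loc by blast
      then show "\<exists>k. ((\<lambda>z. bracket (x - d) (bracket t z)) ^^ k) z = 0"
        by (intro exI[of _ k]) (simp add: pow lin_map_zero[OF lin_map_funpow[OF lin_map_bracket_right]])
    qed
  qed
  have "x - d = 0" by (rule h_nondeg[OF h_closed(5)[OF x dh] kd])
  then show ?thesis using s(2)[OF v] d[of v] by simp
qed

text \<open>The components of a joint eigenvector with respect to a further ad x remain eigenvectors
  of the earlier operators: ad y - b acts on each component separately and annihilates their sum,
  hence each of them.\<close>

lemma joint_eigenvectors_span:
  assumes "finite Y" "Y \<subseteq> h"
  shows "cvec.span {v. \<forall>x\<in>Y. \<exists>a. bracket x v = a *\<^sub>C v} = UNIV"
  using assms
proof (induction Y rule: finite_induct)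
  case empty
  then show ?case by simp
next
  case (insert x Y)
  let ?E = "\<lambda>Y. {v. \<forall>x\<in>Y. \<exists>a. bracket x v = a *\<^sub>C v}"
  have x: "x \<in> h" and Y: "Y \<subseteq> h" using insert by auto
  note lx = lin_map_bracket_right[of x]
  note sub = subspace_gen_eig[OF lx] and span = gen_eig_span[OF fd lx] and ind = gen_eig_indep[OF lx]
  have "v \<in> cvec.span (?E (insert x Y))" if v: "v \<in> ?E Y" for v
  proof -
    have "v \<in> cvec.span (\<Union>a. gen_eig (bracket x) a)" using span by simp
    then obtain w where w: "\<And>a. Poly_Mapping.lookup w a \<in> gen_eig (bracket x) a" "tot w = v"
      using span_family_rep[where W = "gen_eig (bracket x)" and x = v, OF sub] by blast
    have "Poly_Mapping.lookup w a \<in> ?E (insert x Y)" for a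
    proof -
      have "\<exists>b. bracket y (Poly_Mapping.lookup w a) = b *\<^sub>C Poly_Mapping.lookup w a" if y: "y \<in> Y" for y
      proof -
        obtain b where b: "bracket y v = b *\<^sub>C v" using v y by blast
        note ly = lin_map_shift[OF lin_map_bracket_right[of y], of b]
        define w' where "w' = Poly_Mapping.map (\<lambda>z. bracket y z - b *\<^sub>C z) w"
        have lk: "Poly_Mapping.lookup w' l = bracket y (Poly_Mapping.lookup w l) - b *\<^sub>C Poly_Mapping.lookup w l" for l
          by (simp add: w'_def Poly_Mapping.map.rep_eq when_def bracket_simps)
        have yx: "bracket x (bracket y z) = bracket y (bracket x z)" for z
          using jacobi_derivation[of x y z] h_abelian[of x y] x Y y by (auto simp: bracket_simps)
        have "Poly_Mapping.lookup w' l \<in> gen_eig (bracket x) l" for l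
        proof -
          let ?z = "Poly_Mapping.lookup w l"
          have ez: "bracket x ?z = l *\<^sub>C ?z" using h_diagonalizable[OF x w(1)] .
          have "bracket x (Poly_Mapping.lookup w' l) = l *\<^sub>C Poly_Mapping.lookup w' l"
            by (simp add: lk bracket_simps yx ez cvec.scale_right_diff_distrib mult.commute)
          then show ?thesis unfolding gen_eig_def by (auto intro!: exI[of _ "Suc 0"])
        qed
        moreover have "tot w' = 0"
        proof -
          have "Poly_Mapping.keys w' \<subseteq> Poly_Mapping.keys w" by (auto simp: in_keys_iff lk bracket_simps)
          then have "tot w' = (\<Sum>l\<in>Poly_Mapping.keys w. bracket y (Poly_Mapping.lookup w l) - b *\<^sub>C Poly_Mapping.lookup w l)"
            by (subst tot_superset[of "Poly_Mapping.keys w"]) (auto simp: lk)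
          also have "\<dots> = bracket y (tot w) - b *\<^sub>C tot w"
            by (simp add: tot_def bracket_simps sum_subtractf cvec.scale_sum_right)
          finally show ?thesis by (simp add: w(2) b)
        qed
        ultimately have "w' = 0" using ind unfolding indep_fam_def by blast
        then show ?thesis using lk[of a] by auto
      qed
      moreover have "bracket x (Poly_Mapping.lookup w a) = a *\<^sub>C Poly_Mapping.lookup w a"
        using h_diagonalizable[OF x w(1)] .
      ultimately show ?thesis by auto
    qed
    then show ?thesis unfolding w(2)[symmetric] tot_def by (intro cvec.span_sum cvec.span_base)
  qed
  then have "cvec.span (?E Y) \<subseteq> cvec.span (?E (insert x Y))"
    by (intro cvec.span_minimal cvec.subspace_span) blast
  then show ?case using insert Y by auto
qed

end

lemma lin_map_eq_on_span:
  assumes "lin_map f" "lin_map g" "cvec.span S = UNIV" "\<And>x. x \<in> S \<Longrightarrow> f x = g x"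
  shows "f x = g x"
proof -
  have "x \<in> cvec.span S" using assms(3) by simp
  then show ?thesis
    by (induction rule: cvec.span_induct_alt)
      (simp_all add: lin_map_simps[OF assms(1)] lin_map_simps[OF assms(2)] assms(4))
qed

lemma fun_minus_minus [simp]: "- (- g) = (g :: 'a \<Rightarrow> complex)"
  by (simp add: fun_Compl_def)

section \<open>Weights and roots\<close>

context chevalley begin

lemma dual_spaceD:
  assumes "\<nu> \<in> dual_space h"
  shows "s \<in> h \<Longrightarrow> t \<in> h \<Longrightarrow> \<nu> (s + t) = \<nu> s + \<nu> t" "t \<in> h \<Longrightarrow> \<nu> (c *\<^sub>C t) = c * \<nu> t" "t \<notin> h \<Longrightarrow> \<nu> t = 0"
  using assms by (auto simp: dual_space_def)

lemma dual_space_eqI: "\<mu> \<in> dual_space h \<Longrightarrow> \<nu> \<in> dual_space h \<Longrightarrow> (\<And>t. t \<in> h \<Longrightarrow> \<mu> t = \<nu> t) \<Longrightarrow> \<mu> = \<nu>"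
  using dual_spaceD(3) by (metis ext)

lemma dual_space_add: "\<mu> \<in> dual_space h \<Longrightarrow> \<nu> \<in> dual_space h \<Longrightarrow> (\<lambda>t. \<mu> t + \<nu> t) \<in> dual_space h"
  and dual_space_scale: "\<mu> \<in> dual_space h \<Longrightarrow> (\<lambda>t. c * \<mu> t) \<in> dual_space h"
  and dual_space_zero: "(\<lambda>_. 0) \<in> dual_space h"
  by (auto simp: dual_space_def algebra_simps)

lemma dual_space_neg: "\<mu> \<in> dual_space h \<Longrightarrow> - \<mu> \<in> dual_space h"
  using dual_space_scale[of \<mu> "-1"] by (simp add: fun_Compl_def)

lemma root_spaceD: "v \<in> root_space h \<beta> \<Longrightarrow> t \<in> h \<Longrightarrow> bracket t v = \<beta> t *\<^sub>C v"
  by (simp add: root_space_def)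

lemma subspace_root_space: "cvec.subspace (root_space h \<beta>)"
  by (auto simp: cvec.subspace_def root_space_def bracket_simps cscale_add_right mult.commute)

lemma root_space_bracket:
  "v \<in> root_space h \<beta> \<Longrightarrow> w \<in> root_space h \<gamma> \<Longrightarrow> bracket v w \<in> root_space h (\<lambda>t. \<beta> t + \<gamma> t)"
  unfolding root_space_def mem_Collect_eq
proof
  fix t assume a: "\<forall>t\<in>h. bracket t v = \<beta> t *\<^sub>C v" "\<forall>t\<in>h. bracket t w = \<gamma> t *\<^sub>C w" "t \<in> h"
  then show "bracket t (bracket v w) = (\<beta> t + \<gamma> t) *\<^sub>C bracket v w"
    using jacobi_derivation[of t v w] by (simp add: bracket_simps cscale_add_left)
qed

lemma root_space_zero: "root_space h (\<lambda>_. 0) = h"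
  using h_centralizer h_abelian by (auto simp: root_space_def)

lemma joint_eigenvector_weight:
  assumes "\<forall>x\<in>X. \<exists>a. bracket x v = a *\<^sub>C v"
  shows "\<exists>\<beta>\<in>dual_space h. v \<in> root_space h \<beta>"
proof (cases "v = 0")
  case True
  then show ?thesis using dual_space_zero cvec.subspace_0[OF subspace_root_space] by blast
next
  case False
  have ex: "\<exists>a. bracket t v = a *\<^sub>C v" if "t \<in> h" for t
    using that unfolding X_facts(2)[symmetric]
  proof (induction rule: cvec.span_induct_alt)
    case base
    show ?case by (intro exI[of _ 0]) (simp add: bracket_simps)
  next
    case (step c x t)
    then obtain a b where "bracket x v = a *\<^sub>C v" "bracket t v = b *\<^sub>C v" using assms by blast
    then show ?case by (intro exI[of _ "c * a + b"]) (simp add: bracket_simps cscale_add_left)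
  qed
  define \<beta> where "\<beta> t = (if t \<in> h then SOME a. bracket t v = a *\<^sub>C v else 0)" for t
  have \<beta>: "bracket t v = \<beta> t *\<^sub>C v" if "t \<in> h" for t
    using someI_ex[OF ex[OF that]] that by (simp add: \<beta>_def)
  have inj: "a = b" if "a *\<^sub>C v = b *\<^sub>C v" for a b using that False by simp
  have "\<beta> \<in> dual_space h"
    unfolding dual_space_def
  proof (intro CollectI conjI ballI allI impI)
    fix s t assume st: "s \<in> h" "t \<in> h"
    show "\<beta> (s + t) = \<beta> s + \<beta> t"
      by (rule inj) (simp add: \<beta>[symmetric] st h_closed(2) bracket_simps cscale_add_left)
    fix c show "\<beta> (c *\<^sub>C t) = c * \<beta> t"
      by (rule inj) (simp add: \<beta>[symmetric] st h_closed(3) bracket_simps flip: cscale_assoc)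
  qed (simp add: \<beta>_def)
  then show ?thesis using \<beta> by (auto simp: root_space_def)
qed

text \<open>\<open>root_space\<close> looks only at the values of its argument on h. Functions
  differing outside h would repeat the same space and destroy independence of the family, so all but
  the canonically extended functionals get the zero space.\<close>

definition weight_space :: "('g \<Rightarrow> complex) \<Rightarrow> 'g set" where
  "weight_space \<beta> = (if \<beta> \<in> dual_space h then root_space h \<beta> else {0})"

lemma subspace_weight_space: "cvec.subspace (weight_space \<beta>)"
  by (simp add: weight_space_def subspace_root_space cvec.subspace_single_0)

lemma weight_span: "cvec.span (\<Union>\<beta>. weight_space \<beta>) = UNIV"
proof -
  have "X \<subseteq> h" using X_h by blast
  from joint_eigenvectors_span[OF finite_X this]
  have "cvec.span {v. \<forall>x\<in>X. \<exists>a. bracket x v = a *\<^sub>C v} = UNIV" .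
  moreover have "{v. \<forall>x\<in>X. \<exists>a. bracket x v = a *\<^sub>C v} \<subseteq> (\<Union>\<beta>. weight_space \<beta>)"
    using joint_eigenvector_weight by (fastforce simp: weight_space_def)
  ultimately show ?thesis using cvec.span_mono by blast
qed

lemma weight_indep: "indep_fam weight_space"
proof (rule indep_famI)
  fix \<beta> \<gamma> :: "'g \<Rightarrow> complex" assume ne: "\<beta> \<noteq> \<gamma>"
  consider "\<gamma> \<notin> dual_space h" | "\<beta> \<notin> dual_space h" | "\<beta> \<in> dual_space h" "\<gamma> \<in> dual_space h" by blast
  then show "\<exists>T. lin_map T \<and> (\<forall>l. T ` weight_space l \<subseteq> weight_space l) \<and>
      (\<forall>v\<in>weight_space \<gamma>. \<exists>n. (T ^^ n) v = 0) \<and> (\<forall>v\<in>weight_space \<beta>. T v = 0 \<longrightarrow> v = 0)"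
  proof cases
    case 1
    then show ?thesis by (intro exI[of _ id]) (auto simp: lin_map_id weight_space_def intro: exI[of _ 0])
  next
    case 2
    then show ?thesis using cvec.subspace_0[OF subspace_root_space]
      by (intro exI[of _ "\<lambda>_. 0"]) (auto simp: lin_mapI weight_space_def intro: exI[of _ "Suc 0"])
  next
    case 3
    then obtain t where t: "t \<in> h" "\<beta> t \<noteq> \<gamma> t" using dual_space_eqI ne by blast
    let ?T = "\<lambda>w. bracket t w - \<gamma> t *\<^sub>C w"
    have Tv: "?T v = (\<delta> t - \<gamma> t) *\<^sub>C v" if "v \<in> weight_space \<delta>" for \<delta> v
      using that t by (auto simp: weight_space_def root_space_def cvec.scale_left_diff_distrib bracket_simps split: if_splits)
    have "?T ` weight_space l \<subseteq> weight_space l" for l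
      using Tv[of _ l] cvec.subspace_scale[OF subspace_weight_space] by auto
    moreover have "\<exists>n. (?T ^^ n) v = 0" if "v \<in> weight_space \<gamma>" for v
      using Tv[OF that] by (intro exI[of _ "Suc 0"]) simp
    moreover have "v = 0" if "v \<in> weight_space \<beta>" "?T v = 0" for v
      using Tv[OF that(1)] that(2) t by simp
    ultimately show ?thesis
      by (intro exI[of _ ?T] conjI lin_map_shift[OF lin_map_bracket_right]) auto
  qed
qed

lemma finite_weights: "finite {\<beta> \<in> dual_space h. root_space h \<beta> \<noteq> {0}}"
proof -
  let ?D = "{\<beta> \<in> dual_space h. root_space h \<beta> \<noteq> {0}}"
  have "\<exists>w. w \<in> root_space h \<beta> \<and> w \<noteq> 0" if "\<beta> \<in> ?D" for \<beta>
    using that cvec.subspace_0[OF subspace_root_space] by blast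
  then obtain v where v: "\<And>\<beta>. \<beta> \<in> ?D \<Longrightarrow> v \<beta> \<in> root_space h \<beta> \<and> v \<beta> \<noteq> 0" by metis
  have zero: "\<forall>\<beta>\<in>I. c \<beta> = 0" if "finite I" "I \<subseteq> ?D" "(\<Sum>\<beta>\<in>I. c \<beta> *\<^sub>C v \<beta>) = 0" for I c
  proof -
    define w where "w = (\<Sum>\<beta>\<in>I. Poly_Mapping.single \<beta> (c \<beta> *\<^sub>C v \<beta>))"
    have lk: "Poly_Mapping.lookup w \<beta> = (if \<beta> \<in> I then c \<beta> *\<^sub>C v \<beta> else 0)" for \<beta>
      using that(1) by (simp add: w_def lookup_sum lookup_single when_def sum.delta)
    have "Poly_Mapping.keys w \<subseteq> I" by (auto simp: in_keys_iff lk split: if_splits)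
    then have "tot w = 0" using that by (simp add: tot_superset[of I] lk)
    moreover have "Poly_Mapping.lookup w \<beta> \<in> weight_space \<beta>" for \<beta>
    proof (cases "\<beta> \<in> I")
      case True
      then have "\<beta> \<in> ?D" using that(2) by blast
      then show ?thesis using v[of \<beta>] True by (simp add: lk weight_space_def cvec.subspace_scale[OF subspace_root_space])
    qed (simp add: lk cvec.subspace_0[OF subspace_weight_space])
    ultimately have "w = 0" using weight_indep unfolding indep_fam_def by blast
    then show ?thesis using lk v that(2) by (metis (no_types, lifting) cvec.scale_eq_0_iff lookup_zero subsetD)
  qed
  have inj: "inj_on v ?D"
  proof (rule inj_onI, rule ccontr)
    fix \<beta> \<gamma> assume a: "\<beta> \<in> ?D" "\<gamma> \<in> ?D" "v \<beta> = v \<gamma>" "\<beta> \<noteq> \<gamma>"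
    then have "(\<Sum>\<delta>\<in>{\<beta>, \<gamma>}. (if \<delta> = \<beta> then 1 else -1) *\<^sub>C v \<delta>) = 0" by simp
    from zero[OF _ _ this] a show False by auto
  qed
  have "cvec.independent (v ` ?D)"
    unfolding cvec.independent_explicit_finite_subsets
  proof (intro allI impI ballI)
    fix S c w assume S: "S \<subseteq> v ` ?D" "finite S" "(\<Sum>w\<in>S. c w *\<^sub>C w) = 0" "w \<in> S"
    obtain I where I: "I \<subseteq> ?D" "S = v ` I" using S(1) unfolding subset_image_iff by blast
    have injI: "inj_on v I" using inj I(1) inj_on_subset by blast
    then have fI: "finite I" using S(2) I(2) finite_imageD by blast
    have "(\<Sum>\<beta>\<in>I. c (v \<beta>) *\<^sub>C v \<beta>) = 0" using S(3) I(2) injI by (simp add: sum.reindex)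
    from zero[OF fI I(1) this] show "c w = 0" using S(4) I(2) by blast
  qed
  then have "finite (v ` ?D)" by (rule fin_dim_independent[OF fd])
  then show ?thesis using inj finite_imageD by blast
qed

lemma finite_roots: "finite (roots h)"
  using finite_weights by (rule finite_subset[rotated]) (auto simp: roots_def)

lemma root_dual: "\<alpha> \<in> roots h \<Longrightarrow> \<alpha> \<in> dual_space h" and root_nonzero: "\<alpha> \<in> roots h \<Longrightarrow> \<exists>t\<in>h. \<alpha> t \<noteq> 0"
  using dual_spaceD(3) by (fastforce simp: roots_def)+

text \<open>\<sigma> maps the root space of \<alpha> into that of -\<alpha>.\<close>

lemma root_uminus: assumes "\<alpha> \<in> roots h" shows "- \<alpha> \<in> roots h"
proof -
  obtain v where v: "v \<in> root_space h \<alpha>" "v \<noteq> 0"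
    using assms cvec.subspace_0[OF subspace_root_space] by (auto simp: roots_def)
  have "\<sigma> v \<in> root_space h (- \<alpha>)"
    unfolding root_space_def
  proof (intro CollectI ballI)
    fix t assume t: "t \<in> h"
    have "bracket t (\<sigma> v) = \<sigma> (bracket (- t) v)"
      using t h_closed(4)[OF t] by (simp add: \<sigma>_bracket \<sigma>_h)
    also have "\<dots> = (- \<alpha>) t *\<^sub>C \<sigma> v"
      using root_spaceD[OF v(1) t] by (simp add: bracket_simps lin_map_simps[OF \<sigma>_lin])
    finally show "bracket t (\<sigma> v) = (- \<alpha>) t *\<^sub>C \<sigma> v" .
  qed
  moreover have "\<sigma> v \<noteq> 0" using v(2) \<sigma>_\<sigma>[of v] lin_map_zero[OF \<sigma>_lin] by metis
  moreover have "- \<alpha> \<noteq> (\<lambda>_. 0)" using root_nonzero[OF assms] by (auto simp: fun_eq_iff)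
  ultimately show ?thesis using assms dual_space_neg by (auto simp: roots_def)
qed

lemma t_dual:
  assumes "\<nu> \<in> dual_space h" shows "t_dual h \<nu> \<in> h" "s \<in> h \<Longrightarrow> killing (t_dual h \<nu>) s = \<nu> s"
proof -
  have sum: "\<nu> (\<Sum>x\<in>Y. c x *\<^sub>C x) = (\<Sum>x\<in>Y. c x * \<nu> x)" if "finite Y" "Y \<subseteq> X" for Y c
    using that
  proof (induction Y rule: finite_induct)
    case empty
    then show ?case using dual_spaceD(2)[OF assms h_closed(1), of 0] by simp
  next
    case (insert x Y)
    have "(\<Sum>x\<in>Y. c x *\<^sub>C x) \<in> h" using insert X_h by (intro h_closed(6) h_closed(3)) auto
    then show ?case using insert X_h h_closed(3) by (simp add: dual_spaceD[OF assms])
  qed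
  \<comment> \<open>The representing vector has the coordinates \<nu> x in the orthonormal
    basis.\<close>
  let ?t = "\<Sum>x\<in>X. \<nu> x *\<^sub>C x"
  have t: "?t \<in> h" using X_h by (intro h_closed(6) h_closed(3))
  have k: "\<nu> s = killing ?t s" if "s \<in> h" for s
  proof -
    have "\<nu> s = (\<Sum>x\<in>X. killing x s * \<nu> x)"
      using sum[OF finite_X order_refl, of "\<lambda>x. killing x s"] h_expand[OF that] by simp
    then show ?thesis by (simp add: killing_simps cscale_complex_def mult.commute)
  qed
  have "\<exists>!t. t \<in> h \<and> (\<forall>s\<in>h. \<nu> s = killing t s)"
  proof (rule ex1I[of _ ?t])
    fix t' assume t': "t' \<in> h \<and> (\<forall>s\<in>h. \<nu> s = killing t' s)"
    then have "t' - ?t = 0" using t k by (intro h_nondeg h_closed(5)) (auto simp: killing_diff)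
    then show "t' = ?t" by simp
  qed (use t k in auto)
  from theI'[OF this] show "t_dual h \<nu> \<in> h" "s \<in> h \<Longrightarrow> killing (t_dual h \<nu>) s = \<nu> s"
    by (auto simp: t_dual_def)
qed

lemma killing_root_spaces:
  assumes "v \<in> root_space h \<beta>" "w \<in> root_space h \<gamma>" "t \<in> h" "\<beta> t + \<gamma> t \<noteq> 0"
  shows "killing v w = 0"
proof -
  have "killing (bracket v t) w = killing v (bracket t w)" by (rule killing_inv)
  moreover have "bracket v t = - (\<beta> t *\<^sub>C v)" using bracket_anti[of v t] root_spaceD[OF assms(1,3)] by simp
  ultimately have "\<gamma> t * killing v w = - (\<beta> t * killing v w)"
    using root_spaceD[OF assms(2,3)] by (simp add: killing_simps cscale_complex_def)
  then have "(\<beta> t + \<gamma> t) * killing v w = 0" by (simp add: distrib_right)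
  then show ?thesis using assms(4) by simp
qed

lemma ad_power_weight:
  assumes "x \<in> root_space h \<alpha>" "v \<in> root_space h \<beta>"
  shows "(bracket x ^^ n) v \<in> root_space h (\<lambda>t. \<beta> t + of_nat n * \<alpha> t)"
proof (induction n)
  case (Suc n)
  then show ?case using root_space_bracket[OF assms(1) Suc] by (simp add: algebra_simps)
qed (simp add: assms)

text \<open>The functionals \<beta> + n \<alpha> are pairwise different, and only finitely many
  weights occur.\<close>

lemma ad_power_zero:
  assumes \<alpha>: "\<alpha> \<in> dual_space h" "t \<in> h" "\<alpha> t \<noteq> 0" and x: "x \<in> root_space h \<alpha>"
    and \<beta>: "\<beta> \<in> dual_space h" and v: "v \<in> root_space h \<beta>"
  shows "\<exists>n. (bracket x ^^ n) v = 0"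
proof (rule ccontr)
  assume nz: "\<nexists>n. (bracket x ^^ n) v = 0"
  let ?w = "\<lambda>n s. \<beta> s + of_nat n * \<alpha> s"
  have "?w n \<in> {\<beta> \<in> dual_space h. root_space h \<beta> \<noteq> {0}}" for n :: nat
    using ad_power_weight[OF x v, of n] nz dual_space_add[OF \<beta> dual_space_scale[OF \<alpha>(1)]] by fastforce
  then have "finite (range ?w)" using finite_weights by (meson finite_subset image_subsetI)
  moreover have "inj ?w"
  proof (rule injI)
    fix m n assume "?w m = ?w n"
    then have "?w m t = ?w n t" by metis
    then show "m = n" using \<alpha>(3) by simp
  qed
  ultimately show False using finite_imageD by blast
qed

text \<open>The sl2 string computation without normalizing \<alpha> on t = [e, f]; even the value 0
  is allowed. If e^(m+1) v is the first vanishing power, applying f to it gives (m + 1) (\<beta>(t)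
  + m/2 \<alpha>(t)) = 0.\<close>

lemma lowest_vector:
  assumes \<alpha>: "\<alpha> \<in> dual_space h" "s \<in> h" "\<alpha> s \<noteq> 0" and e: "e \<in> root_space h \<alpha>"
    and t: "bracket e f \<in> h" and \<beta>: "\<beta> \<in> dual_space h"
    and v: "v \<in> root_space h \<beta>" "v \<noteq> 0" "bracket f v = 0"
  shows "\<exists>n. 2 * \<beta> (bracket e f) + of_nat n * \<alpha> (bracket e f) = 0"
proof -
  let ?t = "bracket e f" and ?w = "\<lambda>n. (bracket e ^^ n) v"
  have rec: "bracket f (?w (Suc n)) = - ((of_nat (Suc n) * \<beta> ?t + of_nat (Suc n) * of_nat n / 2 * \<alpha> ?t) *\<^sub>C ?w n)" for n
  proof (induction n)
    case 0
    have "bracket f (bracket e v) = bracket (bracket f e) v + bracket e (bracket f v)" by (rule jacobi_derivation)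
    then show ?case using root_spaceD[OF v(1) t] bracket_anti[of f e] v(3) by (simp add: bracket_simps)
  next
    case (Suc n)
    have "bracket f (?w (Suc (Suc n))) = bracket (bracket f e) (?w (Suc n)) + bracket e (bracket f (?w (Suc n)))"
      using jacobi_derivation[of f e "?w (Suc n)"] by simp
    also have "bracket (bracket f e) (?w (Suc n)) = - ((\<beta> ?t + of_nat (Suc n) * \<alpha> ?t) *\<^sub>C ?w (Suc n))"
      using root_spaceD[OF ad_power_weight[OF e v(1), of "Suc n"] t] bracket_anti[of f e] by (simp only: bracket_simps)
    also have "bracket e (bracket f (?w (Suc n))) = - ((of_nat (Suc n) * \<beta> ?t + of_nat (Suc n) * of_nat n / 2 * \<alpha> ?t) *\<^sub>C ?w (Suc n))"
      unfolding Suc by (simp add: bracket_simps)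
    also have "- ((\<beta> ?t + of_nat (Suc n) * \<alpha> ?t) *\<^sub>C ?w (Suc n)) + \<dots> = 
       - (((\<beta> ?t + of_nat (Suc n) * \<alpha> ?t) + (of_nat (Suc n) * \<beta> ?t + of_nat (Suc n) * of_nat n / 2 * \<alpha> ?t)) *\<^sub>C ?w (Suc n))"
      by (simp only: cscale_add_left) simp
    also have "(\<beta> ?t + of_nat (Suc n) * \<alpha> ?t) + (of_nat (Suc n) * \<beta> ?t + of_nat (Suc n) * of_nat n / 2 * \<alpha> ?t)
      = of_nat (Suc (Suc n)) * \<beta> ?t + of_nat (Suc (Suc n)) * of_nat (Suc n) / 2 * \<alpha> ?t"
      by (simp add: field_simps)
    finally show ?case .
  qed
  obtain n where n: "?w n = 0" "\<And>m. m < n \<Longrightarrow> ?w m \<noteq> 0"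
    using ad_power_zero[OF \<alpha> e \<beta> v(1)] exists_least_iff[of "\<lambda>n. ?w n = 0"] by auto
  then obtain m where m: "n = Suc m" using v(2) by (cases n) auto
  have "(of_nat (Suc m) * \<beta> ?t + of_nat (Suc m) * of_nat m / 2 * \<alpha> ?t) *\<^sub>C ?w m = 0"
    using rec[of m] n(1) m by (simp add: bracket_simps)
  then have "of_nat (Suc m) * \<beta> ?t + of_nat (Suc m) * of_nat m / 2 * \<alpha> ?t = 0"
    using n(2)[of m] m cvec.scale_eq_0_iff by blast
  then have "of_nat (Suc m) * (\<beta> ?t + of_nat m / 2 * \<alpha> ?t) = 0" by (simp add: algebra_simps)
  then have "\<beta> ?t + of_nat m / 2 * \<alpha> ?t = 0" using of_nat_neq_0 mult_eq_0_iff by blast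
  then have "2 * \<beta> ?t + of_nat m * \<alpha> ?t = 0" by (simp add: field_simps)
  then show ?thesis by blast
qed

end

section \<open>Dual bases and the projection onto the fixed point subalgebra\<close>

locale chevalley_basis = chevalley h \<sigma> X
  for h :: "'g::complex_lie_algebra set" and \<sigma> :: "'g \<Rightarrow> 'g" and X :: "'g set" +
  fixes Rp :: "('g \<Rightarrow> complex) set" and e :: "('g \<Rightarrow> complex) \<Rightarrow> 'g" and y :: 'g
  assumes pos: "positive_system (roots h) Rp"
    and root_vectors: "\<forall>\<alpha>\<in>roots h. e \<alpha> \<in> root_space h \<alpha> \<and>
          bracket (e \<alpha>) (e (- \<alpha>)) = t_dual h \<alpha> \<and> \<sigma> (e \<alpha>) = - e (- \<alpha>)"
    and y: "y \<in> h"
begin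

section \<open>Normalized root vectors and one-dimensional root spaces\<close>

lemma e_root_space: "\<alpha> \<in> roots h \<Longrightarrow> e \<alpha> \<in> root_space h \<alpha>"
  and e_bracket: "\<alpha> \<in> roots h \<Longrightarrow> bracket (e \<alpha>) (e (- \<alpha>)) = t_dual h \<alpha>"
  and \<sigma>_e: "\<alpha> \<in> roots h \<Longrightarrow> \<sigma> (e \<alpha>) = - e (- \<alpha>)"
  using root_vectors by auto

text \<open>The value 1 is forced by [e_\<alpha>, e_-\<alpha>] = t_\<alpha>: pairing with t and
  using invariance gives \<alpha>(t) = \<alpha>(t) K(e_\<alpha>, e_-\<alpha>).\<close>

lemma killing_e: 
  assumes "\<alpha> \<in> roots h" shows "killing (e \<alpha>) (e (- \<alpha>)) = 1"
proof -
  obtain t where t: "t \<in> h" "\<alpha> t \<noteq> 0" using root_nonzero[OF assms] by blast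
  have "\<alpha> t = killing (bracket (e \<alpha>) (e (- \<alpha>))) t"
    using t_dual(2)[OF root_dual[OF assms] t(1)] e_bracket[OF assms] by simp
  also have "\<dots> = killing (e \<alpha>) (bracket (e (- \<alpha>)) t)" by (rule killing_inv)
  also have "bracket (e (- \<alpha>)) t = \<alpha> t *\<^sub>C e (- \<alpha>)"
    using bracket_anti[of "e (- \<alpha>)" t] root_spaceD[OF e_root_space[OF root_uminus[OF assms]] t(1)] by simp
  finally show ?thesis using t(2) by (simp add: killing_simps cscale_complex_def)
qed

lemma killing_e_other:
  assumes "\<alpha> \<in> roots h" "\<beta> \<in> roots h" "\<beta> \<noteq> - \<alpha>" shows "killing (e \<alpha>) (e \<beta>) = 0"
proof -
  have "\<exists>t\<in>h. \<beta> t \<noteq> (- \<alpha>) t"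
    using dual_space_eqI[OF root_dual[OF assms(2)] dual_space_neg[OF root_dual[OF assms(1)]]] assms(3) by blast
  then obtain t where "t \<in> h" "\<alpha> t + \<beta> t \<noteq> 0" by (auto simp: add_eq_0_iff)
  then show ?thesis using killing_root_spaces[OF e_root_space[OF assms(1)] e_root_space[OF assms(2)]] by blast
qed

lemma killing_h_root:
  assumes "\<alpha> \<in> roots h" "s \<in> h" "v \<in> root_space h \<alpha>" shows "killing s v = 0"
proof -
  obtain t where t: "t \<in> h" "\<alpha> t \<noteq> 0" using root_nonzero[OF assms(1)] by blast
  show ?thesis using killing_root_spaces[of s "\<lambda>_. 0" v \<alpha> t] assms t root_space_zero by simp
qed

text \<open>If \<alpha> vanished on t_\<alpha>, then by \<open>lowest_vector\<close> every weight
  would vanish there. So t_\<alpha> would be central, hence zero by simplicity, contradicting that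
  \<alpha> is nonzero.\<close>

lemma t_dual_nonisotropic:
  assumes \<alpha>: "\<alpha> \<in> roots h" shows "\<alpha> (t_dual h \<alpha>) \<noteq> 0"
proof
  assume iso: "\<alpha> (t_dual h \<alpha>) = 0"
  let ?t = "t_dual h \<alpha>" and ?f = "e (- \<alpha>)"
  obtain s where s: "s \<in> h" "\<alpha> s \<noteq> 0" using root_nonzero[OF \<alpha>] by blast
  note ad = root_dual[OF \<alpha>] and nad = root_dual[OF root_uminus[OF \<alpha>]]
  have th: "?t \<in> h" using t_dual(1)[OF ad] .
  have zero: "\<beta> ?t = 0" if \<beta>: "\<beta> \<in> dual_space h" and v: "v \<in> root_space h \<beta>" "v \<noteq> 0" for \<beta> v
  proof -
    have "(- \<alpha>) s \<noteq> 0" using s by simp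
    from ad_power_zero[OF nad s(1) this e_root_space[OF root_uminus[OF \<alpha>]] \<beta> v(1)]
    obtain n where n: "(bracket ?f ^^ n) v = 0" "\<And>m. m < n \<Longrightarrow> (bracket ?f ^^ m) v \<noteq> 0"
      using exists_least_iff[of "\<lambda>n. (bracket ?f ^^ n) v = 0"] by auto
    then obtain m where m: "n = Suc m" using v(2) by (cases n) auto
    \<comment> \<open>The last nonvanishing power of f gives a lowest vector; its weight \<beta> - m
      \<alpha> agrees with \<beta> on t_\<alpha>.\<close>
    let ?v = "(bracket ?f ^^ m) v" and ?\<gamma> = "\<lambda>t. \<beta> t + of_nat m * (- \<alpha>) t"
    have 1: "?v \<in> root_space h ?\<gamma>" by (rule ad_power_weight[OF e_root_space[OF root_uminus[OF \<alpha>]] v(1)])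
    have 2: "?v \<noteq> 0" "bracket ?f ?v = 0" using n m by auto
    have 3: "?\<gamma> \<in> dual_space h" by (rule dual_space_add[OF \<beta> dual_space_scale[OF nad]])
    have 4: "bracket (e \<alpha>) ?f \<in> h" using th e_bracket[OF \<alpha>] by simp
    from lowest_vector[OF ad s e_root_space[OF \<alpha>] 4 3 1 2]
    obtain k :: nat where "2 * ?\<gamma> (bracket (e \<alpha>) ?f) + of_nat k * \<alpha> (bracket (e \<alpha>) ?f) = 0" by blast
    then show ?thesis using iso e_bracket[OF \<alpha>] by simp
  qed
  have "bracket ?t v = 0" for v
  proof (rule lin_map_eq_on_span[OF lin_map_bracket_right _ weight_span])
    show "lin_map (\<lambda>_. 0 :: 'g)" by (simp add: lin_mapI)
    fix v assume "v \<in> (\<Union>\<beta>. weight_space \<beta>)"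
    then obtain \<beta> where "v \<in> weight_space \<beta>" by blast
    then show "bracket ?t v = 0"
      using zero[of \<beta> v] root_spaceD[of v \<beta>, OF _ th] by (cases "v = 0") (auto simp: weight_space_def bracket_simps split: if_splits)
  qed
  then have "bracket v (c *\<^sub>C ?t) = 0" for v c using bracket_anti[of v ?t] by (simp add: bracket_simps)
  then have "?t = 0" by (rule null_vector[OF simple])
  then show False using t_dual(2)[OF ad s(1)] s(2) by (simp add: killing_zero)
qed

text \<open>Subtracting the multiple of e_\<alpha> leaves w orthogonal to f = e_-\<alpha>. Then
  [f, w] lies in h and is orthogonal to h, so w is a lowest vector of weight \<alpha>, and (n + 2)
  \<alpha>(t_\<alpha>) = 0 would follow.\<close>

lemma root_space_line:
  assumes \<alpha>: "\<alpha> \<in> roots h" and v: "v \<in> root_space h \<alpha>"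
  shows "v = killing (e (- \<alpha>)) v *\<^sub>C e \<alpha>"
proof (rule ccontr)
  let ?f = "e (- \<alpha>)" and ?t = "t_dual h \<alpha>"
  let ?w = "v - killing ?f v *\<^sub>C e \<alpha>"
  assume "v \<noteq> killing ?f v *\<^sub>C e \<alpha>"
  then have nz: "?w \<noteq> 0" by simp
  obtain s where s: "s \<in> h" "\<alpha> s \<noteq> 0" using root_nonzero[OF \<alpha>] by blast
  note ad = root_dual[OF \<alpha>]
  have w: "?w \<in> root_space h \<alpha>"
    by (intro cvec.subspace_diff cvec.subspace_scale subspace_root_space v e_root_space \<alpha>)
  have kw: "killing ?f ?w = 0"
    using killing_e[OF \<alpha>] killing_sym[of ?f "e \<alpha>"] killing_sym[of ?f ?w] killing_sym[of v ?f]
    by (simp add: killing_diff killing_simps cscale_complex_def)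
  have "bracket ?f ?w \<in> root_space h (\<lambda>t. (- \<alpha>) t + \<alpha> t)"
    by (rule root_space_bracket[OF e_root_space[OF root_uminus[OF \<alpha>]] w])
  then have bh: "bracket ?f ?w \<in> h" by (simp add: root_space_zero)
  have "bracket ?f ?w = 0"
  proof (rule h_nondeg[OF bh])
    fix t assume t: "t \<in> h"
    have "killing (bracket ?f ?w) t = killing ?f (bracket ?w t)" by (rule killing_inv)
    also have "bracket ?w t = - (\<alpha> t *\<^sub>C ?w)" by (subst bracket_anti) (simp only: root_spaceD[OF w t])
    finally show "killing (bracket ?f ?w) t = 0" by (simp only: killing_simps kw) (simp add: cscale_complex_def)
  qed
  from lowest_vector[OF ad s e_root_space[OF \<alpha>] _ ad w nz this] t_dual(1)[OF ad]
  obtain n where "2 * \<alpha> ?t + of_nat n * \<alpha> ?t = (0 :: complex)" by (auto simp: e_bracket[OF \<alpha>])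
  then have "of_nat (n + 2) * \<alpha> ?t = (0 :: complex)" by (simp add: algebra_simps)
  then show False using t_dual_nonisotropic[OF \<alpha>] by (simp only: mult_eq_0_iff of_nat_eq_0_iff) simp
qed

lemma basis_span: "cvec.span (h \<union> e ` roots h) = UNIV"
proof -
  have "v \<in> cvec.span (h \<union> e ` roots h)" if vw: "v \<in> weight_space \<beta>" for v \<beta>
  proof -
    consider "v = 0" | "\<beta> = (\<lambda>_. 0)" "v \<in> h" | "\<beta> \<in> roots h" "v \<in> root_space h \<beta>"
    proof (cases "v = 0 \<or> \<beta> = (\<lambda>_. 0)")
      case True
      then show ?thesis using that vw root_space_zero dual_space_zero by (auto simp: weight_space_def)
    next
      case False
      then have "\<beta> \<in> dual_space h" "v \<in> root_space h \<beta>" using vw by (auto simp: weight_space_def split: if_splits)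
      then have "\<beta> \<in> roots h" using False by (auto simp: roots_def)
      then show ?thesis using \<open>v \<in> root_space h \<beta>\<close> that by blast
    qed
    then show ?thesis
    proof cases
      case 1
      then show ?thesis using cvec.span_zero by blast
    next
      case 2
      then show ?thesis using cvec.span_base by blast
    next
      case 3
      have "e \<beta> \<in> cvec.span (h \<union> e ` roots h)" using 3(1) by (intro cvec.span_base) blast
      then show ?thesis by (subst root_space_line[OF 3]) (rule cvec.span_scale)
    qed
  qed
  then have "cvec.span (\<Union>\<beta>. weight_space \<beta>) \<subseteq> cvec.span (h \<union> e ` roots h)"
    by (intro cvec.span_minimal cvec.subspace_span) blast
  then show ?thesis using weight_span by auto
qed

text \<open>\<open>Ad_torus\<close> is a definite description, so its properties rest on unique
  existence. The scalars exp (\<beta> y) define a homomorphism because weights add under the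
  bracket; exp (-\<beta> y) gives the inverse.\<close>

lemma Ad_torus_ex1:
  "\<exists>!f. lie_automorphism f \<and> (\<forall>t\<in>h. f t = t) \<and> (\<forall>\<alpha>\<in>roots h. \<forall>x\<in>root_space h \<alpha>. f x = exp (\<alpha> y) *\<^sub>C x)"
proof -
  note fs = family_scaling[OF subspace_weight_space weight_span weight_indep]
  obtain f where f: "lin_map f" "\<And>\<beta> v. v \<in> weight_space \<beta> \<Longrightarrow> f v = exp (\<beta> y) *\<^sub>C v"
    using fs[of "\<lambda>\<beta>. exp (\<beta> y)"] by blast
  obtain g where g: "lin_map g" "\<And>\<beta> v. v \<in> weight_space \<beta> \<Longrightarrow> g v = exp (- \<beta> y) *\<^sub>C v"
    using fs[of "\<lambda>\<beta>. exp (- \<beta> y)"] by blast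
  have "f (g v) = v" for v
    by (rule lin_map_eq_on_span[where f = "\<lambda>v. f (g v)", OF lin_map_comp[OF f(1) g(1), unfolded comp_def] lin_map_id(2) weight_span])
      (auto simp: f(2) g(2) lin_map_scale[OF f(1)] exp_minus)
  moreover have "g (f v) = v" for v
    by (rule lin_map_eq_on_span[where f = "\<lambda>v. g (f v)", OF lin_map_comp[OF g(1) f(1), unfolded comp_def] lin_map_id(2) weight_span])
      (auto simp: f(2) g(2) lin_map_scale[OF g(1)] exp_minus)
  ultimately have bij: "bij f" by (metis bijI')
  have br: "f (bracket v w) = bracket (f v) (f w)" for v w
  proof (rule span_extend2[OF weight_span, where f = "\<lambda>v w. f (bracket v w)" and g = "\<lambda>v w. bracket (f v) (f w)"])
    show "bilin (\<lambda>v w. f (bracket v w))"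
      by (auto intro!: bilinI lin_mapI simp: lin_map_simps[OF f(1)] bracket_simps)
    show "bilin (\<lambda>v w. bracket (f v) (f w))" by (rule bilin_bracket[OF f(1) f(1)])
    fix v w assume "v \<in> (\<Union>\<beta>. weight_space \<beta>)" "w \<in> (\<Union>\<beta>. weight_space \<beta>)"
    then obtain \<beta> \<gamma> where vw: "v \<in> weight_space \<beta>" "w \<in> weight_space \<gamma>" by blast
    show "f (bracket v w) = bracket (f v) (f w)"
    proof (cases "v = 0 \<or> w = 0")
      case True
      then show ?thesis by (auto simp: bracket_simps lin_map_zero[OF f(1)])
    next
      case False
      then have d: "\<beta> \<in> dual_space h" "\<gamma> \<in> dual_space h" using vw by (auto simp: weight_space_def split: if_splits)
      have "bracket v w \<in> weight_space (\<lambda>t. \<beta> t + \<gamma> t)"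
        using vw d root_space_bracket dual_space_add[OF d] by (auto simp: weight_space_def)
      from f(2)[OF this] show ?thesis by (simp add: f(2)[OF vw(1)] f(2)[OF vw(2)] bracket_simps exp_add)
    qed
  qed
  have "f t = t" if "t \<in> h" for t
    using f(2)[of t "\<lambda>_. 0"] that by (simp add: weight_space_def dual_space_zero root_space_zero)
  moreover have "f x = exp (\<alpha> y) *\<^sub>C x" if "\<alpha> \<in> roots h" "x \<in> root_space h \<alpha>" for \<alpha> x
    using f(2)[of x \<alpha>] that root_dual by (simp add: weight_space_def)
  ultimately show ?thesis
  proof (intro ex1I[of _ f])
    fix f' assume f': "lie_automorphism f' \<and> (\<forall>t\<in>h. f' t = t) \<and> (\<forall>\<alpha>\<in>roots h. \<forall>x\<in>root_space h \<alpha>. f' x = exp (\<alpha> y) *\<^sub>C x)"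
    show "f' = f"
    proof
      fix v show "f' v = f v"
        by (rule lin_map_eq_on_span[OF _ f(1) basis_span])
          (use f' \<open>\<And>t. t \<in> h \<Longrightarrow> f t = t\<close> \<open>\<And>x \<alpha>. \<alpha> \<in> roots h \<Longrightarrow> x \<in> root_space h \<alpha> \<Longrightarrow> f x = exp (\<alpha> y) *\<^sub>C x\<close>
            e_root_space in \<open>auto simp: lie_automorphism_def\<close>)
    qed
  qed (auto simp: lie_automorphism_def f(1) bij br)
qed

section \<open>The twisted involution, its fixed points and dual bases\<close>

definition \<tau> :: "'g \<Rightarrow> 'g" where "\<tau> = \<sigma> \<circ> Ad_torus h y"

lemma Ad_torus: "lie_automorphism (Ad_torus h y)" "t \<in> h \<Longrightarrow> Ad_torus h y t = t"
  "\<alpha> \<in> roots h \<Longrightarrow> Ad_torus h y (e \<alpha>) = exp (\<alpha> y) *\<^sub>C e \<alpha>"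
  using theI'[OF Ad_torus_ex1] e_root_space unfolding Ad_torus_def by blast+

lemma \<tau>_lin: "lin_map \<tau>" and \<tau>_bracket: "\<tau> (bracket v w) = bracket (\<tau> v) (\<tau> w)"
  using Ad_torus(1) \<sigma>_lin \<sigma>_bracket by (auto simp: \<tau>_def lie_automorphism_def intro: lin_map_comp)

lemma \<tau>_h: "t \<in> h \<Longrightarrow> \<tau> t = - t" and \<tau>_e: "\<alpha> \<in> roots h \<Longrightarrow> \<tau> (e \<alpha>) = - (exp (\<alpha> y) *\<^sub>C e (- \<alpha>))"
  by (simp_all add: \<tau>_def Ad_torus \<sigma>_h \<sigma>_e lin_map_simps[OF \<sigma>_lin])

definition k :: "'g set" where "k = {x. \<tau> x = x}"

lemma lie_subalgebra_k: "lie_subalgebra k"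
  by (auto simp: lie_subalgebra_def k_def cvec.subspace_def lin_map_simps[OF \<tau>_lin] \<tau>_bracket)

text \<open>The disjoint sum indexes the basis formed by \<open>X\<close> and the root vectors.
  \<open>X\<close> is its own dual basis, and by \<open>killing_e\<close> the vector dual to e
  \<alpha> is e (-\<alpha>).\<close>

definition J :: "('g + ('g \<Rightarrow> complex)) set" where "J = X <+> roots h"
definition u :: "'g + ('g \<Rightarrow> complex) \<Rightarrow> 'g" where "u = case_sum id e"
definition u' :: "'g + ('g \<Rightarrow> complex) \<Rightarrow> 'g" where "u' = case_sum id (\<lambda>\<alpha>. e (- \<alpha>))"

lemma sum_J: "(\<Sum>a\<in>J. F (u a) (u' a)) = (\<Sum>x\<in>X. F x x) + (\<Sum>\<alpha>\<in>roots h. F (e \<alpha>) (e (- \<alpha>)))"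
  unfolding J_def by (subst sum.Plus[OF finite_X finite_roots]) (simp add: u_def u'_def)

lemma Rp_roots: "\<alpha> \<in> Rp \<Longrightarrow> \<alpha> \<in> roots h" and Rp_neg: "\<alpha> \<in> roots h \<Longrightarrow> \<alpha> \<in> Rp \<longleftrightarrow> - \<alpha> \<notin> Rp"
  and Rp_add: "\<alpha> \<in> Rp \<Longrightarrow> \<beta> \<in> Rp \<Longrightarrow> (\<lambda>t. \<alpha> t + \<beta> t) \<in> roots h \<Longrightarrow> (\<lambda>t. \<alpha> t + \<beta> t) \<in> Rp"
  using pos unfolding positive_system_def by blast+

lemma finite_Rp: "finite Rp"
  by (rule finite_subset[OF _ finite_roots]) (use Rp_roots in blast)

lemma sum_roots: "(\<Sum>\<alpha>\<in>roots h. F \<alpha>) = (\<Sum>\<alpha>\<in>Rp. F \<alpha> + F (- \<alpha>))" for F :: "_ \<Rightarrow> 'b::comm_monoid_add"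
proof -
  have R: "roots h = Rp \<union> uminus ` Rp"
  proof (intro equalityI subsetI)
    fix \<alpha> assume \<alpha>: "\<alpha> \<in> roots h"
    show "\<alpha> \<in> Rp \<union> uminus ` Rp"
    proof (cases "\<alpha> \<in> Rp")
      case False
      then have "- \<alpha> \<in> Rp" using Rp_neg[OF \<alpha>] by blast
      then show ?thesis using image_eqI[of \<alpha> uminus "- \<alpha>" Rp] by simp
    qed simp
  qed (use Rp_roots root_uminus in auto)
  have disj: "Rp \<inter> uminus ` Rp = {}" using Rp_neg Rp_roots by auto
  have "(\<Sum>\<alpha>\<in>roots h. F \<alpha>) = (\<Sum>\<alpha>\<in>Rp. F \<alpha>) + (\<Sum>\<alpha>\<in>uminus ` Rp. F \<alpha>)"
    unfolding R using disj finite_Rp by (intro sum.union_disjoint) auto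
  also have "(\<Sum>\<alpha>\<in>uminus ` Rp. F \<alpha>) = (\<Sum>\<alpha>\<in>Rp. F (- \<alpha>))"
  proof (subst sum.reindex)
    show "inj_on uminus Rp" by (rule inj_on_inverseI[of _ uminus]) simp
  qed simp
  finally show ?thesis by (simp add: sum.distrib)
qed

lemma killing_e_sum:
  assumes "\<beta> \<in> roots h"
  shows "(\<Sum>\<alpha>\<in>roots h. killing (e (- \<alpha>)) (e \<beta>) *\<^sub>C F \<alpha>) = (F \<beta> :: 'g)"
proof -
  have "(\<Sum>\<alpha>\<in>roots h. killing (e (- \<alpha>)) (e \<beta>) *\<^sub>C F \<alpha>) = (\<Sum>\<alpha>\<in>roots h. if \<alpha> = \<beta> then F \<beta> else 0)"
  proof (intro sum.cong refl)
    fix \<alpha> assume \<alpha>: "\<alpha> \<in> roots h"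
    show "killing (e (- \<alpha>)) (e \<beta>) *\<^sub>C F \<alpha> = (if \<alpha> = \<beta> then F \<beta> else 0)"
      using killing_e[OF root_uminus[OF \<alpha>]] killing_e_other[OF root_uminus[OF \<alpha>] assms] by auto
  qed
  then show ?thesis using assms finite_roots by simp
qed

lemma expansion: "z = (\<Sum>x\<in>X. killing x z *\<^sub>C x) + (\<Sum>\<alpha>\<in>roots h. killing (e (- \<alpha>)) z *\<^sub>C e \<alpha>)"
proof (rule lin_map_eq_on_span[OF lin_map_id(2) _ basis_span])
  show "lin_map (\<lambda>z. (\<Sum>x\<in>X. killing x z *\<^sub>C x) + (\<Sum>\<alpha>\<in>roots h. killing (e (- \<alpha>)) z *\<^sub>C e \<alpha>))"
    by (rule lin_mapI) (simp_all add: killing_simps cscale_add_left sum.distrib cscale_add_right cvec.scale_sum_right cscale_complex_def)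
  fix z assume "z \<in> h \<union> e ` roots h"
  then consider "z \<in> h" | \<beta> where "\<beta> \<in> roots h" "z = e \<beta>" by blast
  then show "z = (\<Sum>x\<in>X. killing x z *\<^sub>C x) + (\<Sum>\<alpha>\<in>roots h. killing (e (- \<alpha>)) z *\<^sub>C e \<alpha>)"
  proof cases
    case 1
    have "(\<Sum>\<alpha>\<in>roots h. killing (e (- \<alpha>)) z *\<^sub>C e \<alpha>) = 0"
      using killing_h_root[OF root_uminus 1 e_root_space[OF root_uminus]] killing_sym by (intro sum.neutral) simp
    then show ?thesis using h_expand[OF 1] by simp
  next
    case 2
    have "(\<Sum>x\<in>X. killing x z *\<^sub>C x) = 0"
      using killing_h_root[OF 2(1) X_h e_root_space[OF 2(1)]] 2(2) by (intro sum.neutral) simp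
    then show ?thesis using killing_e_sum[OF 2(1), of e] 2(2) by simp
  qed
qed

sublocale D: dual_bases killing J u u'
proof
  show "finite J" unfolding J_def using finite_X finite_roots by (rule finite_Plus)
  fix z :: 'g
  show "z = (\<Sum>a\<in>J. killing (u' a) z *\<^sub>C u a)"
    using expansion[of z] sum_J[of "\<lambda>x y. killing y z *\<^sub>C x"] by simp
  have "(\<Sum>\<alpha>\<in>roots h. killing (e (- \<alpha>)) z *\<^sub>C e \<alpha>) = (\<Sum>\<alpha>\<in>roots h. killing (e \<alpha>) z *\<^sub>C e (- \<alpha>))"
    by (simp add: sum_roots add.commute)
  then show "z = (\<Sum>a\<in>J. killing (u a) z *\<^sub>C u' a)"
    using expansion[of z] sum_J[of "\<lambda>x y. killing x z *\<^sub>C y"] by simp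
qed (rule killing_bilin killing_sym killing_inv)+

text \<open>This is e \<alpha> + \<tau> (e \<alpha>), the fixed point attached to \<alpha>.\<close>

definition f :: "('g \<Rightarrow> complex) \<Rightarrow> 'g" where "f \<alpha> = e \<alpha> - exp (\<alpha> y) *\<^sub>C e (- \<alpha>)"

text \<open>Fixed points are combinations of the f \<alpha> with \<alpha> positive, and the
  coefficient of f \<alpha> is that of e \<alpha>, namely K(e_-\<alpha>, z). The same formula on the
  whole algebra ignores h and the negative root vectors.\<close>

definition \<Theta> :: "'g \<Rightarrow> 'g" where "\<Theta> z = (\<Sum>\<alpha>\<in>Rp. killing (e (- \<alpha>)) z *\<^sub>C f \<alpha>)"

lemma \<Theta>_lin: "lin_map \<Theta>"
  unfolding \<Theta>_def by (rule lin_mapI)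
    (simp_all add: killing_simps cscale_add_left sum.distrib cvec.scale_sum_right cscale_complex_def)

lemma f_k: "\<alpha> \<in> roots h \<Longrightarrow> f \<alpha> \<in> k"
  using root_uminus by (simp add: f_def k_def lin_map_simps[OF \<tau>_lin] \<tau>_e exp_minus)

lemma \<Theta>_k: "\<Theta> z \<in> k"
  unfolding \<Theta>_def using lie_subalgebra_k Rp_roots f_k
  by (intro cvec.subspace_sum cvec.subspace_scale) (auto simp: lie_subalgebra_def)

lemma \<Theta>_h: "t \<in> h \<Longrightarrow> \<Theta> t = 0"
  unfolding \<Theta>_def using killing_h_root[OF root_uminus _ e_root_space[OF root_uminus]] killing_sym Rp_roots
  by (intro sum.neutral) simp

lemma \<Theta>_e: assumes "\<beta> \<in> roots h" shows "\<Theta> (e \<beta>) = (if \<beta> \<in> Rp then f \<beta> else 0)"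
proof -
  have "\<Theta> (e \<beta>) = (\<Sum>\<alpha>\<in>Rp. if \<alpha> = \<beta> then f \<beta> else 0)"
    unfolding \<Theta>_def
  proof (intro sum.cong refl)
    fix \<alpha> assume "\<alpha> \<in> Rp"
    then have \<alpha>: "\<alpha> \<in> roots h" by (rule Rp_roots)
    show "killing (e (- \<alpha>)) (e \<beta>) *\<^sub>C f \<alpha> = (if \<alpha> = \<beta> then f \<beta> else 0)"
      using killing_e[OF root_uminus[OF \<alpha>]] killing_e_other[OF root_uminus[OF \<alpha>] assms] by auto
  qed
  then show ?thesis using finite_Rp by simp
qed

lemma \<Theta>_f: assumes "\<alpha> \<in> Rp" shows "\<Theta> (f \<alpha>) = f \<alpha>"
  using assms Rp_roots[OF assms] root_uminus[OF Rp_roots[OF assms]] Rp_neg[OF Rp_roots[OF assms]]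
  by (simp add: f_def[of \<alpha>] lin_map_simps[OF \<Theta>_lin] \<Theta>_e)

lemma f_neg: "f (- \<alpha>) = - (exp (- \<alpha> y) *\<^sub>C f \<alpha>)"
  by (simp add: f_def cvec.scale_right_diff_distrib exp_minus)

text \<open>For a fixed point 2 z = z + \<tau> z. In this sum the Cartan parts cancel and the root
  parts combine into the f \<alpha>, which \<Theta> fixes.\<close>

lemma \<Theta>_id: assumes "z \<in> k" shows "\<Theta> z = z"
proof -
  have "z + z = z + \<tau> z" using assms by (simp add: k_def)
  also have "\<tau> z = - (\<Sum>x\<in>X. killing x z *\<^sub>C x) - (\<Sum>\<alpha>\<in>roots h. killing (e (- \<alpha>)) z *\<^sub>C exp (\<alpha> y) *\<^sub>C e (- \<alpha>))"
    using X_h by (subst expansion[of z]) (simp add: lin_map_simps[OF \<tau>_lin] \<tau>_h \<tau>_e sum_negf del: cscale_assoc)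
  also have "z + \<dots> = (\<Sum>\<alpha>\<in>roots h. killing (e (- \<alpha>)) z *\<^sub>C f \<alpha>)"
    by (subst (1) expansion[of z]) (simp add: f_def cvec.scale_right_diff_distrib sum_subtractf)
  \<comment> \<open>f (-\<alpha>) is a multiple of f \<alpha>, so the negative roots fold onto the
    positive ones.\<close>
  also have "\<dots> = (\<Sum>\<alpha>\<in>Rp. (killing (e (- \<alpha>)) z - killing (e \<alpha>) z * exp (- \<alpha> y)) *\<^sub>C f \<alpha>)"
    by (simp add: sum_roots f_neg cvec.scale_left_diff_distrib)
  finally have z: "z + z = (\<Sum>\<alpha>\<in>Rp. (killing (e (- \<alpha>)) z - killing (e \<alpha>) z * exp (- \<alpha> y)) *\<^sub>C f \<alpha>)" .
  have "\<Theta> (z + z) = z + z" unfolding z by (simp add: lin_map_simps[OF \<Theta>_lin] \<Theta>_f)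
  then have "(\<Theta> z - z) + (\<Theta> z - z) = 0" by (simp add: lin_map_simps[OF \<Theta>_lin] algebra_simps)
  then have "\<Theta> z - z = 0" by (rule double_eq_zero)
  then show ?thesis by simp
qed

lemma \<Theta>_kernel_span:
  assumes "\<Theta> z = 0" shows "z \<in> cvec.span (h \<union> (\<lambda>\<alpha>. e (- \<alpha>)) ` Rp)"
proof -
  let ?S = "cvec.span (h \<union> (\<lambda>\<alpha>. e (- \<alpha>)) ` Rp)"
  have bS: "e (- \<alpha>) \<in> ?S" if "\<alpha> \<in> Rp" for \<alpha> using that by (intro cvec.span_base) auto
  have "z - \<Theta> z = (\<Sum>x\<in>X. killing x z *\<^sub>C x) + (\<Sum>\<alpha>\<in>Rp. (killing (e \<alpha>) z + killing (e (- \<alpha>)) z * exp (\<alpha> y)) *\<^sub>C e (- \<alpha>))"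
    by (subst (1) expansion[of z])
      (simp add: \<Theta>_def sum_roots f_def cvec.scale_right_diff_distrib cscale_add_left sum.distrib sum_subtractf)
  moreover have "\<dots> \<in> ?S"
    using X_h bS by (intro cvec.span_add cvec.span_sum cvec.span_scale) (auto intro: cvec.span_base)
  ultimately show ?thesis using assms by simp
qed

text \<open>The negative Borel subalgebra is closed under the bracket: brackets of its generators
  have weight -(\<gamma> + \<delta>) with \<gamma> and \<delta> zero or positive. This is never a
  positive root, and \<Theta> sees only positive root components.\<close>

lemma \<Theta>_kernel_bracket:
  assumes "\<Theta> v = 0" "\<Theta> w = 0" shows "\<Theta> (bracket v w) = 0"
proof -
  let ?B = "h \<union> (\<lambda>\<alpha>. e (- \<alpha>)) ` Rp"
  have vanish: "\<Theta> x = 0" if x: "x \<in> root_space h (\<lambda>t. - \<gamma> t)" and \<gamma>: "\<gamma> \<in> dual_space h" and n: "- \<gamma> \<notin> Rp" for x \<gamma>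
    unfolding \<Theta>_def
  proof (intro sum.neutral ballI)
    fix \<alpha> assume \<alpha>: "\<alpha> \<in> Rp"
    then have "- \<gamma> \<noteq> \<alpha>" using n by blast
    then have "\<exists>t\<in>h. (- \<gamma>) t \<noteq> \<alpha> t"
      using dual_space_eqI[OF dual_space_neg[OF \<gamma>] root_dual[OF Rp_roots[OF \<alpha>]]] by blast
    then obtain t where t': "t \<in> h" "- \<gamma> t \<noteq> \<alpha> t" by auto
    then have t: "t \<in> h" "(- \<alpha>) t + - \<gamma> t \<noteq> 0" by (simp_all add: add_eq_0_iff minus_equation_iff[of "\<alpha> t"])
    have "killing (e (- \<alpha>)) x = 0"
      by (rule killing_root_spaces[OF e_root_space[OF root_uminus[OF Rp_roots[OF \<alpha>]]] x t])
    then show "killing (e (- \<alpha>)) x *\<^sub>C f \<alpha> = 0" by simp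
  qed
  have base: "\<Theta> (bracket p q) = 0" if "p \<in> ?B" "q \<in> ?B" for p q
  proof -
    have wt: "\<exists>\<gamma>. (\<gamma> = (\<lambda>_. 0) \<or> \<gamma> \<in> Rp) \<and> p \<in> root_space h (\<lambda>t. - \<gamma> t)" if "p \<in> ?B" for p
      using that root_space_zero e_root_space[OF root_uminus[OF Rp_roots]]
      by (auto simp: fun_Compl_def intro: exI[of _ "\<lambda>_. 0"])
    obtain \<gamma> where \<gamma>: "\<gamma> = (\<lambda>_. 0) \<or> \<gamma> \<in> Rp" "p \<in> root_space h (\<lambda>t. - \<gamma> t)" using wt[OF \<open>p \<in> ?B\<close>] by blast
    obtain \<delta> where \<delta>: "\<delta> = (\<lambda>_. 0) \<or> \<delta> \<in> Rp" "q \<in> root_space h (\<lambda>t. - \<delta> t)" using wt[OF \<open>q \<in> ?B\<close>] by blast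
    let ?s = "\<lambda>t. \<gamma> t + \<delta> t"
    have "bracket p q \<in> root_space h (\<lambda>t. - ?s t)"
      using root_space_bracket[OF \<gamma>(2) \<delta>(2)] by (simp add: algebra_simps)
    moreover have "?s \<in> dual_space h"
      using \<gamma>(1) \<delta>(1) dual_space_zero root_dual[OF Rp_roots] by (intro dual_space_add) auto
    \<comment> \<open>Otherwise \<gamma> + \<delta> would be a root, thus positive by closedness of
      the positive system, together with its negative.\<close>
    moreover have "- ?s \<notin> Rp"
    proof
      assume a: "- ?s \<in> Rp"
      then have sR: "?s \<in> roots h" using root_uminus[OF Rp_roots[OF a]] by (simp only: fun_minus_minus)
      have nz: "?s \<noteq> (\<lambda>_. 0)" using sR by (auto simp: roots_def)
      have "?s \<in> Rp"
        using \<gamma>(1) \<delta>(1) nz sR Rp_add by (auto simp: fun_eq_iff)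
      then show False using a Rp_neg[OF sR] by blast
    qed
    ultimately show ?thesis by (rule vanish)
  qed
  have right: "\<Theta> (bracket p w) = 0" if p: "p \<in> ?B" for p
    using \<Theta>_kernel_span[OF assms(2)]
  proof (induction rule: cvec.span_induct_alt)
    case (step c q z)
    then show ?case using base[OF p step(1)] by (simp add: lin_map_simps[OF \<Theta>_lin] bracket_simps)
  qed (simp add: lin_map_simps[OF \<Theta>_lin] bracket_simps)
  show ?thesis
    using \<Theta>_kernel_span[OF assms(1)]
  proof (induction rule: cvec.span_induct_alt)
    case (step c p z)
    then show ?case using right[OF step(1)] by (simp add: lin_map_simps[OF \<Theta>_lin] bracket_simps)
  qed (simp add: lin_map_simps[OF \<Theta>_lin] bracket_simps)
qed

text \<open>\<^term>\<open>\<Theta>\<close> projects onto the subalgebra \<^term>\<open>k\<close> along a complementary (negative Borel) subalgebra.\<close>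

lemma \<Theta>_bracket: "bracket (\<Theta> v) (\<Theta> w) = \<Theta> (bracket (\<Theta> v) w + bracket v (\<Theta> w) - bracket v w)"
proof -
  \<comment> \<open>v - \<Theta> v and w - \<Theta> w lie in the kernel; expanding this equation
    yields the identity.\<close>
  have "\<Theta> (bracket (v - \<Theta> v) (w - \<Theta> w)) = 0"
    by (rule \<Theta>_kernel_bracket) (simp_all add: lin_map_simps[OF \<Theta>_lin] \<Theta>_id[OF \<Theta>_k])
  moreover have "\<Theta> (bracket (\<Theta> v) (\<Theta> w)) = bracket (\<Theta> v) (\<Theta> w)"
    by (intro \<Theta>_id lie_subalgebraD(4)[OF lie_subalgebra_k] \<Theta>_k)
  ultimately show ?thesis by (simp add: bracket_simps lin_map_simps[OF \<Theta>_lin] algebra_simps)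
qed

text \<open>Cartan terms vanish. For positive \<alpha> the terms in F(e_-\<alpha>, e_-\<alpha>) and
  F(e_-\<alpha>, e_\<alpha>) cancel among themselves, and the remaining \<alpha>(t) F(e_\<alpha>,
  e_-\<alpha>) is cancelled by the contribution of -\<alpha>.\<close>

lemma t_condition:
  assumes t: "t \<in> h" and F: "bilin (F :: 'g \<Rightarrow> 'g \<Rightarrow> 'c::complex_vec)"
  shows "(\<Sum>a\<in>J. F (bracket t (\<Theta> (u a))) (u' a) + F (u' a) (bracket (\<Theta> (u a)) t) - F (u' a) (bracket (u a) t)) = 0"
proof -
  note Fs = bilin_simps[OF F] bilin_neg_left[OF F] bilin_neg_right[OF F] 
    lin_map_zero[OF bilinD(1)[OF F]] lin_map_zero[OF bilinD(2)[OF F]]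
    lin_map_diff[OF bilinD(1)[OF F]] lin_map_diff[OF bilinD(2)[OF F]]
  let ?G = "\<lambda>p q. F (bracket t (\<Theta> p)) q + F q (bracket (\<Theta> p) t) - F q (bracket p t)"
  have X0: "?G x x = 0" if "x \<in> X" for x
    using h_abelian[OF X_h[OF that] t] by (simp add: \<Theta>_h X_h[OF that] bracket_simps Fs)
  have R0: "?G (e \<alpha>) (e (- \<alpha>)) + ?G (e (- \<alpha>)) (e (- (- \<alpha>))) = 0" if \<alpha>: "\<alpha> \<in> Rp" for \<alpha>
  proof -
    have r: "\<alpha> \<in> roots h" "- \<alpha> \<in> roots h" "- \<alpha> \<notin> Rp" using \<alpha> Rp_roots root_uminus Rp_neg by blast+
    have b: "bracket t (e \<alpha>) = \<alpha> t *\<^sub>C e \<alpha>" "bracket t (e (- \<alpha>)) = - (\<alpha> t *\<^sub>C e (- \<alpha>))"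
      using root_spaceD[OF e_root_space[OF r(1)] t] root_spaceD[OF e_root_space[OF r(2)] t] by simp_all
    have b': "bracket (e \<alpha>) t = - (\<alpha> t *\<^sub>C e \<alpha>)" "bracket (e (- \<alpha>)) t = \<alpha> t *\<^sub>C e (- \<alpha>)"
      using b bracket_anti[of "e \<alpha>" t] bracket_anti[of "e (- \<alpha>)" t] by simp_all
    show ?thesis
      by (simp add: \<Theta>_e r \<alpha> f_def bracket_simps b b' Fs cvec.scale_right_diff_distrib cscale_add_right)
  qed
  show ?thesis
    unfolding sum_J[of ?G] using X0 R0 by (simp add: sum_roots)
qed

end

section \<open>The boundary Hamiltonians\<close>

context chevalley_basis begin

section \<open>The r-matrices and their products\<close>

definition varpi_h :: "('g, 'g) tensor" where "varpi_h = (\<Sum>x\<in>X. tensor x x)"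
definition varpi :: "('g, 'g) tensor" where "varpi = varpi_h + (\<Sum>\<alpha>\<in>roots h. tensor (e (- \<alpha>)) (e \<alpha>))"
definition r :: "('g, 'g) tensor" where "r = (1/2) *\<^sub>C varpi_h + (\<Sum>\<alpha>\<in>Rp. tensor (e \<alpha>) (e (- \<alpha>)))"
definition r' :: "('g, 'g) tensor" where "r' = tensor_map \<tau> id r"
definition rp :: "('g, 'g) tensor" where "rp = (1/2) *\<^sub>C (r' + r)"

lemmas tensor_simps = lin_map_simps[OF lin_map_tensor(1)] lin_map_simps[OF lin_map_tensor(2)]

lemma r'_eq: "r' = - ((1/2) *\<^sub>C varpi_h) - (\<Sum>\<alpha>\<in>Rp. exp (\<alpha> y) *\<^sub>C tensor (e (- \<alpha>)) (e (- \<alpha>)))"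
proof -
  let ?F = "\<lambda>v. tensor (\<tau> v) :: 'g \<Rightarrow> _"
  have b: "bilin ?F" using bilin_comp[OF bilin_tensor \<tau>_lin lin_map_id(1)] by simp
  note l = lin_map_simps[OF lin_map_tensor_ext[OF b]] tensor_ext_tensor[OF b]
  have "tensor_ext ?F varpi_h = - varpi_h"
    using X_h by (simp add: varpi_h_def l \<tau>_h tensor_simps sum_negf)
  moreover have "tensor_ext ?F (\<Sum>\<alpha>\<in>Rp. tensor (e \<alpha>) (e (- \<alpha>)))
      = - (\<Sum>\<alpha>\<in>Rp. exp (\<alpha> y) *\<^sub>C tensor (e (- \<alpha>)) (e (- \<alpha>)))"
    by (simp add: l Rp_roots \<tau>_e tensor_simps sum_negf)
  moreover have "tensor_map \<tau> id = tensor_ext ?F" by (simp add: tensor_map_ext)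
  ultimately show ?thesis unfolding r'_def r_def by (simp add: l)
qed

lemma rp_eq: "rp = (1/2) *\<^sub>C (\<Sum>\<alpha>\<in>Rp. tensor (f \<alpha>) (e (- \<alpha>)))"
proof -
  have "r' + r = (\<Sum>\<alpha>\<in>Rp. tensor (f \<alpha>) (e (- \<alpha>)))"
    by (simp add: r'_eq r_def f_def tensor_simps sum_subtractf)
  then show ?thesis by (simp add: rp_def)
qed

lemma rp_subtensor: "rp \<in> subtensor k UNIV"
proof -
  have "tensor (f \<alpha>) (e (- \<alpha>)) \<in> subtensor k UNIV" if "\<alpha> \<in> Rp" for \<alpha>
    unfolding subtensor_def using f_k[OF Rp_roots[OF that]] by (intro cvec.span_base) blast
  then show ?thesis unfolding rp_eq subtensor_def by (intro cvec.span_scale cvec.span_sum)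
qed

text \<open>The form required by the commutator identities: \<Theta> kills h and the negative root
  vectors and sends e \<alpha> to f \<alpha> for positive \<alpha>.\<close>

lemma rp_sum: "rp = (1/2) *\<^sub>C (\<Sum>a\<in>J. tensor (\<Theta> (u a)) (u' a))"
proof -
  have x: "tensor (\<Theta> x) x = 0" if "x \<in> X" for x
    using X_h[OF that] by (simp add: \<Theta>_h tensor_simps)
  have r: "tensor (\<Theta> (e \<alpha>)) (e (- \<alpha>)) + tensor (\<Theta> (e (- \<alpha>))) (e \<alpha>) = tensor (f \<alpha>) (e (- \<alpha>))"
    if "\<alpha> \<in> Rp" for \<alpha>
  proof -
    have "\<alpha> \<in> roots h" "- \<alpha> \<in> roots h" "- \<alpha> \<notin> Rp" using that Rp_roots root_uminus Rp_neg by blast+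
    then show ?thesis using that by (simp add: \<Theta>_e tensor_simps)
  qed
  have "(\<Sum>a\<in>J. tensor (\<Theta> (u a)) (u' a)) = (\<Sum>\<alpha>\<in>Rp. tensor (f \<alpha>) (e (- \<alpha>)))"
    unfolding sum_J[of "\<lambda>x y. tensor (\<Theta> x) y"] sum_roots by (simp add: x r)
  then show ?thesis by (simp add: rp_eq)
qed

lemma varpi_sum: "varpi = (\<Sum>a\<in>J. tensor (u' a) (u a))"
  by (simp add: varpi_def varpi_h_def sum_J[of "\<lambda>x y. tensor y x"])

text \<open>The element of h dual to half the sum of the positive roots. It measures the cost of
  reordering e \<alpha> and e (-\<alpha>) in products.\<close>

definition half_sum :: 'g where "half_sum = (1/2) *\<^sub>C (\<Sum>\<alpha>\<in>Rp. t_dual h \<alpha>)"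

lemma half_sum_h: "half_sum \<in> h"
  unfolding half_sum_def using t_dual(1) root_dual Rp_roots by (intro h_closed(3) h_closed(6)) blast

text \<open>r is half the Casimir tensor plus half the sum over positive roots of e_\<alpha>
  \<otimes> e_-\<alpha> - e_-\<alpha> \<otimes> e_\<alpha>. If \<open>F\<close> is a product with
  commutator \<open>G\<close>, the antisymmetric part contributes \<open>G\<close> of half the sum
  of the [e_\<alpha>, e_-\<alpha>] = t_\<alpha>.\<close>

lemma tensor_ext_r:
  assumes F: "bilin (F :: 'g \<Rightarrow> 'g \<Rightarrow> 'c::complex_vec)" and G: "lin_map G"
    and FG: "\<And>v w. F v w - F w v = G (bracket v w)"
  shows "tensor_ext F r = (1/2) *\<^sub>C (\<Sum>a\<in>J. F (u' a) (u a)) + G half_sum"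
proof -
  note l = lin_map_simps[OF lin_map_tensor_ext[OF F]] tensor_ext_tensor[OF F]
  have Gt: "G (t_dual h \<alpha>) = F (e \<alpha>) (e (- \<alpha>)) - F (e (- \<alpha>)) (e \<alpha>)" if "\<alpha> \<in> Rp" for \<alpha>
    using FG[of "e \<alpha>" "e (- \<alpha>)"] e_bracket[OF Rp_roots[OF that]] by simp
  have "G half_sum = (1/2) *\<^sub>C (\<Sum>\<alpha>\<in>Rp. F (e \<alpha>) (e (- \<alpha>)) - F (e (- \<alpha>)) (e \<alpha>))"
    by (simp add: half_sum_def lin_map_simps[OF G] Gt)
  moreover have "(\<Sum>a\<in>J. F (u' a) (u a)) = (\<Sum>x\<in>X. F x x) + (\<Sum>\<alpha>\<in>Rp. F (e (- \<alpha>)) (e \<alpha>) + F (e \<alpha>) (e (- \<alpha>)))"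
    by (simp add: sum_J[of "\<lambda>x y. F y x"] sum_roots)
  ultimately have "(1/2) *\<^sub>C (\<Sum>a\<in>J. F (u' a) (u a)) + G half_sum = (1/2) *\<^sub>C (\<Sum>x\<in>X. F x x) +
    (1/2) *\<^sub>C ((\<Sum>\<alpha>\<in>Rp. F (e \<alpha>) (e (- \<alpha>))) + (\<Sum>\<alpha>\<in>Rp. F (e \<alpha>) (e (- \<alpha>))))"
    by (simp add: sum.distrib sum_subtractf cscale_add_right cvec.scale_right_diff_distrib)
  also have "(1/2) *\<^sub>C ((\<Sum>\<alpha>\<in>Rp. F (e \<alpha>) (e (- \<alpha>))) + (\<Sum>\<alpha>\<in>Rp. F (e \<alpha>) (e (- \<alpha>)))) = (\<Sum>\<alpha>\<in>Rp. F (e \<alpha>) (e (- \<alpha>)))"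
    using cscale_add_left[of "1/2" "1/2" "\<Sum>\<alpha>\<in>Rp. F (e \<alpha>) (e (- \<alpha>))"] by (simp add: cscale_add_right)
  finally show ?thesis by (simp add: r_def varpi_h_def l)
qed

lemma r'_diff: "r' = 2 *\<^sub>C rp - r"
  by (simp add: rp_def)

text \<open>Uses r' = 2 rp - r. Halving the result explains the constants of the core, (M - t) / 2 -
  C / 4.\<close>

lemma tensor_ext_r':
  assumes F: "bilin (F :: 'g \<Rightarrow> 'g \<Rightarrow> 'c::complex_vec)" and G: "lin_map G"
    and FG: "\<And>v w. F v w - F w v = G (bracket v w)"
  shows "tensor_ext F r' = (\<Sum>a\<in>J. F (\<Theta> (u a)) (u' a)) - G half_sum - (1/2) *\<^sub>C (\<Sum>a\<in>J. F (u' a) (u a))"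
proof -
  note l = lin_map_simps[OF lin_map_tensor_ext[OF F]] tensor_ext_tensor[OF F]
  have "tensor_ext F (2 *\<^sub>C rp) = (\<Sum>a\<in>J. F (\<Theta> (u a)) (u' a))"
    by (simp add: rp_sum l)
  then show ?thesis
    by (simp add: r'_diff l tensor_ext_r[OF assms])
qed

lemma uea_mult_eq:
  shows "(1/2) \<odot>\<^bsub>uea UNIV\<^esub> uea_mult r' = (- 1/4) \<odot>\<^bsub>uea UNIV\<^esub> uea_mult varpi_h \<oplus>\<^bsub>uea UNIV\<^esub>
    (- 1/2) \<odot>\<^bsub>uea UNIV\<^esub> (\<Oplus>\<^bsub>uea UNIV\<^esub>\<alpha>\<in>Rp. exp (\<alpha> y) \<odot>\<^bsub>uea UNIV\<^esub>
      (uea_in UNIV (e (- \<alpha>)) \<otimes>\<^bsub>uea UNIV\<^esub> uea_in UNIV (e (- \<alpha>))))"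
proof -
  interpret U: calgebra "uea (UNIV :: 'g set)" by (rule calgebra_uea[OF lie_subalgebra_UNIV])
  note c = uea_in_closed[OF lie_subalgebra_UNIV]
  define em where "em x = U.emb (uea_in UNIV x)" for x :: 'g
  have em: "lin_map em"
    by (rule lin_mapI) (simp_all add: em_def uea_in_add[OF lie_subalgebra_UNIV] uea_in_scale[OF lie_subalgebra_UNIV]
      U.emb_add U.emb_smult c)
  have b: "bilin (\<lambda>x y. em x * em y)" by (rule bilin_mult[OF em em])
  note l = lin_map_simps[OF lin_map_tensor_ext[OF b]] tensor_ext_tensor[OF b]
  have um: "uea_mult z \<in> carrier (uea UNIV)" "U.emb (uea_mult z) = tensor_ext (\<lambda>x y. em x * em y) z" for z
    unfolding uea_mult_def
    by (rule U.tensor_lift[OF _ _ U.mod_hom_emb b]; simp add: subtensor_UNIV c U.emb_mult em_def)+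
  show ?thesis
    by (subst U.emb_inject[symmetric])
      (simp_all add: um c U.emb_add U.emb_smult U.emb_finsum U.emb_mult Pi_iff r'_eq l em_def[symmetric]
        cvec.scale_right_diff_distrib finite_Rp)
qed

end

text \<open>\<open>S\<^sub>0\<close> is the set of boundary sites coupled by \<kappa>; its nonempty
  values are the three choices in the theorem.\<close>

locale boundary_setup = chevalley_basis h \<sigma> X Rp e y
  for h :: "'g::complex_lie_algebra set" and \<sigma> :: "'g \<Rightarrow> 'g" and X :: "'g set"
    and Rp :: "('g \<Rightarrow> complex) set" and e :: "('g \<Rightarrow> complex) \<Rightarrow> 'g" and y :: 'g +
  fixes N :: nat and S\<^sub>0 :: "nat set"
  assumes S\<^sub>0: "S\<^sub>0 \<subseteq> {0, N + 1}"
begin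

sublocale bs: boundary_sites N k
  by unfold_locales (rule lie_subalgebra_k)

lemma slot_\<Theta>: "\<Theta> x \<in> slot N k s"
  using \<Theta>_k by (simp add: slot_def)

lemma slot_UNIV: "i \<in> {1..N} \<Longrightarrow> slot N k i = UNIV"
  by (simp add: slot_def)

lemma lin_site_\<Theta>: "s \<le> N + 1 \<Longrightarrow> lin_map (\<lambda>x. bs.site s (\<Theta> x))"
  by (rule lin_mapI) (simp_all add: lin_map_simps[OF \<Theta>_lin] bs.site_add bs.site_scale slot_\<Theta>)

sublocale kz: boundary_kz killing J u u' \<Theta> N "S\<^sub>0 \<union> {1..N}" bs.site "\<lambda>s x. bs.site s (\<Theta> x)" half_sum
proof
  have S: "s \<le> N + 1" if "s \<in> S\<^sub>0 \<union> {1..N}" for s using that S\<^sub>0 by auto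
  show "finite (S\<^sub>0 \<union> {1..N})" using S\<^sub>0 finite_subset by auto
  show "bs.site i (bracket v w) = commutator (bs.site i v) (bs.site i w)" if "i \<in> {1..N}" for i v w
    using that by (simp add: commutator_def bs.site_bracket slot_UNIV)
  show "commutator (bs.site s (\<Theta> v)) (bs.site s (\<Theta> w)) = bs.site s (\<Theta> (bracket (\<Theta> v) w + bracket v (\<Theta> w) - bracket v w))"
    if "s \<in> S\<^sub>0 \<union> {1..N}" for s v w
    using bs.site_bracket[OF S[OF that] slot_\<Theta> slot_\<Theta>, of v w] by (simp add: commutator_def \<Theta>_bracket)
  show "commutator (bs.site s (\<Theta> v)) (bs.site s' (\<Theta> w)) = 0" if "s \<noteq> s'" for s s' v w
    using bs.site_commute[OF that slot_\<Theta> slot_\<Theta>] by (simp add: commutator_def)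
  show "commutator (bs.site s (\<Theta> v)) (bs.site i w) = 0" if "i \<in> {1..N}" "s \<noteq> i" for s i v w
    using bs.site_commute[OF that(2) slot_\<Theta>, of w v] that(1) by (simp add: commutator_def slot_UNIV)
  show "commutator (bs.site i v) (bs.site j w) = 0" if "i \<in> {1..N}" "j \<in> {1..N}" "i \<noteq> j" for i j v w
    using bs.site_commute[OF that(3), of v w] that by (simp add: commutator_def slot_UNIV)
qed (use S\<^sub>0 in \<open>auto intro!: \<Theta>_lin \<Theta>_bracket bs.lin_map_site lin_site_\<Theta> t_condition half_sum_h\<close>)

lemma place2_bulk:
  assumes "i \<in> {1..N}" "j \<in> {1..N}"
  shows "place2 N k i j z \<in> carrier bs.T"
    "bs.T.emb (place2 N k i j z) = tensor_ext (\<lambda>x y. bs.site i x * bs.site j y) z"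
  using assms by (auto intro!: bs.place2 bilin_mult bs.lin_map_site simp: slot_UNIV subtensor_UNIV)

text \<open>The boundary leg is precomposed with \<Theta>. This changes nothing on \<open>k\<close>,
  where the first leg of rp lives, and makes the form bilinear on the whole algebra.\<close>

lemma place2_rp:
  assumes "s \<in> {0, N + 1}" "i \<in> {1..N}"
  shows "place2 N k s i rp \<in> carrier bs.T" "bs.T.emb (place2 N k s i rp) = (1/2) *\<^sub>C kz.Q s i"
proof -
  have s: "slot N k s = k" using assms(1) by (auto simp: slot_def)
  have sN: "s \<le> N + 1" using assms(1) by auto
  have b: "bilin (\<lambda>x y. bs.site s (\<Theta> x) * bs.site i y)"
    by (rule bilin_mult[OF lin_site_\<Theta>[OF sN] bs.lin_map_site[OF assms(2)]])
  have z: "rp \<in> subtensor (slot N k s) (slot N k i)" using rp_subtensor assms(2) by (simp add: s slot_UNIV)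
  note p = bs.place2[OF z b]
  show "place2 N k s i rp \<in> carrier bs.T" by (rule p(1)) (simp add: s \<Theta>_id)
  have "bs.T.emb (place2 N k s i rp) = tensor_ext (\<lambda>x y. bs.site s (\<Theta> x) * bs.site i y) rp"
    by (rule p(2)) (simp add: s \<Theta>_id)
  also have "\<dots> = (1/2) *\<^sub>C kz.Q s i"
    by (simp add: rp_sum kz.Q_def lin_map_simps[OF lin_map_tensor_ext[OF b]] tensor_ext_tensor[OF b] \<Theta>_id[OF \<Theta>_k])
  finally show "bs.T.emb (place2 N k s i rp) = (1/2) *\<^sub>C kz.Q s i" .
qed

abbreviation "\<kappa>core \<equiv> (1/2) \<odot>\<^bsub>uea (UNIV :: 'g set)\<^esub> uea_mult r'"

lemma place1_\<kappa>core:
  assumes i: "i \<in> {1..N}"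
  shows "place1 N k i \<kappa>core \<in> carrier bs.T"
    "bs.T.emb (place1 N k i \<kappa>core) = (1/2) *\<^sub>C (kz.M i - bs.site i half_sum) - (1/4) *\<^sub>C kz.C i"
proof -
  interpret U: calgebra "uea (UNIV :: 'g set)" by (rule calgebra_uea[OF lie_subalgebra_UNIV])
  have c: "\<kappa>core \<in> carrier (uea UNIV)" by (simp add: bs.uea_mult_closed)
  show "place1 N k i \<kappa>core \<in> carrier bs.T" using bs.place1_closed[of _ i] c by (simp only: slot_UNIV[OF i])
  have "mod_hom (uea UNIV) (\<lambda>u. bs.T.emb (place1 N k i u))"
    using bs.mod_hom_place1[of i] i by (simp add: slot_UNIV)
  then have "bs.T.emb (place1 N k i \<kappa>core) = (1/2) *\<^sub>C bs.T.emb (place1 N k i (uea_mult r'))"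
    using bs.uea_mult_closed unfolding mod_hom_def by blast
  also have "bs.T.emb (place1 N k i (uea_mult r')) = tensor_ext (\<lambda>x y. bs.site i x * bs.site i y) r'"
    by (rule bs.place1_uea_mult[OF i])
  also have "\<dots> = kz.M i - bs.site i half_sum - (1/2) *\<^sub>C kz.C i"
    unfolding kz.M_def kz.C_def
    by (rule tensor_ext_r'[OF bilin_mult bs.lin_map_site[OF i]])
      (simp_all add: bs.lin_map_site[OF i] kz.\<iota>_bracket[OF i] commutator_def)
  finally show "bs.T.emb (place1 N k i \<kappa>core) = (1/2) *\<^sub>C (kz.M i - bs.site i half_sum) - (1/4) *\<^sub>C kz.C i"
    by (simp add: cvec.scale_right_diff_distrib)
qed

text \<open>r + r' = 2 rp, so half of the two bulk couplings has the same shape as a boundary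
  coupling by rp, and all sites enter the Hamiltonian alike.\<close>

lemma bulk_Q:
  assumes "s \<in> {1..N}" "i \<in> {1..N}"
  shows "bs.T.emb (place2 N k s i r) + bs.T.emb (place2 N k s i r') = kz.Q s i"
proof -
  have b: "bilin (\<lambda>x y. bs.site s x * bs.site i y)"
    by (rule bilin_mult[OF bs.lin_map_site[OF assms(1)] bs.lin_map_site[OF assms(2)]])
  note l = lin_map_simps[OF lin_map_tensor_ext[OF b]] tensor_ext_tensor[OF b]
  have "tensor_ext (\<lambda>x y. bs.site s x * bs.site i y) r + tensor_ext (\<lambda>x y. bs.site s x * bs.site i y) r'
     = tensor_ext (\<lambda>x y. bs.site s x * bs.site i y) (2 *\<^sub>C rp)"
    by (simp add: r'_diff l)
  also have "\<dots> = kz.Q s i" by (simp add: rp_sum kz.Q_def l)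
  finally show ?thesis using place2_bulk[OF assms] by simp
qed

lemma bulk_W:
  assumes "i \<in> {1..N}" "s \<in> {1..N}"
  shows "bs.T.emb (place2 N k i s varpi) = kz.W i s"
proof -
  have b: "bilin (\<lambda>x y. bs.site i x * bs.site s y)"
    by (rule bilin_mult[OF bs.lin_map_site[OF assms(1)] bs.lin_map_site[OF assms(2)]])
  show ?thesis
    by (simp add: place2_bulk[OF assms] varpi_sum kz.W_def lin_map_simps[OF lin_map_tensor_ext[OF b]] tensor_ext_tensor[OF b])
qed

text \<open>The Hamiltonian is translated into operators, in the shape demanded by
  \<open>boundary_hamiltonians_commute\<close>; commutation is carried back through injectivity of
  \<open>emb\<close>.\<close>

lemma hamiltonians_commute:
  assumes \<kappa>: "\<And>i. i \<in> {1..N} \<Longrightarrow> \<kappa> i \<in> carrier bs.T \<and>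
      bs.T.emb (\<kappa> i) = bs.T.emb (place1 N k i \<kappa>core) + (\<Sum>s\<in>S\<^sub>0. bs.T.emb (place2 N k s i rp))"
    and A: "\<And>i. i \<in> {1..N} \<Longrightarrow> A i =
       (- 1/2) \<odot>\<^bsub>bs.T\<^esub> (\<Oplus>\<^bsub>bs.T\<^esub>s\<in>{i + 1..N}. place2 N k i s varpi) \<oplus>\<^bsub>bs.T\<^esub>
              (\<kappa> i
                \<oplus>\<^bsub>bs.T\<^esub> (1/2) \<odot>\<^bsub>bs.T\<^esub> (\<Oplus>\<^bsub>bs.T\<^esub>s\<in>{1..N} - {i}. place2 N k s i r)
                \<oplus>\<^bsub>bs.T\<^esub> (1/2) \<odot>\<^bsub>bs.T\<^esub> (\<Oplus>\<^bsub>bs.T\<^esub>s\<in>{1..N} - {i}. place2 N k s i r'))"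
  shows "\<forall>i\<in>{1..N}. A i \<in> carrier bs.T" "\<forall>i\<in>{1..N}. \<forall>j\<in>{1..N}. A i \<otimes>\<^bsub>bs.T\<^esub> A j = A j \<otimes>\<^bsub>bs.T\<^esub> A i"
proof -
  have W_cl: "(\<lambda>s. place2 N k i s varpi) \<in> {i + 1..N} \<rightarrow> carrier bs.T" if "i \<in> {1..N}" for i
    using that by (intro Pi_I place2_bulk(1)) auto
  have r_cl: "(\<lambda>s. place2 N k s i z) \<in> {1..N} - {i} \<rightarrow> carrier bs.T" if "i \<in> {1..N}" for i z
    using that by (intro Pi_I place2_bulk(1)) auto
  have closed: "A i \<in> carrier bs.T" if i: "i \<in> {1..N}" for i
    unfolding A[OF i]
    by (intro bs.T.a_closed bs.T.smult_closed bs.T.finsum_closed W_cl r_cl i conjunct1[OF \<kappa>])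
  then show "\<forall>i\<in>{1..N}. A i \<in> carrier bs.T" by blast
  have emb: "bs.T.emb (A i) = (1/2) *\<^sub>C (kz.M i - bs.site i half_sum) - (1/4) *\<^sub>C kz.C i
      + (1/2) *\<^sub>C (\<Sum>s\<in>S\<^sub>0 \<union> {1..N} - {i}. kz.Q s i) - (1/2) *\<^sub>C (\<Sum>s\<in>{i + 1..N}. kz.W i s)" if i: "i \<in> {1..N}" for i
  proof -
    let ?E = "bs.T.emb"
    have sum: "?E (\<Oplus>\<^bsub>bs.T\<^esub>s\<in>{1..N} - {i}. place2 N k s i z) = (\<Sum>s\<in>{1..N} - {i}. ?E (place2 N k s i z))" for z
      by (rule bs.T.emb_finsum[OF r_cl[OF i]]) simp
    have "?E (A i) = (- 1/2) *\<^sub>C ?E (\<Oplus>\<^bsub>bs.T\<^esub>s\<in>{i + 1..N}. place2 N k i s varpi) + (?E (\<kappa> i)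
        + (1/2) *\<^sub>C ?E (\<Oplus>\<^bsub>bs.T\<^esub>s\<in>{1..N} - {i}. place2 N k s i r) + (1/2) *\<^sub>C ?E (\<Oplus>\<^bsub>bs.T\<^esub>s\<in>{1..N} - {i}. place2 N k s i r'))"
      unfolding A[OF i]
      by (simp only: bs.T.emb_add bs.T.emb_smult bs.T.a_closed bs.T.smult_closed bs.T.finsum_closed
          W_cl[OF i] r_cl[OF i] conjunct1[OF \<kappa>[OF i]])
    also have "?E (\<Oplus>\<^bsub>bs.T\<^esub>s\<in>{i + 1..N}. place2 N k i s varpi) = (\<Sum>s\<in>{i + 1..N}. kz.W i s)"
      using i by (subst bs.T.emb_finsum[OF W_cl[OF i]]) (auto intro!: sum.cong bulk_W)
    also have "?E (\<kappa> i) = (1/2) *\<^sub>C (kz.M i - bs.site i half_sum) - (1/4) *\<^sub>C kz.C i + (1/2) *\<^sub>C (\<Sum>s\<in>S\<^sub>0. kz.Q s i)"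
    proof -
      have "(\<Sum>s\<in>S\<^sub>0. ?E (place2 N k s i rp)) = (1/2) *\<^sub>C (\<Sum>s\<in>S\<^sub>0. kz.Q s i)"
        unfolding cvec.scale_sum_right by (intro sum.cong refl place2_rp(2) i) (use S\<^sub>0 in blast)
      then show ?thesis using conjunct2[OF \<kappa>[OF i]] place1_\<kappa>core(2)[OF i] by simp
    qed
    finally have 1: "?E (A i) = (- 1/2) *\<^sub>C (\<Sum>s\<in>{i + 1..N}. kz.W i s) +
       ((1/2) *\<^sub>C (kz.M i - bs.site i half_sum) - (1/4) *\<^sub>C kz.C i + (1/2) *\<^sub>C (\<Sum>s\<in>S\<^sub>0. kz.Q s i) +
        (1/2) *\<^sub>C ?E (\<Oplus>\<^bsub>bs.T\<^esub>s\<in>{1..N} - {i}. place2 N k s i r) + (1/2) *\<^sub>C ?E (\<Oplus>\<^bsub>bs.T\<^esub>s\<in>{1..N} - {i}. place2 N k s i r'))" .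
    have 2: "(1/2) *\<^sub>C ?E (\<Oplus>\<^bsub>bs.T\<^esub>s\<in>{1..N} - {i}. place2 N k s i r) + (1/2) *\<^sub>C ?E (\<Oplus>\<^bsub>bs.T\<^esub>s\<in>{1..N} - {i}. place2 N k s i r')
       = (1/2) *\<^sub>C (\<Sum>s\<in>{1..N} - {i}. kz.Q s i)"
      unfolding sum cscale_add_right[symmetric] sum.distrib[symmetric]
      using i by (auto intro!: sum.cong bulk_Q arg_cong[where f = "cscale (1/2)"])
    \<comment> \<open>Boundary and bulk positions are disjoint, so the two sums of Q merge into one
      over all sites.\<close>
    have "S\<^sub>0 \<union> {1..N} - {i} = S\<^sub>0 \<union> ({1..N} - {i})" "S\<^sub>0 \<inter> ({1..N} - {i}) = {}" "finite S\<^sub>0"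
      using S\<^sub>0 i finite_subset[OF S\<^sub>0] by auto
    then have 3: "(\<Sum>s\<in>S\<^sub>0 \<union> {1..N} - {i}. kz.Q s i) = (\<Sum>s\<in>S\<^sub>0. kz.Q s i) + (\<Sum>s\<in>{1..N} - {i}. kz.Q s i)"
      by (simp add: sum.union_disjoint)
    show ?thesis unfolding 1 add.assoc 2 3 by (simp add: cscale_add_right algebra_simps)
  qed
  show "\<forall>i\<in>{1..N}. \<forall>j\<in>{1..N}. A i \<otimes>\<^bsub>bs.T\<^esub> A j = A j \<otimes>\<^bsub>bs.T\<^esub> A i"
  proof (intro ballI)
    fix i j assume ij: "i \<in> {1..N}" "j \<in> {1..N}"
    have "bs.T.emb (A i) * bs.T.emb (A j) = bs.T.emb (A j) * bs.T.emb (A i)"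
      by (rule kz.boundary_hamiltonians_commute[of "\<lambda>i. bs.T.emb (A i)", OF emb ij])
    then show "A i \<otimes>\<^bsub>bs.T\<^esub> A j = A j \<otimes>\<^bsub>bs.T\<^esub> A i"
      using closed[OF ij(1)] closed[OF ij(2)] by (simp add: bs.T.emb_inject[symmetric] bs.T.emb_mult)
  qed
qed

end

theorem theorem7p2:
  fixes h :: "'g::complex_lie_algebra set"
    and \<sigma> \<tau> :: "'g \<Rightarrow> 'g"
    and Rp :: "('g \<Rightarrow> complex) set"
    and e :: "('g \<Rightarrow> complex) \<Rightarrow> 'g"
    and X Y k :: "'g set"
    and y :: 'g
    and varpi_h varpi r r' rp :: "('g, 'g) tensor"
    and N :: nat
  assumes simple: "simple_lie_algebra TYPE('g)"
    and cartan: "cartan_subalgebra h"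
    and pos: "positive_system (roots h) Rp"
    and chevalley: "chevalley_involution h \<sigma>"
    and root_vectors: "\<forall>\<alpha>\<in>roots h. e \<alpha> \<in> root_space h \<alpha> \<and>
          bracket (e \<alpha>) (e (- \<alpha>)) = t_dual h \<alpha> \<and> \<sigma> (e \<alpha>) = - e (- \<alpha>)"
    and basis: "orthonormal_basis h X"
    and Y: "Y \<in> torus h" and y: "y \<in> Y"
    and \<tau>: "\<tau> = \<sigma> \<circ> Ad_torus h y"
    and k: "k = {x. \<tau> x = x}"
    and varpi_h: "varpi_h = (\<Sum>x\<in>X. tensor x x)"
    and varpi: "varpi = varpi_h + (\<Sum>\<alpha>\<in>roots h. tensor (e (- \<alpha>)) (e \<alpha>))"
    and r: "r = (1/2) *\<^sub>C varpi_h + (\<Sum>\<alpha>\<in>Rp. tensor (e \<alpha>) (e (- \<alpha>)))"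
    and r': "r' = tensor_map \<tau> id r"
    and rp: "rp = (1/2) *\<^sub>C (r' + r)"
    and U: "U = uea (UNIV :: 'g set)"
    and \<kappa>core: "\<kappa>core = (1/2) \<odot>\<^bsub>U\<^esub> uea_mult r'"
    and N: "N \<ge> 1"
    and T: "T = boundary_algebra N k"
    and \<kappa>: "(\<forall>i\<in>{1..N}. \<kappa> i = place1 N k i \<kappa>core \<oplus>\<^bsub>T\<^esub> place2 N k 0 i rp) \<or>
            (\<forall>i\<in>{1..N}. \<kappa> i = place1 N k i \<kappa>core \<oplus>\<^bsub>T\<^esub> place2 N k (N + 1) i rp) \<or>
            (\<forall>i\<in>{1..N}. \<kappa> i = place1 N k i \<kappa>core \<oplus>\<^bsub>T\<^esub> place2 N k 0 i rp
                                  \<oplus>\<^bsub>T\<^esub> place2 N k (N + 1) i rp)"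
    and A: "\<forall>i\<in>{1..N}. A i =
              (- 1/2) \<odot>\<^bsub>T\<^esub> (\<Oplus>\<^bsub>T\<^esub>s\<in>{i + 1..N}. place2 N k i s varpi) \<oplus>\<^bsub>T\<^esub>
              (\<kappa> i
                \<oplus>\<^bsub>T\<^esub> (1/2) \<odot>\<^bsub>T\<^esub> (\<Oplus>\<^bsub>T\<^esub>s\<in>{1..N} - {i}. place2 N k s i r)
                \<oplus>\<^bsub>T\<^esub> (1/2) \<odot>\<^bsub>T\<^esub> (\<Oplus>\<^bsub>T\<^esub>s\<in>{1..N} - {i}. place2 N k s i r'))"
  shows "r' = - ((1/2) *\<^sub>C varpi_h)
              - (\<Sum>\<alpha>\<in>Rp. exp (\<alpha> y) *\<^sub>C tensor (e (- \<alpha>)) (e (- \<alpha>))) \<and>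
         rp = (1/2) *\<^sub>C (\<Sum>\<alpha>\<in>Rp. tensor (e \<alpha> - exp (\<alpha> y) *\<^sub>C e (- \<alpha>)) (e (- \<alpha>))) \<and>
         rp \<in> subtensor k UNIV \<and>
         \<kappa>core = (- 1/4) \<odot>\<^bsub>U\<^esub> uea_mult varpi_h \<oplus>\<^bsub>U\<^esub>
           (- 1/2) \<odot>\<^bsub>U\<^esub> (\<Oplus>\<^bsub>U\<^esub>\<alpha>\<in>Rp. exp (\<alpha> y) \<odot>\<^bsub>U\<^esub>
             (uea_in UNIV (e (- \<alpha>)) \<otimes>\<^bsub>U\<^esub> uea_in UNIV (e (- \<alpha>)))) \<and>
         (\<forall>i\<in>{1..N}. A i \<in> carrier T) \<and>
         (\<forall>i\<in>{1..N}. \<forall>j\<in>{1..N}. A i \<otimes>\<^bsub>T\<^esub> A j = A j \<otimes>\<^bsub>T\<^esub> A i)"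
proof -
  \<comment> \<open>Every element of the coset lies in h, because the coweight lattice does.\<close>
  have yh: "y \<in> h"
  proof -
    obtain z p where "z \<in> h" "y = z + (2 * complex_of_real pi * \<i>) *\<^sub>C p" "p \<in> h"
      using Y y by (auto simp: torus_def coweight_lattice_def)
    moreover have "cvec.subspace h" using cartan by (simp add: cartan_subalgebra_def lie_subalgebra_def)
    ultimately show ?thesis by (simp add: cvec.subspace_add cvec.subspace_scale)
  qed
  interpret cb: chevalley_basis h \<sigma> X Rp e y
    by (intro chevalley_basis.intro chevalley.intro chevalley_basis_axioms.intro simple cartan chevalley basis pos root_vectors yh)
  have eqs: "\<tau> = cb.\<tau>" "k = cb.k" "varpi_h = cb.varpi_h" "varpi = cb.varpi" "r = cb.r" "r' = cb.r'" "rp = cb.rp"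
    by (simp_all add: \<tau> k varpi_h varpi r r' rp cb.\<tau>_def cb.k_def cb.varpi_h_def cb.varpi_def cb.r_def cb.r'_def cb.rp_def)
  have kc: "\<kappa>core = (1/2) \<odot>\<^bsub>uea UNIV\<^esub> uea_mult cb.r'" by (simp add: \<kappa>core U eqs)
  have A': "A i =
       (- 1/2) \<odot>\<^bsub>boundary_algebra N cb.k\<^esub> (\<Oplus>\<^bsub>boundary_algebra N cb.k\<^esub>s\<in>{i + 1..N}. place2 N cb.k i s cb.varpi) \<oplus>\<^bsub>boundary_algebra N cb.k\<^esub>
              (\<kappa> i
                \<oplus>\<^bsub>boundary_algebra N cb.k\<^esub> (1/2) \<odot>\<^bsub>boundary_algebra N cb.k\<^esub> (\<Oplus>\<^bsub>boundary_algebra N cb.k\<^esub>s\<in>{1..N} - {i}. place2 N cb.k s i cb.r)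
                \<oplus>\<^bsub>boundary_algebra N cb.k\<^esub> (1/2) \<odot>\<^bsub>boundary_algebra N cb.k\<^esub> (\<Oplus>\<^bsub>boundary_algebra N cb.k\<^esub>s\<in>{1..N} - {i}. place2 N cb.k s i cb.r'))"
    if "i \<in> {1..N}" for i
    using A that unfolding T eqs(2,4-6) by blast
  have "(\<forall>i\<in>{1..N}. A i \<in> carrier T) \<and> (\<forall>i\<in>{1..N}. \<forall>j\<in>{1..N}. A i \<otimes>\<^bsub>T\<^esub> A j = A j \<otimes>\<^bsub>T\<^esub> A i)"
    using \<kappa>
  proof (elim disjE)
    assume a: "\<forall>i\<in>{1..N}. \<kappa> i = place1 N k i \<kappa>core \<oplus>\<^bsub>T\<^esub> place2 N k 0 i rp"
    \<comment> \<open>The three choices of \<kappa> correspond to the coupled boundary sites {0}, {N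
      + 1} and {0, N + 1}.\<close>
    interpret bs: boundary_setup h \<sigma> X Rp e y N "{0}" by unfold_locales simp
    have "\<kappa> i \<in> carrier bs.bs.T \<and> bs.bs.T.emb (\<kappa> i) =
        bs.bs.T.emb (place1 N cb.k i bs.\<kappa>core) + (\<Sum>s\<in>{0}. bs.bs.T.emb (place2 N cb.k s i cb.rp))" if "i \<in> {1..N}" for i
      using a that bs.place1_\<kappa>core(1)[OF that] bs.place2_rp(1)[OF _ that]
      by (simp add: T eqs(2,7) kc bs.bs.T.emb_add)
    from bs.hamiltonians_commute[OF this A'] show ?thesis by (simp add: T eqs(2))
  next
    assume a: "\<forall>i\<in>{1..N}. \<kappa> i = place1 N k i \<kappa>core \<oplus>\<^bsub>T\<^esub> place2 N k (N + 1) i rp"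
    interpret bs: boundary_setup h \<sigma> X Rp e y N "{N + 1}" by unfold_locales simp
    have "\<kappa> i \<in> carrier bs.bs.T \<and> bs.bs.T.emb (\<kappa> i) =
        bs.bs.T.emb (place1 N cb.k i bs.\<kappa>core) + (\<Sum>s\<in>{N + 1}. bs.bs.T.emb (place2 N cb.k s i cb.rp))" if "i \<in> {1..N}" for i
      using a that bs.place1_\<kappa>core(1)[OF that] bs.place2_rp(1)[OF _ that]
      by (simp add: T eqs(2,7) kc bs.bs.T.emb_add)
    from bs.hamiltonians_commute[OF this A'] show ?thesis by (simp add: T eqs(2))
  next
    assume a: "\<forall>i\<in>{1..N}. \<kappa> i = place1 N k i \<kappa>core \<oplus>\<^bsub>T\<^esub> place2 N k 0 i rp \<oplus>\<^bsub>T\<^esub> place2 N k (N + 1) i rp"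
    interpret bs: boundary_setup h \<sigma> X Rp e y N "{0, N + 1}" by unfold_locales simp
    have "\<kappa> i \<in> carrier bs.bs.T \<and> bs.bs.T.emb (\<kappa> i) =
        bs.bs.T.emb (place1 N cb.k i bs.\<kappa>core) + (\<Sum>s\<in>{0, N + 1}. bs.bs.T.emb (place2 N cb.k s i cb.rp))" if "i \<in> {1..N}" for i
      using a that bs.place1_\<kappa>core(1)[OF that] bs.place2_rp(1)[OF _ that]
      by (simp add: T eqs(2,7) kc bs.bs.T.emb_add add.assoc)
    from bs.hamiltonians_commute[OF this A'] show ?thesis by (simp add: T eqs(2))
  qed
  moreover have "r' = - ((1/2) *\<^sub>C varpi_h) - (\<Sum>\<alpha>\<in>Rp. exp (\<alpha> y) *\<^sub>C tensor (e (- \<alpha>)) (e (- \<alpha>)))"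
    unfolding eqs by (rule cb.r'_eq)
  moreover have "rp = (1/2) *\<^sub>C (\<Sum>\<alpha>\<in>Rp. tensor (e \<alpha> - exp (\<alpha> y) *\<^sub>C e (- \<alpha>)) (e (- \<alpha>)))"
    unfolding eqs using cb.rp_eq unfolding cb.f_def .
  moreover have "rp \<in> subtensor k UNIV"
    unfolding eqs by (rule cb.rp_subtensor)
  moreover have "\<kappa>core = (- 1/4) \<odot>\<^bsub>U\<^esub> uea_mult varpi_h \<oplus>\<^bsub>U\<^esub>
           (- 1/2) \<odot>\<^bsub>U\<^esub> (\<Oplus>\<^bsub>U\<^esub>\<alpha>\<in>Rp. exp (\<alpha> y) \<odot>\<^bsub>U\<^esub>
             (uea_in UNIV (e (- \<alpha>)) \<otimes>\<^bsub>U\<^esub> uea_in UNIV (e (- \<alpha>))))"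
    unfolding kc U eqs(3) by (rule cb.uea_mult_eq)
  ultimately show ?thesis by blast
qed

end
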